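(* Let $H_1$ and $H_2$ be bialgebras over $\Bbbk$, let $\mathcal{F}_1\in H_1\otimes H_1$ and $\mathcal{F}_2\in H_2\otimes H_2$ be twists on $H_1$ and $H_2$, respectively, and let $\mathcal{R}\in H_2\otimes H_1$ be a weak $\mathcal{R}$-matrix of $((H_2)_{\mathcal{F}_2},(H_1)_{\mathcal{F}_1})$. Then $$\mathcal{F}:=(1_{H_1}\otimes\mathcal{R}^{-1}\otimes1_{H_2})\big((\mathrm{Id}_{H_1}\otimes\tau\otimes\mathrm{Id}_{H_2})(\mathcal{F}_1\otimes\mathcal{F}_2)\big)$$ is a twist on the tensor product bialgebra $H_1\otimes H_2$.
   Context: $\Bbbk$ is an arbitrary field; bialgebras and tensor products are over $\Bbbk$. $\tau$ denotes the canonical flip of vector spaces and $\varepsilon$ the counit. The tensor product bialgebra $H_1\otimes H_2$ has componentwise multiplication, unit $1\otimes 1$, comultiplication $(\mathrm{Id}\otimes\tau\otimes\mathrm{Id})(\Delta_{H_1}\otimes\Delta_{H_2})$ and counit $\varepsilon\otimes\varepsilon$. A twist on a bialgebra $H$ is an invertible element $\mathcal{F}\in H\otimes H$ with $(\mathcal{F}\otimes1)(\Delta\otimes\mathrm{Id})(\mathcal{F})=(1\otimes\mathcal{F})(\mathrm{Id}\otimes\Delta)(\mathcal{F})$ and $(\varepsilon\otimes\mathrm{Id})(\mathcal{F})=1=(\mathrm{Id}\otimes\varepsilon)(\mathcal{F})$. Then $H_{\mathcal{F}}$ denotes the bialgebra with the same algebra structure and counit as $H$ and comultiplication $\Delta_{\mathcal{F}}(\cdot)=\mathcal{F}\Delta(\cdot)\mathcal{F}^{-1}$.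 For bialgebras $A,B$, an invertible element $\mathcal{R}\in A\otimes B$ is a weak $\mathcal{R}$-matrix of $(A,B)$ if $(\mathrm{Id}_A\otimes\Delta_B)(\mathcal{R})=\mathcal{R}_{13}\mathcal{R}_{12}$ in $A\otimes B\otimes B$ and $(\Delta_A\otimes\mathrm{Id}_B)(\mathcal{R})=\mathcal{R}_{13}\mathcal{R}_{23}$ in $A\otimes A\otimes B$, with the usual leg notation. *)

theory Defs
  imports "HOL-Algebra.RingHom" "HOL-Algebra.Module"
begin

section \<open>Tensor products of vector spaces\<close>

text \<open>
  The tensor product of \<open>A\<close> and \<open>B\<close> over \<open>K\<close> is the quotient of the free vector space on the set
  \<open>carrier A \<times> carrier B\<close> by the subspace generated by the bilinearity relations.  Its elements
  are cosets of finitely supported functions, so the carrier type is \<open>('a \<times> 'b \<Rightarrow> 'k) set\<close>.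
\<close>

type_synonym ('k, 'a, 'b) tensor = "('a \<times> 'b \<Rightarrow> 'k) set"

text \<open>Library modules are records that extend rings.  The \<open>mult\<close> and \<open>one\<close> fields of
  \<open>free_vs\<close> and \<open>tensor_vs\<close> are meaningless and never used.\<close>

definition free_vs :: "('k, 'r) ring_scheme \<Rightarrow> 'x set \<Rightarrow> ('k, 'x \<Rightarrow> 'k) module" where
  "free_vs K S =
    \<lparr>carrier = {f. (\<forall>x. f x \<in> carrier K) \<and> (\<forall>x. x \<notin> S \<longrightarrow> f x = \<zero>\<^bsub>K\<^esub>) \<and> finite {x. f x \<noteq> \<zero>\<^bsub>K\<^esub>}},
     mult = undefined, one = undefined,
     zero = (\<lambda>x. \<zero>\<^bsub>K\<^esub>), add = (\<lambda>f g x. f x \<oplus>\<^bsub>K\<^esub> g x),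
     smult = (\<lambda>c f x. c \<otimes>\<^bsub>K\<^esub> f x)\<rparr>"

definition basis_fun :: "('k, 'r) ring_scheme \<Rightarrow> 'x \<Rightarrow> 'x \<Rightarrow> 'k" where
  "basis_fun K p = (\<lambda>x. if x = p then \<one>\<^bsub>K\<^esub> else \<zero>\<^bsub>K\<^esub>)"

definition tensor_relators ::
    "('k, 'r) ring_scheme \<Rightarrow> ('k, 'a, 'm) module_scheme \<Rightarrow> ('k, 'b, 'n) module_scheme
      \<Rightarrow> ('a \<times> 'b \<Rightarrow> 'k) set" where
  "tensor_relators K A B =
    (let V = free_vs K (carrier A \<times> carrier B); e = (\<lambda>a b. basis_fun K (a, b)) in
      {e (a \<oplus>\<^bsub>A\<^esub> a') b \<ominus>\<^bsub>V\<^esub> (e a b \<oplus>\<^bsub>V\<^esub> e a' b) | a a' b.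
         a \<in> carrier A \<and> a' \<in> carrier A \<and> b \<in> carrier B} \<union>
      {e a (b \<oplus>\<^bsub>B\<^esub> b') \<ominus>\<^bsub>V\<^esub> (e a b \<oplus>\<^bsub>V\<^esub> e a b') | a b b'.
         a \<in> carrier A \<and> b \<in> carrier B \<and> b' \<in> carrier B} \<union>
      {e (c \<odot>\<^bsub>A\<^esub> a) b \<ominus>\<^bsub>V\<^esub> c \<odot>\<^bsub>V\<^esub> e a b | c a b.
         c \<in> carrier K \<and> a \<in> carrier A \<and> b \<in> carrier B} \<union>
      {e a (c \<odot>\<^bsub>B\<^esub> b) \<ominus>\<^bsub>V\<^esub> c \<odot>\<^bsub>V\<^esub> e a b | c a b.
         c \<in> carrier K \<and> a \<in> carrier A \<and> b \<in> carrier B})"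

definition tensor_null ::
    "('k, 'r) ring_scheme \<Rightarrow> ('k, 'a, 'm) module_scheme \<Rightarrow> ('k, 'b, 'n) module_scheme
      \<Rightarrow> ('a \<times> 'b \<Rightarrow> 'k) set" where
  "tensor_null K A B =
    \<Inter> {N. submodule N K (free_vs K (carrier A \<times> carrier B)) \<and> tensor_relators K A B \<subseteq> N}"

definition tensor_vs ::
    "('k, 'r) ring_scheme \<Rightarrow> ('k, 'a, 'm) module_scheme \<Rightarrow> ('k, 'b, 'n) module_scheme
      \<Rightarrow> ('k, ('k, 'a, 'b) tensor) module" where
  "tensor_vs K A B =
    (let V = free_vs K (carrier A \<times> carrier B); N = tensor_null K A B in
      \<lparr>carrier = a_rcosets\<^bsub>V\<^esub> N,
       mult = undefined, one = undefined,
       zero = N, add = (\<lambda>X Y. X <+>\<^bsub>V\<^esub> Y),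
       smult = (\<lambda>c X. \<Union>f\<in>X. N +>\<^bsub>V\<^esub> (c \<odot>\<^bsub>V\<^esub> f))\<rparr>)"

text \<open>The pure tensor of \<open>a\<close> and \<open>b\<close>.\<close>

definition ptens ::
    "('k, 'r) ring_scheme \<Rightarrow> ('k, 'a, 'm) module_scheme \<Rightarrow> ('k, 'b, 'n) module_scheme
      \<Rightarrow> 'a \<Rightarrow> 'b \<Rightarrow> ('k, 'a, 'b) tensor" where
  "ptens K A B a b =
    tensor_null K A B +>\<^bsub>free_vs K (carrier A \<times> carrier B)\<^esub> basis_fun K (a, b)"

text \<open>
  The linear map \<open>A \<otimes> B \<rightarrow> M\<close> induced by a bilinear map \<open>\<phi> : A \<times> B \<rightarrow> M\<close>: choose a
  representative and extend \<open>\<phi>\<close> linearly; for bilinear \<open>\<phi>\<close> the value does not depend on the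
  choice (see \<open>tensor_lift_ptens\<close> and \<open>tensor_lift_linear\<close> below).
\<close>

definition tensor_lift ::
    "('k, 'r) ring_scheme \<Rightarrow> ('k, 'a, 'm) module_scheme \<Rightarrow> ('k, 'b, 'n) module_scheme
      \<Rightarrow> ('k, 'c, 'l) module_scheme \<Rightarrow> ('a \<Rightarrow> 'b \<Rightarrow> 'c) \<Rightarrow> ('k, 'a, 'b) tensor \<Rightarrow> 'c" where
  "tensor_lift K A B M \<phi> t =
    (let f = (SOME f. f \<in> t) in
      \<Oplus>\<^bsub>M\<^esub>p\<in>{p. f p \<noteq> \<zero>\<^bsub>K\<^esub>}. f p \<odot>\<^bsub>M\<^esub> \<phi> (fst p) (snd p))"

definition linear_maps ::
    "('k, 'r) ring_scheme \<Rightarrow> ('k, 'a, 'm) module_scheme \<Rightarrow> ('k, 'b, 'n) module_scheme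
      \<Rightarrow> ('a \<Rightarrow> 'b) set" where
  "linear_maps K A B =
    {h \<in> carrier A \<rightarrow> carrier B.
      (\<forall>x\<in>carrier A. \<forall>y\<in>carrier A. h (x \<oplus>\<^bsub>A\<^esub> y) = h x \<oplus>\<^bsub>B\<^esub> h y) \<and>
      (\<forall>c\<in>carrier K. \<forall>x\<in>carrier A. h (c \<odot>\<^bsub>A\<^esub> x) = c \<odot>\<^bsub>B\<^esub> h x)}"

definition bilinear_maps ::
    "('k, 'r) ring_scheme \<Rightarrow> ('k, 'a, 'm) module_scheme \<Rightarrow> ('k, 'b, 'n) module_scheme
      \<Rightarrow> ('k, 'c, 'l) module_scheme \<Rightarrow> ('a \<Rightarrow> 'b \<Rightarrow> 'c) set" where
  "bilinear_maps K A B M =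
    {\<phi>. (\<forall>a\<in>carrier A. \<phi> a \<in> linear_maps K B M) \<and>
         (\<forall>b\<in>carrier B. (\<lambda>a. \<phi> a b) \<in> linear_maps K A M)}"

section \<open>The universal property of the tensor product\<close>

text \<open>
  Pure tensors are bilinear (\<open>ptens_bilinear\<close>), a bilinear map extends to the linear map
  \<open>tensor_lift\<close> (\<open>tensor_lift_linear\<close>, \<open>tensor_lift_ptens\<close>), and the extension is unique
  (\<open>linear_map_ext\<close>).
\<close>

lemma free_vs_sel [simp]:
  "carrier (free_vs K S) = {f. (\<forall>x. f x \<in> carrier K) \<and> (\<forall>x. x \<notin> S \<longrightarrow> f x = \<zero>\<^bsub>K\<^esub>) \<and> finite {x. f x \<noteq> \<zero>\<^bsub>K\<^esub>}}"
  "zero (free_vs K S) = (\<lambda>x. \<zero>\<^bsub>K\<^esub>)"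
  "add (free_vs K S) f g = (\<lambda>x. f x \<oplus>\<^bsub>K\<^esub> g x)"
  "smult (free_vs K S) c f = (\<lambda>x. c \<otimes>\<^bsub>K\<^esub> f x)"
  by (simp_all add: free_vs_def)

lemma free_vs_module:
  assumes "cring K" shows "module K (free_vs K S)"
proof -
  interpret K: cring K by fact
  have fin2: "finite {x. f x \<oplus>\<^bsub>K\<^esub> g x \<noteq> \<zero>\<^bsub>K\<^esub>}"
    if "finite {x. f x \<noteq> \<zero>\<^bsub>K\<^esub>}" "finite {x. g x \<noteq> \<zero>\<^bsub>K\<^esub>}" for f g :: "'x \<Rightarrow> 'a"
    by (rule finite_subset[OF _ finite_UnI[OF that]]) auto
  have fins: "finite {x. c \<otimes>\<^bsub>K\<^esub> f x \<noteq> \<zero>\<^bsub>K\<^esub>}"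
    if "finite {x. f x \<noteq> \<zero>\<^bsub>K\<^esub>}" "c \<in> carrier K" for f :: "'x \<Rightarrow> 'a" and c
    by (rule finite_subset[OF _ that(1)]) (auto simp: that)
  have fini: "finite {x. \<ominus>\<^bsub>K\<^esub> f x \<noteq> \<zero>\<^bsub>K\<^esub>}"
    if "finite {x. f x \<noteq> \<zero>\<^bsub>K\<^esub>}" for f :: "'x \<Rightarrow> 'a"
    by (rule finite_subset[OF _ that(1)]) auto
  show ?thesis
  proof (rule moduleI)
    show "abelian_group (free_vs K S)"
    proof (rule abelian_groupI)
      fix x assume x: "x \<in> carrier (free_vs K S)"
      show "\<exists>y\<in>carrier (free_vs K S). y \<oplus>\<^bsub>free_vs K S\<^esub> x = \<zero>\<^bsub>free_vs K S\<^esub>"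
        by (rule bexI[of _ "\<lambda>p. \<ominus>\<^bsub>K\<^esub> x p"]) (use x in \<open>auto simp: K.l_neg fini\<close>)
    qed (auto simp: fin2 K.a_ac fun_eq_iff)
  qed (auto simp: assms fins fin2 K.l_distr K.r_distr K.m_assoc fun_eq_iff)
qed

definition linext where
  "linext K M \<phi> f = (\<Oplus>\<^bsub>M\<^esub>p\<in>{p. f p \<noteq> \<zero>\<^bsub>K\<^esub>}. f p \<odot>\<^bsub>M\<^esub> \<phi> p)"

lemma linext_superset:
  assumes "module K M" "\<phi> \<in> S \<rightarrow> carrier M" "f \<in> carrier (free_vs K S)" "finite T" "{p. f p \<noteq> \<zero>\<^bsub>K\<^esub>} \<subseteq> T" "T \<subseteq> S"
  shows "linext K M \<phi> f = (\<Oplus>\<^bsub>M\<^esub>p\<in>T. f p \<odot>\<^bsub>M\<^esub> \<phi> p)"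
proof -
  interpret module K M by fact
  show ?thesis unfolding linext_def
    by (rule M.add.finprod_mono_neutral_cong_left) (use assms(2-) in \<open>auto simp: Pi_iff\<close>)
qed

lemma linext_linear:
  assumes "module K M" "\<phi> \<in> S \<rightarrow> carrier M"
  shows "linext K M \<phi> \<in> linear_maps K (free_vs K S) M"
proof -
  interpret module K M by fact
  have cl: "linext K M \<phi> f \<in> carrier M" if "f \<in> carrier (free_vs K S)" for f
    unfolding linext_def by (rule M.finsum_closed) (use that assms(2) in \<open>auto simp: Pi_iff\<close>)
  interpret V: module K "free_vs K S" by (rule free_vs_module) (rule R.is_cring)
  have sub: "{p. f p \<noteq> \<zero>\<^bsub>K\<^esub>} \<subseteq> S" "finite {p. f p \<noteq> \<zero>\<^bsub>K\<^esub>}" if "f \<in> carrier (free_vs K S)" for f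
    using that by auto
  show ?thesis unfolding linear_maps_def
  proof (intro CollectI conjI ballI)
    show "linext K M \<phi> \<in> carrier (free_vs K S) \<rightarrow> carrier M" using cl by auto
  next
    fix f g assume f: "f \<in> carrier (free_vs K S)" and g: "g \<in> carrier (free_vs K S)"
    let ?T = "{p. f p \<noteq> \<zero>\<^bsub>K\<^esub>} \<union> {p. g p \<noteq> \<zero>\<^bsub>K\<^esub>}"
    have T: "finite ?T" "?T \<subseteq> S" using sub[OF f] sub[OF g] by auto
    have "linext K M \<phi> (f \<oplus>\<^bsub>free_vs K S\<^esub> g) = (\<Oplus>\<^bsub>M\<^esub>p\<in>?T. (f \<oplus>\<^bsub>free_vs K S\<^esub> g) p \<odot>\<^bsub>M\<^esub> \<phi> p)"
      by (rule linext_superset[OF assms V.M.a_closed[OF f g] T(1) _ T(2)]) (use f g in auto)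
    also have "\<dots> = (\<Oplus>\<^bsub>M\<^esub>p\<in>?T. f p \<odot>\<^bsub>M\<^esub> \<phi> p \<oplus>\<^bsub>M\<^esub> g p \<odot>\<^bsub>M\<^esub> \<phi> p)"
      by (rule M.finsum_cong') (use T f g assms(2) in \<open>auto simp: Pi_iff smult_l_distr subset_iff\<close>)
    also have "\<dots> = (\<Oplus>\<^bsub>M\<^esub>p\<in>?T. f p \<odot>\<^bsub>M\<^esub> \<phi> p) \<oplus>\<^bsub>M\<^esub> (\<Oplus>\<^bsub>M\<^esub>p\<in>?T. g p \<odot>\<^bsub>M\<^esub> \<phi> p)"
      by (rule M.finsum_addf) (use T f g assms(2) in \<open>auto simp: Pi_iff subset_iff\<close>)
    also have "\<dots> = linext K M \<phi> f \<oplus>\<^bsub>M\<^esub> linext K M \<phi> g"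
      using linext_superset[OF assms f T(1) _ T(2)] linext_superset[OF assms g T(1) _ T(2)] by auto
    finally show "linext K M \<phi> (f \<oplus>\<^bsub>free_vs K S\<^esub> g) = linext K M \<phi> f \<oplus>\<^bsub>M\<^esub> linext K M \<phi> g" .
  next
    fix c f assume c: "c \<in> carrier K" and f: "f \<in> carrier (free_vs K S)"
    have mem: "i \<in> S" if "f i \<noteq> \<zero>\<^bsub>K\<^esub>" for i
      using f that by auto
    have "linext K M \<phi> (c \<odot>\<^bsub>free_vs K S\<^esub> f) = (\<Oplus>\<^bsub>M\<^esub>p\<in>{p. f p \<noteq> \<zero>\<^bsub>K\<^esub>}. (c \<odot>\<^bsub>free_vs K S\<^esub> f) p \<odot>\<^bsub>M\<^esub> \<phi> p)"
      by (rule linext_superset[OF assms V.smult_closed[OF c f] sub(2)[OF f] _ sub(1)[OF f]]) (use c f in auto)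
    also have "\<dots> = (\<Oplus>\<^bsub>M\<^esub>p\<in>{p. f p \<noteq> \<zero>\<^bsub>K\<^esub>}. c \<odot>\<^bsub>M\<^esub> (f p \<odot>\<^bsub>M\<^esub> \<phi> p))"
      by (rule M.finsum_cong') (use c f assms(2) mem in \<open>auto simp: Pi_iff smult_assoc1\<close>)
    also have "\<dots> = c \<odot>\<^bsub>M\<^esub> linext K M \<phi> f"
      unfolding linext_def
      by (rule finsum_smult_ldistr[symmetric]) (use c f assms(2) in \<open>auto simp: Pi_iff\<close>)
    finally show "linext K M \<phi> (c \<odot>\<^bsub>free_vs K S\<^esub> f) = c \<odot>\<^bsub>M\<^esub> linext K M \<phi> f" .
  qed
qed


declare free_vs_sel [simp del]

locale tensor_pair = A: module K A + B: module K B
  for K (structure) and A (structure) and B (structure)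
begin

abbreviation "V \<equiv> free_vs K (carrier A \<times> carrier B)"
abbreviation "N \<equiv> tensor_null K A B"
abbreviation "e a b \<equiv> basis_fun K (a, b)"

sublocale V: module K V by (rule free_vs_module) (rule A.R.is_cring)

lemma basis_in: "a \<in> carrier A \<Longrightarrow> b \<in> carrier B \<Longrightarrow> e a b \<in> carrier V"
  by (auto simp: free_vs_sel basis_fun_def intro: finite_subset[of _ "{(a,b)}"])

lemma relators_sub: "tensor_relators K A B \<subseteq> carrier V"
  unfolding tensor_relators_def Let_def a_minus_def
  by (auto intro!: V.M.a_closed V.M.a_inv_closed basis_in V.smult_closed)

lemma N_submodule: "submodule N K V"
proof (rule V.submoduleI)
  note E = V.submoduleE
  let ?F = "{N. submodule N K V \<and> tensor_relators K A B \<subseteq> N}"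
  have mem: "carrier V \<in> ?F" using relators_sub V.carrier_is_submodule by auto
  show "N \<subseteq> carrier V" unfolding tensor_null_def using mem by (rule Inter_lower)
  show "\<zero>\<^bsub>V\<^esub> \<in> N" unfolding tensor_null_def
    using subgroup.one_closed[OF submodule.axioms(1)] by fastforce
  show "\<ominus>\<^bsub>V\<^esub> a \<in> N" if "a \<in> N" for a using that E(3) unfolding tensor_null_def by blast
  show "a \<oplus>\<^bsub>V\<^esub> b \<in> N" if "a \<in> N" "b \<in> N" for a b using that E(5) unfolding tensor_null_def by blast
  show "c \<odot>\<^bsub>V\<^esub> a \<in> N" if "c \<in> carrier K" "a \<in> N" for c a using that E(4) unfolding tensor_null_def by blast
qed

lemma relators_N: "tensor_relators K A B \<subseteq> N"
  unfolding tensor_null_def by blast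

sublocale N: abelian_subgroup N V
  by (rule abelian_subgroupI3)
     (simp_all add: additive_subgroup.intro submodule.axioms(1)[OF N_submodule] V.M.abelian_group_axioms)

abbreviation "cl f \<equiv> N +>\<^bsub>V\<^esub> f"

lemma cl_carrier [simp]: "f \<in> carrier V \<Longrightarrow> cl f \<in> carrier (tensor_vs K A B)"
  unfolding tensor_vs_def Let_def by (auto simp: A_RCOSETS_def' )

lemma carrier_tvs: "carrier (tensor_vs K A B) = cl ` carrier V"
  unfolding tensor_vs_def Let_def by (auto simp: A_RCOSETS_def' )

lemma cl_self: "f \<in> carrier V \<Longrightarrow> f \<in> cl f"
  by (rule N.a_rcos_self)

lemma cl_mem: "g \<in> cl f \<longleftrightarrow> (\<exists>h\<in>N. g = h \<oplus>\<^bsub>V\<^esub> f)"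
  by (auto simp: a_r_coset_def')

lemma cl_eqI: "f \<in> carrier V \<Longrightarrow> g \<in> cl f \<Longrightarrow> cl g = cl f"
  using N.a_repr_independence' by metis

lemma N_sub: "h \<in> N \<Longrightarrow> h \<in> carrier V"
  using N.a_subset by blast

lemma add_cl: "f \<in> carrier V \<Longrightarrow> g \<in> carrier V \<Longrightarrow> cl f \<oplus>\<^bsub>tensor_vs K A B\<^esub> cl g = cl (f \<oplus>\<^bsub>V\<^esub> g)"
  unfolding tensor_vs_def Let_def by (simp add: N.a_rcos_sum)

lemma smult_cl:
  assumes "c \<in> carrier K" "f \<in> carrier V"
  shows "c \<odot>\<^bsub>tensor_vs K A B\<^esub> cl f = cl (c \<odot>\<^bsub>V\<^esub> f)"
proof -
  have "cl (c \<odot>\<^bsub>V\<^esub> g) = cl (c \<odot>\<^bsub>V\<^esub> f)" if g: "g \<in> cl f" for g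
  proof (rule cl_eqI)
    from g obtain h where h: "h \<in> N" "g = h \<oplus>\<^bsub>V\<^esub> f" by (auto simp: cl_mem)
    then show "c \<odot>\<^bsub>V\<^esub> g \<in> cl (c \<odot>\<^bsub>V\<^esub> f)"
      using assms V.submoduleE(4)[OF N_submodule, of c h]
      by (auto simp: cl_mem V.smult_r_distr N_sub)
  qed (use assms in auto)
  then have "(\<Union>g\<in>cl f. cl (c \<odot>\<^bsub>V\<^esub> g)) = (\<Union>g\<in>cl f. cl (c \<odot>\<^bsub>V\<^esub> f))"
    by (rule SUP_cong[OF refl])
  also have "\<dots> = cl (c \<odot>\<^bsub>V\<^esub> f)" using cl_self[OF assms(2)] by blast
  finally show ?thesis by (simp add: tensor_vs_def Let_def)
qed

lemma zero_tvs: "\<zero>\<^bsub>tensor_vs K A B\<^esub> = cl \<zero>\<^bsub>V\<^esub>"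
  unfolding tensor_vs_def Let_def using N.a_subset by (simp add: V.M.a_coset_add_zero)

lemma tensor_vs_module: "module K (tensor_vs K A B)"
proof (rule moduleI)
  show "cring K" by (rule A.R.is_cring)
  show "abelian_group (tensor_vs K A B)"
  proof (rule abelian_groupI)
    fix X assume "X \<in> carrier (tensor_vs K A B)"
    then obtain f where f: "f \<in> carrier V" "X = cl f" by (auto simp: carrier_tvs)
    show "\<exists>Y\<in>carrier (tensor_vs K A B). Y \<oplus>\<^bsub>tensor_vs K A B\<^esub> X = \<zero>\<^bsub>tensor_vs K A B\<^esub>"
      by (rule bexI[of _ "cl (\<ominus>\<^bsub>V\<^esub> f)"]) (use f in \<open>auto simp: add_cl zero_tvs V.M.l_neg\<close>)
  qed (auto simp: carrier_tvs add_cl zero_tvs V.M.a_ac)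
qed (auto simp: carrier_tvs add_cl smult_cl V.smult_l_distr V.smult_r_distr V.smult_assoc1)

lemma ptens_def': "ptens K A B a b = cl (e a b)" by (simp add: ptens_def)

lemma ptens_relI:
  assumes "f \<in> carrier V" "g \<in> carrier V" "f \<ominus>\<^bsub>V\<^esub> g \<in> N"
  shows "cl f = cl g"
proof (rule cl_eqI[OF assms(2)])
  have "f = (f \<ominus>\<^bsub>V\<^esub> g) \<oplus>\<^bsub>V\<^esub> g" using assms by (simp add: a_minus_def V.M.a_assoc V.M.l_neg)
  then show "f \<in> cl g" using assms(3) by (auto simp: cl_mem)
qed

lemma ptens_bilinear: "ptens K A B \<in> bilinear_maps K A B (tensor_vs K A B)"
proof -
  have "cl (e (a \<oplus>\<^bsub>A\<^esub> a') b) = cl (e a b \<oplus>\<^bsub>V\<^esub> e a' b)"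
    if "a \<in> carrier A" "a' \<in> carrier A" "b \<in> carrier B" for a a' b
  proof (rule ptens_relI)
    have "e (a \<oplus>\<^bsub>A\<^esub> a') b \<ominus>\<^bsub>V\<^esub> (e a b \<oplus>\<^bsub>V\<^esub> e a' b) \<in> tensor_relators K A B"
      unfolding tensor_relators_def Let_def using that by blast
    then show "e (a \<oplus>\<^bsub>A\<^esub> a') b \<ominus>\<^bsub>V\<^esub> (e a b \<oplus>\<^bsub>V\<^esub> e a' b) \<in> N" using relators_N by blast
  qed (use that in \<open>auto intro!: basis_in\<close>)
  moreover have "cl (e a (b \<oplus>\<^bsub>B\<^esub> b')) = cl (e a b \<oplus>\<^bsub>V\<^esub> e a b')"
    if "a \<in> carrier A" "b \<in> carrier B" "b' \<in> carrier B" for a b b'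
  proof (rule ptens_relI)
    have "e a (b \<oplus>\<^bsub>B\<^esub> b') \<ominus>\<^bsub>V\<^esub> (e a b \<oplus>\<^bsub>V\<^esub> e a b') \<in> tensor_relators K A B"
      unfolding tensor_relators_def Let_def using that by blast
    then show "e a (b \<oplus>\<^bsub>B\<^esub> b') \<ominus>\<^bsub>V\<^esub> (e a b \<oplus>\<^bsub>V\<^esub> e a b') \<in> N" using relators_N by blast
  qed (use that in \<open>auto intro!: basis_in\<close>)
  moreover have "cl (e (c \<odot>\<^bsub>A\<^esub> a) b) = cl (c \<odot>\<^bsub>V\<^esub> e a b)"
    if "a \<in> carrier A" "c \<in> carrier K" "b \<in> carrier B" for a c b
  proof (rule ptens_relI)
    have "e (c \<odot>\<^bsub>A\<^esub> a) b \<ominus>\<^bsub>V\<^esub> c \<odot>\<^bsub>V\<^esub> e a b \<in> tensor_relators K A B"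
      unfolding tensor_relators_def Let_def using that by blast
    then show "e (c \<odot>\<^bsub>A\<^esub> a) b \<ominus>\<^bsub>V\<^esub> c \<odot>\<^bsub>V\<^esub> e a b \<in> N" using relators_N by blast
  qed (use that in \<open>auto intro!: basis_in\<close>)
  moreover have "cl (e a (c \<odot>\<^bsub>B\<^esub> b)) = cl (c \<odot>\<^bsub>V\<^esub> e a b)"
    if "a \<in> carrier A" "c \<in> carrier K" "b \<in> carrier B" for a c b
  proof (rule ptens_relI)
    have "e a (c \<odot>\<^bsub>B\<^esub> b) \<ominus>\<^bsub>V\<^esub> c \<odot>\<^bsub>V\<^esub> e a b \<in> tensor_relators K A B"
      unfolding tensor_relators_def Let_def using that by blast
    then show "e a (c \<odot>\<^bsub>B\<^esub> b) \<ominus>\<^bsub>V\<^esub> c \<odot>\<^bsub>V\<^esub> e a b \<in> N" using relators_N by blast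
  qed (use that in \<open>auto intro!: basis_in\<close>)
  ultimately show ?thesis
    by (auto simp: bilinear_maps_def linear_maps_def ptens_def' basis_in add_cl smult_cl)
qed

lemma
  assumes M: "module K M" and \<phi>: "\<phi> \<in> bilinear_maps K A B M"
  shows tensor_lift_linear: "tensor_lift K A B M \<phi> \<in> linear_maps K (tensor_vs K A B) M"
    and tensor_lift_ptens:
      "\<lbrakk>a \<in> carrier A; b \<in> carrier B\<rbrakk> \<Longrightarrow> tensor_lift K A B M \<phi> (ptens K A B a b) = \<phi> a b"
proof -
  interpret M: module K M by fact
  let ?\<phi> = "\<lambda>p. \<phi> (fst p) (snd p)"
  let ?L = "linext K M ?\<phi>"
  have \<phi>c: "?\<phi> \<in> carrier A \<times> carrier B \<rightarrow> carrier M"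
    using \<phi> by (fastforce simp: bilinear_maps_def linear_maps_def Pi_iff)
  note lin = linext_linear[OF M \<phi>c]
  have Lc: "f \<in> carrier V \<Longrightarrow> ?L f \<in> carrier M" for f
    using lin by (auto simp: linear_maps_def)
  have La: "f \<in> carrier V \<Longrightarrow> g \<in> carrier V \<Longrightarrow> ?L (f \<oplus>\<^bsub>V\<^esub> g) = ?L f \<oplus>\<^bsub>M\<^esub> ?L g" for f g
    using lin by (auto simp: linear_maps_def)
  have Ls: "c \<in> carrier K \<Longrightarrow> f \<in> carrier V \<Longrightarrow> ?L (c \<odot>\<^bsub>V\<^esub> f) = c \<odot>\<^bsub>M\<^esub> ?L f" for c f
    using lin by (auto simp: linear_maps_def)
  have L0: "?L \<zero>\<^bsub>V\<^esub> = \<zero>\<^bsub>M\<^esub>"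
    using La[of "\<zero>\<^bsub>V\<^esub>" "\<zero>\<^bsub>V\<^esub>"] Lc[of "\<zero>\<^bsub>V\<^esub>"] by (simp add: M.M.add.l_cancel_one' )
  have Lm: "?L (\<ominus>\<^bsub>V\<^esub> f) = \<ominus>\<^bsub>M\<^esub> ?L f" if "f \<in> carrier V" for f
    using La[of "\<ominus>\<^bsub>V\<^esub> f" f] that Lc L0 by (simp add: V.M.l_neg M.M.minus_equality)
  have Le: "?L (e a b) = \<phi> a b" if "a \<in> carrier A" "b \<in> carrier B" for a b
  proof -
    have "?L (e a b) = (\<Oplus>\<^bsub>M\<^esub>p\<in>{(a,b)}. e a b p \<odot>\<^bsub>M\<^esub> ?\<phi> p)"
      by (rule linext_superset[OF M \<phi>c basis_in[OF that]]) (use that in \<open>auto simp: basis_fun_def\<close>)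
    also have "\<dots> = \<phi> a b" using that \<phi>c by (auto simp: basis_fun_def Pi_iff)
    finally show ?thesis .
  qed
  have "submodule {f \<in> carrier V. ?L f = \<zero>\<^bsub>M\<^esub>} K V"
    by (rule V.submoduleI) (auto simp: L0 Lm La Ls)
  moreover have "tensor_relators K A B \<subseteq> {f \<in> carrier V. ?L f = \<zero>\<^bsub>M\<^esub>}"
    using relators_sub \<phi> \<phi>c
    by (auto simp: tensor_relators_def Let_def a_minus_def La Ls Lm Le basis_in bilinear_maps_def
        linear_maps_def M.M.r_neg Pi_iff)
  ultimately have "N \<subseteq> {f \<in> carrier V. ?L f = \<zero>\<^bsub>M\<^esub>}"
    unfolding tensor_null_def by (intro Inter_lower) auto
  then have LN: "f \<in> N \<Longrightarrow> ?L f = \<zero>\<^bsub>M\<^esub>" for f by auto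
  have T: "tensor_lift K A B M \<phi> (cl f) = ?L f" if f: "f \<in> carrier V" for f
  proof -
    have "(SOME g. g \<in> cl f) \<in> cl f" by (rule someI[of "\<lambda>g. g \<in> cl f", OF cl_self[OF f]])
    then obtain h where "h \<in> N" "(SOME g. g \<in> cl f) = h \<oplus>\<^bsub>V\<^esub> f" by (auto simp: cl_mem)
    then show ?thesis using f LN by (simp add: tensor_lift_def linext_def[symmetric] La Lc N_sub)
  qed
  show "tensor_lift K A B M \<phi> \<in> linear_maps K (tensor_vs K A B) M"
    by (auto simp: linear_maps_def carrier_tvs T Lc La Ls add_cl smult_cl)
  show "tensor_lift K A B M \<phi> (ptens K A B a b) = \<phi> a b" if "a \<in> carrier A" "b \<in> carrier B"
    using that by (simp add: ptens_def' T basis_in Le)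
qed


lemma linear_map_ext:
  assumes M: "module K M"
    and h: "h \<in> linear_maps K (tensor_vs K A B) M" and h': "h' \<in> linear_maps K (tensor_vs K A B) M"
    and eq: "\<And>a b. \<lbrakk>a \<in> carrier A; b \<in> carrier B\<rbrakk> \<Longrightarrow> h (ptens K A B a b) = h' (ptens K A B a b)"
    and t: "t \<in> carrier (tensor_vs K A B)"
  shows "h t = h' t"
proof -
  interpret M: module K M by fact
  have cr: "f \<in> carrier V \<longleftrightarrow> (\<forall>x. f x \<in> carrier K) \<and> (\<forall>x. x \<notin> carrier A \<times> carrier B \<longrightarrow> f x = \<zero>\<^bsub>K\<^esub>)
      \<and> finite {x. f x \<noteq> \<zero>\<^bsub>K\<^esub>}" for f
    by (simp add: free_vs_sel)
  have ha: "g (cl f \<oplus>\<^bsub>tensor_vs K A B\<^esub> cl f') = g (cl f) \<oplus>\<^bsub>M\<^esub> g (cl f')"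
    if "g \<in> linear_maps K (tensor_vs K A B) M" "f \<in> carrier V" "f' \<in> carrier V" for g f f'
    using that by (simp add: linear_maps_def)
  have hs: "g (c \<odot>\<^bsub>tensor_vs K A B\<^esub> cl f) = c \<odot>\<^bsub>M\<^esub> g (cl f)"
    if "g \<in> linear_maps K (tensor_vs K A B) M" "f \<in> carrier V" "c \<in> carrier K" for g f c
    using that by (simp add: linear_maps_def)
  have h0: "g (cl \<zero>\<^bsub>V\<^esub>) = \<zero>\<^bsub>M\<^esub>" if "g \<in> linear_maps K (tensor_vs K A B) M" for g
  proof -
    have "g (cl \<zero>\<^bsub>V\<^esub>) \<in> carrier M" using that by (auto simp: linear_maps_def)
    moreover have "g (\<zero>\<^bsub>K\<^esub> \<odot>\<^bsub>tensor_vs K A B\<^esub> cl \<zero>\<^bsub>V\<^esub>) = \<zero>\<^bsub>K\<^esub> \<odot>\<^bsub>M\<^esub> g (cl \<zero>\<^bsub>V\<^esub>)"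
      using that by (rule hs) auto
    ultimately show ?thesis by (simp add: smult_cl)
  qed
  have "h (cl f) = h' (cl f)" if "finite T" "f \<in> carrier V" "{p. f p \<noteq> \<zero>\<^bsub>K\<^esub>} \<subseteq> T" for T f
    using that
  proof (induction T arbitrary: f rule: finite_induct)
    case empty
    then have "f = \<zero>\<^bsub>V\<^esub>" by (auto simp: free_vs_sel)
    then show ?case using h0[OF h] h0[OF h'] by simp
  next
    case (insert p T)
    show ?case
    proof (cases "f p = \<zero>\<^bsub>K\<^esub>")
      case True
      then show ?thesis using insert.prems by (intro insert.IH) auto
    next
      case False
      then obtain a b where p: "p = (a, b)" "a \<in> carrier A" "b \<in> carrier B"
        using insert.prems(1) unfolding cr by (cases p) auto
      let ?g = "f(p := \<zero>\<^bsub>K\<^esub>)"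
      have fp: "f p \<in> carrier K" using insert.prems(1)[unfolded cr] by (elim conjE) (erule spec)
      have g: "?g \<in> carrier V"
        using insert.prems(1) unfolding cr by (auto elim: rev_finite_subset)
      have f: "f = f p \<odot>\<^bsub>V\<^esub> e a b \<oplus>\<^bsub>V\<^esub> ?g"
        using insert.prems(1) p(1) by (auto simp: free_vs_sel basis_fun_def fun_eq_iff)
      have IH: "h (cl ?g) = h' (cl ?g)" by (rule insert.IH[OF g]) (use insert.prems(2) in auto)
      have step: "k (cl f) = f p \<odot>\<^bsub>M\<^esub> k (ptens K A B a b) \<oplus>\<^bsub>M\<^esub> k (cl ?g)"
        if "k \<in> linear_maps K (tensor_vs K A B) M" for k
      proof -
        have "cl f = f p \<odot>\<^bsub>tensor_vs K A B\<^esub> cl (e a b) \<oplus>\<^bsub>tensor_vs K A B\<^esub> cl ?g"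
          by (subst f) (use fp g p basis_in in \<open>simp add: smult_cl add_cl\<close>)
        then show ?thesis
          using that fp g p basis_in[OF p(2,3)]
          by (simp add: smult_cl ha hs[symmetric] ptens_def')
      qed
      show ?thesis by (simp only: step[OF h] step[OF h'] IH eq[OF p(2,3)])
    qed
  qed
  then show ?thesis using t by (auto simp: carrier_tvs cr)
qed

end

section \<open>Tensor products of algebras\<close>

text \<open>The library locale \<open>algebra\<close> is restricted to commutative algebras.\<close>

locale assoc_algebra = module K A + A: ring A
  for K (structure) and A (structure) +
  assumes smult_mult_left:
      "\<lbrakk>c \<in> carrier K; x \<in> carrier A; y \<in> carrier A\<rbrakk>
        \<Longrightarrow> (c \<odot>\<^bsub>A\<^esub> x) \<otimes>\<^bsub>A\<^esub> y = c \<odot>\<^bsub>A\<^esub> (x \<otimes>\<^bsub>A\<^esub> y)"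
    and smult_mult_right:
      "\<lbrakk>c \<in> carrier K; x \<in> carrier A; y \<in> carrier A\<rbrakk>
        \<Longrightarrow> x \<otimes>\<^bsub>A\<^esub> (c \<odot>\<^bsub>A\<^esub> y) = c \<odot>\<^bsub>A\<^esub> (x \<otimes>\<^bsub>A\<^esub> y)"

definition base_algebra :: "('k, 'r) ring_scheme \<Rightarrow> ('k, 'k) module" where
  "base_algebra K =
    \<lparr>carrier = carrier K, mult = mult K, one = \<one>\<^bsub>K\<^esub>, zero = \<zero>\<^bsub>K\<^esub>, add = add K, smult = mult K\<rparr>"

text \<open>Componentwise multiplication, \<open>(a \<otimes> b)(a' \<otimes> b') = aa' \<otimes> bb'\<close>, and unit \<open>1 \<otimes> 1\<close>.\<close>

definition tensor_algebra ::
    "('k, 'r) ring_scheme \<Rightarrow> ('k, 'a, 'm) module_scheme \<Rightarrow> ('k, 'b, 'n) module_scheme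
      \<Rightarrow> ('k, ('k, 'a, 'b) tensor) module" (infixl \<open>\<boxtimes>\<index>\<close> 75) where
  "A \<boxtimes>\<^bsub>K\<^esub> B = (tensor_vs K A B)
    \<lparr>mult := (\<lambda>s t. tensor_lift K A B (tensor_vs K A B)
        (\<lambda>a b. tensor_lift K A B (tensor_vs K A B)
          (\<lambda>a' b'. ptens K A B (a \<otimes>\<^bsub>A\<^esub> a') (b \<otimes>\<^bsub>B\<^esub> b')) t) s),
     one := ptens K A B \<one>\<^bsub>A\<^esub> \<one>\<^bsub>B\<^esub>\<rparr>"

text \<open>\<open>tensor_map K A B C D f g\<close> is \<open>f \<otimes> g : A \<otimes> B \<rightarrow> C \<otimes> D\<close> for linear \<open>f : A \<rightarrow> C\<close>, \<open>g : B \<rightarrow> D\<close>.\<close>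

definition tensor_map ::
    "('k, 'r) ring_scheme \<Rightarrow> ('k, 'a, 'm) module_scheme \<Rightarrow> ('k, 'b, 'n) module_scheme
      \<Rightarrow> ('k, 'c, 'l) module_scheme \<Rightarrow> ('k, 'd, 'q) module_scheme
      \<Rightarrow> ('a \<Rightarrow> 'c) \<Rightarrow> ('b \<Rightarrow> 'd) \<Rightarrow> ('k, 'a, 'b) tensor \<Rightarrow> ('k, 'c, 'd) tensor" where
  "tensor_map K A B C D f g =
    tensor_lift K A B (C \<boxtimes>\<^bsub>K\<^esub> D) (\<lambda>a b. ptens K C D (f a) (g b))"

text \<open>The associativity isomorphism \<open>(A \<otimes> B) \<otimes> C \<rightarrow> A \<otimes> (B \<otimes> C)\<close>, usually suppressed.\<close>

definition tensor_assoc ::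
    "('k, 'r) ring_scheme \<Rightarrow> ('k, 'a, 'm) module_scheme \<Rightarrow> ('k, 'b, 'n) module_scheme
      \<Rightarrow> ('k, 'c, 'l) module_scheme
      \<Rightarrow> ('k, ('k, 'a, 'b) tensor, 'c) tensor \<Rightarrow> ('k, 'a, ('k, 'b, 'c) tensor) tensor" where
  "tensor_assoc K A B C =
    tensor_lift K (A \<boxtimes>\<^bsub>K\<^esub> B) C (A \<boxtimes>\<^bsub>K\<^esub> (B \<boxtimes>\<^bsub>K\<^esub> C))
      (\<lambda>t c. tensor_lift K A B (A \<boxtimes>\<^bsub>K\<^esub> (B \<boxtimes>\<^bsub>K\<^esub> C))
        (\<lambda>a b. ptens K A (B \<boxtimes>\<^bsub>K\<^esub> C) a (ptens K B C b c)) t)"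

text \<open>
  \<open>Id \<otimes> \<tau> \<otimes> Id : (A \<otimes> B) \<otimes> (C \<otimes> D) \<rightarrow> (A \<otimes> C) \<otimes> (B \<otimes> D)\<close>, that is,
  \<open>(a \<otimes> b) \<otimes> (c \<otimes> d) \<mapsto> (a \<otimes> c) \<otimes> (b \<otimes> d)\<close>.
\<close>

definition middle_flip ::
    "('k, 'r) ring_scheme \<Rightarrow> ('k, 'a, 'm) module_scheme \<Rightarrow> ('k, 'b, 'n) module_scheme
      \<Rightarrow> ('k, 'c, 'l) module_scheme \<Rightarrow> ('k, 'd, 'q) module_scheme
      \<Rightarrow> ('k, ('k, 'a, 'b) tensor, ('k, 'c, 'd) tensor) tensor
      \<Rightarrow> ('k, ('k, 'a, 'c) tensor, ('k, 'b, 'd) tensor) tensor" where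
  "middle_flip K A B C D =
    (let T = (A \<boxtimes>\<^bsub>K\<^esub> C) \<boxtimes>\<^bsub>K\<^esub> (B \<boxtimes>\<^bsub>K\<^esub> D) in
      tensor_lift K (A \<boxtimes>\<^bsub>K\<^esub> B) (C \<boxtimes>\<^bsub>K\<^esub> D) T
        (\<lambda>s t. tensor_lift K A B T
          (\<lambda>a b. tensor_lift K C D T
            (\<lambda>c d. ptens K (A \<boxtimes>\<^bsub>K\<^esub> C) (B \<boxtimes>\<^bsub>K\<^esub> D) (ptens K A C a c) (ptens K B D b d)) t) s))"

section \<open>Bialgebras\<close>

record ('k, 'h) bialgebra = "('k, 'h) module" +
  comult :: "'h \<Rightarrow> ('k, 'h, 'h) tensor"
  counit :: "'h \<Rightarrow> 'k"

text \<open>\<open>\<epsilon> \<otimes> Id\<close> and \<open>Id \<otimes> \<epsilon>\<close> as maps \<open>H \<otimes> H \<rightarrow> H\<close>, with \<open>K \<otimes> H\<close> and \<open>H \<otimes> K\<close> identified with \<open>H\<close>.\<close>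

definition counit_left ::
    "('k, 'r) ring_scheme \<Rightarrow> ('k, 'h, 'm) bialgebra_scheme \<Rightarrow> ('k, 'h, 'h) tensor \<Rightarrow> 'h" where
  "counit_left K H = tensor_lift K H H H (\<lambda>x y. counit H x \<odot>\<^bsub>H\<^esub> y)"

definition counit_right ::
    "('k, 'r) ring_scheme \<Rightarrow> ('k, 'h, 'm) bialgebra_scheme \<Rightarrow> ('k, 'h, 'h) tensor \<Rightarrow> 'h" where
  "counit_right K H = tensor_lift K H H H (\<lambda>x y. counit H y \<odot>\<^bsub>H\<^esub> x)"

text \<open>\<open>\<Delta> \<otimes> Id\<close> and \<open>Id \<otimes> \<Delta>\<close> as maps \<open>H \<otimes> B \<rightarrow> H \<otimes> (H \<otimes> B)\<close> and \<open>A \<otimes> H \<rightarrow> A \<otimes> (H \<otimes> H)\<close>;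
  triple tensor products are consistently bracketed to the right.\<close>

definition comult_left ::
    "('k, 'r) ring_scheme \<Rightarrow> ('k, 'h, 'm) bialgebra_scheme \<Rightarrow> ('k, 'b, 'n) module_scheme
      \<Rightarrow> ('k, 'h, 'b) tensor \<Rightarrow> ('k, 'h, ('k, 'h, 'b) tensor) tensor" where
  "comult_left K H B t =
    tensor_assoc K H H B (tensor_map K H B (H \<boxtimes>\<^bsub>K\<^esub> H) B (comult H) (\<lambda>b. b) t)"

definition comult_right ::
    "('k, 'r) ring_scheme \<Rightarrow> ('k, 'a, 'm) module_scheme \<Rightarrow> ('k, 'h, 'n) bialgebra_scheme
      \<Rightarrow> ('k, 'a, 'h) tensor \<Rightarrow> ('k, 'a, ('k, 'h, 'h) tensor) tensor" where
  "comult_right K A H t = tensor_map K A H A (H \<boxtimes>\<^bsub>K\<^esub> H) (\<lambda>a. a) (comult H) t"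

locale bialgebra = K: field K + assoc_algebra K H
  for K (structure) and H (structure) +
  assumes comult_hom: "comult H \<in> ring_hom H (H \<boxtimes>\<^bsub>K\<^esub> H) \<inter> linear_maps K H (H \<boxtimes>\<^bsub>K\<^esub> H)"
    and counit_hom: "counit H \<in> ring_hom H K \<inter> linear_maps K H (base_algebra K)"
    and coassoc:
      "x \<in> carrier H \<Longrightarrow> comult_left K H H (comult H x) = comult_right K H H (comult H x)"
    and counit_left: "x \<in> carrier H \<Longrightarrow> counit_left K H (comult H x) = x"
    and counit_right: "x \<in> carrier H \<Longrightarrow> counit_right K H (comult H x) = x"

definition tensor_bialgebra ::
    "('k, 'r) ring_scheme \<Rightarrow> ('k, 'a, 'm) bialgebra_scheme \<Rightarrow> ('k, 'b, 'n) bialgebra_scheme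
      \<Rightarrow> ('k, ('k, 'a, 'b) tensor) bialgebra" where
  "tensor_bialgebra K H1 H2 = module.extend (H1 \<boxtimes>\<^bsub>K\<^esub> H2)
    \<lparr>comult = (\<lambda>t. middle_flip K H1 H1 H2 H2
        (tensor_map K H1 H2 (H1 \<boxtimes>\<^bsub>K\<^esub> H1) (H2 \<boxtimes>\<^bsub>K\<^esub> H2) (comult H1) (comult H2) t)),
     counit = tensor_lift K H1 H2 (base_algebra K) (\<lambda>a b. counit H1 a \<otimes>\<^bsub>K\<^esub> counit H2 b)\<rparr>"

section \<open>Twists and weak R-matrices\<close>

text \<open>
  \<open>F \<otimes> 1\<close> and \<open>1 \<otimes> F\<close> as elements of \<open>A \<otimes> (B \<otimes> C)\<close>, for \<open>F\<close> in \<open>A \<otimes> B\<close> resp. in \<open>B \<otimes> C\<close>, and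
  \<open>R\<^sub>1\<^sub>3\<close> for \<open>R\<close> in \<open>A \<otimes> C\<close>.
\<close>

definition leg12 ::
    "('k, 'r) ring_scheme \<Rightarrow> ('k, 'a, 'm) module_scheme \<Rightarrow> ('k, 'b, 'n) module_scheme
      \<Rightarrow> ('k, 'c, 'l) module_scheme \<Rightarrow> ('k, 'a, 'b) tensor
      \<Rightarrow> ('k, 'a, ('k, 'b, 'c) tensor) tensor" where
  "leg12 K A B C t = tensor_assoc K A B C (ptens K (A \<boxtimes>\<^bsub>K\<^esub> B) C t \<one>\<^bsub>C\<^esub>)"

definition leg23 ::
    "('k, 'r) ring_scheme \<Rightarrow> ('k, 'a, 'm) module_scheme \<Rightarrow> ('k, 'b, 'n) module_scheme
      \<Rightarrow> ('k, 'c, 'l) module_scheme \<Rightarrow> ('k, 'b, 'c) tensor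
      \<Rightarrow> ('k, 'a, ('k, 'b, 'c) tensor) tensor" where
  "leg23 K A B C t = ptens K A (B \<boxtimes>\<^bsub>K\<^esub> C) \<one>\<^bsub>A\<^esub> t"

definition leg13 ::
    "('k, 'r) ring_scheme \<Rightarrow> ('k, 'a, 'm) module_scheme \<Rightarrow> ('k, 'b, 'n) module_scheme
      \<Rightarrow> ('k, 'c, 'l) module_scheme \<Rightarrow> ('k, 'a, 'c) tensor
      \<Rightarrow> ('k, 'a, ('k, 'b, 'c) tensor) tensor" where
  "leg13 K A B C = tensor_lift K A C (A \<boxtimes>\<^bsub>K\<^esub> (B \<boxtimes>\<^bsub>K\<^esub> C))
    (\<lambda>a c. ptens K A (B \<boxtimes>\<^bsub>K\<^esub> C) a (ptens K B C \<one>\<^bsub>B\<^esub> c))"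

definition twist ::
    "('k, 'r) ring_scheme \<Rightarrow> ('k, 'h, 'm) bialgebra_scheme \<Rightarrow> ('k, 'h, 'h) tensor \<Rightarrow> bool" where
  "twist K H F \<longleftrightarrow>
    F \<in> Units (H \<boxtimes>\<^bsub>K\<^esub> H) \<and>
    leg12 K H H H F \<otimes>\<^bsub>H \<boxtimes>\<^bsub>K\<^esub> (H \<boxtimes>\<^bsub>K\<^esub> H)\<^esub> comult_left K H H F =
      leg23 K H H H F \<otimes>\<^bsub>H \<boxtimes>\<^bsub>K\<^esub> (H \<boxtimes>\<^bsub>K\<^esub> H)\<^esub> comult_right K H H F \<and>
    counit_left K H F = \<one>\<^bsub>H\<^esub> \<and> counit_right K H F = \<one>\<^bsub>H\<^esub>"

definition twisted_bialgebra ::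
    "('k, 'r) ring_scheme \<Rightarrow> ('k, 'h, 'm) bialgebra_scheme \<Rightarrow> ('k, 'h, 'h) tensor
      \<Rightarrow> ('k, 'h, 'm) bialgebra_scheme" where
  "twisted_bialgebra K H F =
    H\<lparr>comult := (\<lambda>x. F \<otimes>\<^bsub>H \<boxtimes>\<^bsub>K\<^esub> H\<^esub> comult H x \<otimes>\<^bsub>H \<boxtimes>\<^bsub>K\<^esub> H\<^esub> inv\<^bsub>H \<boxtimes>\<^bsub>K\<^esub> H\<^esub> F)\<rparr>"

definition weak_R_matrix ::
    "('k, 'r) ring_scheme \<Rightarrow> ('k, 'a, 'm) bialgebra_scheme \<Rightarrow> ('k, 'b, 'n) bialgebra_scheme
      \<Rightarrow> ('k, 'a, 'b) tensor \<Rightarrow> bool" where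
  "weak_R_matrix K A B R \<longleftrightarrow>
    R \<in> Units (A \<boxtimes>\<^bsub>K\<^esub> B) \<and>
    comult_right K A B R =
      leg13 K A B B R \<otimes>\<^bsub>A \<boxtimes>\<^bsub>K\<^esub> (B \<boxtimes>\<^bsub>K\<^esub> B)\<^esub> leg12 K A B B R \<and>
    comult_left K A B R =
      leg13 K A A B R \<otimes>\<^bsub>A \<boxtimes>\<^bsub>K\<^esub> (A \<boxtimes>\<^bsub>K\<^esub> B)\<^esub> leg23 K A A B R"

text \<open>\<open>1 \<otimes> S \<otimes> 1\<close> as an element of \<open>(A \<otimes> B) \<otimes> (C \<otimes> D)\<close>, for \<open>S\<close> in \<open>B \<otimes> C\<close>.\<close>

definition inner_legs ::
    "('k, 'r) ring_scheme \<Rightarrow> ('k, 'a, 'm) module_scheme \<Rightarrow> ('k, 'b, 'n) module_scheme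
      \<Rightarrow> ('k, 'c, 'l) module_scheme \<Rightarrow> ('k, 'd, 'q) module_scheme
      \<Rightarrow> ('k, 'b, 'c) tensor
      \<Rightarrow> ('k, ('k, 'a, 'b) tensor, ('k, 'c, 'd) tensor) tensor" where
  "inner_legs K A B C D = tensor_lift K B C ((A \<boxtimes>\<^bsub>K\<^esub> B) \<boxtimes>\<^bsub>K\<^esub> (C \<boxtimes>\<^bsub>K\<^esub> D))
    (\<lambda>b c. ptens K (A \<boxtimes>\<^bsub>K\<^esub> B) (C \<boxtimes>\<^bsub>K\<^esub> D) (ptens K A B \<one>\<^bsub>A\<^esub> b) (ptens K C D c \<one>\<^bsub>D\<^esub>))"

end

theory Submission
  imports Defs
begin

text \<open>
  Why the theorem holds.  Write \<open>A = H\<^sub>1\<close>, \<open>B = H\<^sub>2\<close>, \<open>H = A \<otimes> B\<close> and \<open>S = R\<inverse>\<close>.  In \<open>H \<otimes> H \<otimes> H\<close> there are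
  three copies of \<open>A\<close> and three copies of \<open>B\<close>, and any two different ones of these six subalgebras
  commute.  Denote by \<open>E\<^bsub>P,Q\<^esub>\<close> an element \<open>E\<close> of a twofold tensor product, placed in the copies \<open>P\<close> and \<open>Q\<close>.
  The element in question is \<open>F = S\<^bsub>B1,A2\<^esub> F\<^sub>1\<^bsub>A1,A2\<^esub> F\<^sub>2\<^bsub>B1,B2\<^esub>\<close>.  The weak R-matrix equations for the
  twisted bialgebras, inverted and freed of the conjugation by the twists, read
  \<open>F\<^sub>2\<^bsub>B1,B2\<^esub> (\<Delta> \<otimes> Id)(S) = S\<^bsub>B2,A3\<^esub> S\<^bsub>B1,A3\<^esub> F\<^sub>2\<^bsub>B1,B2\<^esub>\<close> and
  \<open>F\<^sub>1\<^bsub>A2,A3\<^esub> (Id \<otimes> \<Delta>)(S) = S\<^bsub>B1,A2\<^esub> S\<^bsub>B1,A3\<^esub> F\<^sub>1\<^bsub>A2,A3\<^esub>\<close> (\<open>S_left\<close>, \<open>S_right\<close>).  With them both sides of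
  the twist equation for \<open>F\<close> become a product of three legs of \<open>S\<close> and the common values of the twist
  equations for \<open>F\<^sub>1\<close> and \<open>F\<^sub>2\<close>; the products of the legs of \<open>S\<close> differ only in the order of \<open>S\<^bsub>B1,A2\<^esub>\<close>
  and \<open>S\<^bsub>B2,A3\<^esub>\<close>, which commute (\<open>twist_product_cocycle\<close>).  The counit conditions reduce to those of \<open>F\<^sub>1\<close>
  and \<open>F\<^sub>2\<close> and to \<open>(\<epsilon> \<otimes> Id)(R) = 1 = (Id \<otimes> \<epsilon>)(R)\<close>; the latter hold because these elements are invertible
  and idempotent (\<open>S_counit_left\<close>, \<open>S_counit_right\<close>).

  To keep iterated tensor products out of the computation, it is carried out in an arbitrary algebra
  \<open>T\<close>.  Algebra homomorphisms \<open>f : X \<rightarrow> T\<close> and \<open>g : Y \<rightarrow> T\<close> with commuting images induce an algebra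
  homomorphism \<open>pairing f g : X \<otimes> Y \<rightarrow> T\<close>, denoted \<open>f * g\<close> in the comments.  All maps in the definitions
  of twists and weak R-matrices are of this kind: for three commuting homomorphisms \<open>f, g, h\<close> the
  homomorphism \<open>f * (g * h)\<close> sends the legs \<open>t\<^sub>1\<^sub>2\<close>, \<open>t\<^sub>1\<^sub>3\<close>, \<open>t\<^sub>2\<^sub>3\<close> to \<open>(f * g)(t)\<close>, \<open>(f * h)(t)\<close>, \<open>(g * h)(t)\<close>,
  and \<open>(\<Delta> \<otimes> Id)(t)\<close>, \<open>(Id \<otimes> \<Delta>)(t)\<close> to \<open>(((f * g) \<circ> \<Delta>) * h)(t)\<close>, \<open>(f * ((g * h) \<circ> \<Delta>))(t)\<close> (locale
  \<open>hom_triple\<close>); applying \<open>\<epsilon>\<close> to a leg is a pairing with a homomorphism into the centre.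
\<close>

section \<open>Linear maps on tensor products\<close>

lemma linear_mapsI:
  assumes "\<And>x. x \<in> carrier A \<Longrightarrow> h x \<in> carrier B"
    and "\<And>x y. \<lbrakk>x \<in> carrier A; y \<in> carrier A\<rbrakk> \<Longrightarrow> h (x \<oplus>\<^bsub>A\<^esub> y) = h x \<oplus>\<^bsub>B\<^esub> h y"
    and "\<And>c x. \<lbrakk>c \<in> carrier K; x \<in> carrier A\<rbrakk> \<Longrightarrow> h (c \<odot>\<^bsub>A\<^esub> x) = c \<odot>\<^bsub>B\<^esub> h x"
  shows "h \<in> linear_maps K A B"
  using assms by (auto simp: linear_maps_def)

lemma linear_maps_closed: "\<lbrakk>h \<in> linear_maps K A B; x \<in> carrier A\<rbrakk> \<Longrightarrow> h x \<in> carrier B"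
  and linear_maps_add:
    "\<lbrakk>h \<in> linear_maps K A B; x \<in> carrier A; y \<in> carrier A\<rbrakk> \<Longrightarrow> h (x \<oplus>\<^bsub>A\<^esub> y) = h x \<oplus>\<^bsub>B\<^esub> h y"
  and linear_maps_smult:
    "\<lbrakk>h \<in> linear_maps K A B; c \<in> carrier K; x \<in> carrier A\<rbrakk> \<Longrightarrow> h (c \<odot>\<^bsub>A\<^esub> x) = c \<odot>\<^bsub>B\<^esub> h x"
  by (auto simp: linear_maps_def)

lemma linear_maps_comp:
  "\<lbrakk>f \<in> linear_maps K A B; g \<in> linear_maps K B C\<rbrakk> \<Longrightarrow> (\<lambda>x. g (f x)) \<in> linear_maps K A C"
  by (auto simp: linear_maps_def Pi_iff)

lemma bilinear_mapsI:
  assumes "\<And>a. a \<in> carrier A \<Longrightarrow> \<phi> a \<in> linear_maps K B M"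
    and "\<And>b. b \<in> carrier B \<Longrightarrow> (\<lambda>a. \<phi> a b) \<in> linear_maps K A M"
  shows "\<phi> \<in> bilinear_maps K A B M"
  using assms by (auto simp: bilinear_maps_def)

lemma linear_maps_tensor_algebra_dom:
  "linear_maps K (A \<boxtimes>\<^bsub>K\<^esub> B) M = linear_maps K (tensor_vs K A B) M"
  by (simp add: linear_maps_def tensor_algebra_def)

lemma linear_maps_tensor_algebra_cod:
  "linear_maps K M (A \<boxtimes>\<^bsub>K\<^esub> B) = linear_maps K M (tensor_vs K A B)"
  by (simp add: linear_maps_def tensor_algebra_def)

context tensor_pair
begin

lemma tensor_module: "module K (A \<boxtimes>\<^bsub>K\<^esub> B)"
  using tensor_vs_module
  by (simp add: module_def abelian_group_def abelian_monoid_def abelian_group_axioms_def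
      module_axioms_def tensor_algebra_def)

sublocale tensor: module K "A \<boxtimes>\<^bsub>K\<^esub> B"
  by (rule tensor_module)

lemma ptens_bilinear': "ptens K A B \<in> bilinear_maps K A B (A \<boxtimes>\<^bsub>K\<^esub> B)"
  using ptens_bilinear by (simp add: bilinear_maps_def linear_maps_tensor_algebra_cod)

lemma ptens_linear_right: "a \<in> carrier A \<Longrightarrow> ptens K A B a \<in> linear_maps K B (A \<boxtimes>\<^bsub>K\<^esub> B)"
  and ptens_linear_left:
    "b \<in> carrier B \<Longrightarrow> (\<lambda>a. ptens K A B a b) \<in> linear_maps K A (A \<boxtimes>\<^bsub>K\<^esub> B)"
  using ptens_bilinear' by (auto simp: bilinear_maps_def)

lemma ptens_closed [simp]:
  "\<lbrakk>a \<in> carrier A; b \<in> carrier B\<rbrakk> \<Longrightarrow> ptens K A B a b \<in> carrier (A \<boxtimes>\<^bsub>K\<^esub> B)"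
  using ptens_linear_right by (rule linear_maps_closed)

lemma ptens_add_left:
  "\<lbrakk>a \<in> carrier A; a' \<in> carrier A; b \<in> carrier B\<rbrakk>
    \<Longrightarrow> ptens K A B (a \<oplus>\<^bsub>A\<^esub> a') b = ptens K A B a b \<oplus>\<^bsub>A \<boxtimes>\<^bsub>K\<^esub> B\<^esub> ptens K A B a' b"
  using linear_maps_add[OF ptens_linear_left] by blast

lemma ptens_add_right:
  "\<lbrakk>a \<in> carrier A; b \<in> carrier B; b' \<in> carrier B\<rbrakk>
    \<Longrightarrow> ptens K A B a (b \<oplus>\<^bsub>B\<^esub> b') = ptens K A B a b \<oplus>\<^bsub>A \<boxtimes>\<^bsub>K\<^esub> B\<^esub> ptens K A B a b'"
  using linear_maps_add[OF ptens_linear_right] by blast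

lemma ptens_smult_left:
  "\<lbrakk>c \<in> carrier K; a \<in> carrier A; b \<in> carrier B\<rbrakk>
    \<Longrightarrow> ptens K A B (c \<odot>\<^bsub>A\<^esub> a) b = c \<odot>\<^bsub>A \<boxtimes>\<^bsub>K\<^esub> B\<^esub> ptens K A B a b"
  using linear_maps_smult[OF ptens_linear_left] by blast

lemma ptens_smult_right:
  "\<lbrakk>c \<in> carrier K; a \<in> carrier A; b \<in> carrier B\<rbrakk>
    \<Longrightarrow> ptens K A B a (c \<odot>\<^bsub>B\<^esub> b) = c \<odot>\<^bsub>A \<boxtimes>\<^bsub>K\<^esub> B\<^esub> ptens K A B a b"
  using linear_maps_smult[OF ptens_linear_right] by blast

lemma ptens_zero:
  "ptens K A B \<zero>\<^bsub>A\<^esub> \<zero>\<^bsub>B\<^esub> = \<zero>\<^bsub>A \<boxtimes>\<^bsub>K\<^esub> B\<^esub>"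
  using ptens_smult_left[of "\<zero>\<^bsub>K\<^esub>" "\<zero>\<^bsub>A\<^esub>" "\<zero>\<^bsub>B\<^esub>"] by simp

lemma lift_linear:
  "\<lbrakk>module K M; \<phi> \<in> bilinear_maps K A B M\<rbrakk>
    \<Longrightarrow> tensor_lift K A B M \<phi> \<in> linear_maps K (A \<boxtimes>\<^bsub>K\<^esub> B) M"
  unfolding linear_maps_tensor_algebra_dom by (rule tensor_lift_linear)

text \<open>Every tensor is a finite sum of pure tensors; scalars are absorbed into a factor.\<close>

lemma tensor_induct [consumes 1, case_names pure add]:
  assumes t: "t \<in> carrier (A \<boxtimes>\<^bsub>K\<^esub> B)"
    and pure: "\<And>a b. \<lbrakk>a \<in> carrier A; b \<in> carrier B\<rbrakk> \<Longrightarrow> P (ptens K A B a b)"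
    and add: "\<And>s t. \<lbrakk>s \<in> carrier (A \<boxtimes>\<^bsub>K\<^esub> B); t \<in> carrier (A \<boxtimes>\<^bsub>K\<^esub> B); P s; P t\<rbrakk>
      \<Longrightarrow> P (s \<oplus>\<^bsub>A \<boxtimes>\<^bsub>K\<^esub> B\<^esub> t)"
  shows "P t"
proof -
  have car: "carrier (A \<boxtimes>\<^bsub>K\<^esub> B) = carrier (tensor_vs K A B)"
    and addeq: "add (A \<boxtimes>\<^bsub>K\<^esub> B) = add (tensor_vs K A B)"
    by (simp_all add: tensor_algebra_def)
  have cr: "f \<in> carrier V \<longleftrightarrow> (\<forall>x. f x \<in> carrier K)
      \<and> (\<forall>x. x \<notin> carrier A \<times> carrier B \<longrightarrow> f x = \<zero>\<^bsub>K\<^esub>) \<and> finite {x. f x \<noteq> \<zero>\<^bsub>K\<^esub>}" for f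
    by (simp add: free_vs_sel)
  have "P (cl f)" if "finite T" "f \<in> carrier V" "{p. f p \<noteq> \<zero>\<^bsub>K\<^esub>} \<subseteq> T" for T f
    using that
  proof (induction T arbitrary: f rule: finite_induct)
    case empty
    then have "f = \<zero>\<^bsub>V\<^esub>" by (auto simp: free_vs_sel)
    then have "cl f = ptens K A B \<zero>\<^bsub>A\<^esub> \<zero>\<^bsub>B\<^esub>"
      using ptens_zero by (simp add: tensor_algebra_def zero_tvs)
    then show ?case using pure by simp
  next
    case (insert p T)
    show ?case
    proof (cases "f p = \<zero>\<^bsub>K\<^esub>")
      case True
      then show ?thesis using insert.prems by (intro insert.IH) auto
    next
      case False
      then obtain a b where p: "p = (a, b)" "a \<in> carrier A" "b \<in> carrier B"
        using insert.prems(1) unfolding cr by (cases p) auto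
      let ?g = "f(p := \<zero>\<^bsub>K\<^esub>)"
      have fp: "f p \<in> carrier K" using insert.prems(1)[unfolded cr] by (elim conjE) (erule spec)
      have g: "?g \<in> carrier V"
        using insert.prems(1) unfolding cr by (auto elim: rev_finite_subset)
      have f: "f = f p \<odot>\<^bsub>V\<^esub> e a b \<oplus>\<^bsub>V\<^esub> ?g"
        using insert.prems(1) p(1) by (auto simp: free_vs_sel basis_fun_def fun_eq_iff)
      have IH: "P (cl ?g)" by (rule insert.IH[OF g]) (use insert.prems(2) in auto)
      have "cl f = f p \<odot>\<^bsub>tensor_vs K A B\<^esub> cl (e a b) \<oplus>\<^bsub>tensor_vs K A B\<^esub> cl ?g"
        by (subst f) (use fp g p basis_in in \<open>simp add: smult_cl add_cl\<close>)
      also have "f p \<odot>\<^bsub>tensor_vs K A B\<^esub> cl (e a b) = ptens K A B (f p \<odot>\<^bsub>A\<^esub> a) b"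
        using ptens_smult_left[OF fp p(2,3)] by (simp add: tensor_algebra_def ptens_def')
      finally have "cl f = ptens K A B (f p \<odot>\<^bsub>A\<^esub> a) b \<oplus>\<^bsub>A \<boxtimes>\<^bsub>K\<^esub> B\<^esub> cl ?g"
        unfolding addeq .
      moreover have "cl ?g \<in> carrier (A \<boxtimes>\<^bsub>K\<^esub> B)" using g by (simp add: car)
      ultimately show ?thesis
        using add[of "ptens K A B (f p \<odot>\<^bsub>A\<^esub> a) b" "cl ?g"] pure[of "f p \<odot>\<^bsub>A\<^esub> a" b] IH p fp
        by simp
    qed
  qed
  then show ?thesis using t by (auto simp: car carrier_tvs cr)
qed

lemma tensor_linear_ext:
  assumes "h \<in> linear_maps K (A \<boxtimes>\<^bsub>K\<^esub> B) M" "h' \<in> linear_maps K (A \<boxtimes>\<^bsub>K\<^esub> B) M"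
    and "\<And>a b. \<lbrakk>a \<in> carrier A; b \<in> carrier B\<rbrakk> \<Longrightarrow> h (ptens K A B a b) = h' (ptens K A B a b)"
    and "t \<in> carrier (A \<boxtimes>\<^bsub>K\<^esub> B)"
  shows "h t = h' t"
  using assms(4)
  by (induction t rule: tensor_induct) (simp_all add: assms linear_maps_add[OF assms(1)] linear_maps_add[OF assms(2)])

text \<open>The linear map induced by a bilinear map depends linearly on the bilinear map.\<close>

lemma lift_param:
  assumes M: "module K M"
    and \<phi>: "\<And>x. x \<in> carrier X \<Longrightarrow> \<phi> x \<in> bilinear_maps K A B M"
    and lin: "\<And>a b. \<lbrakk>a \<in> carrier A; b \<in> carrier B\<rbrakk> \<Longrightarrow> (\<lambda>x. \<phi> x a b) \<in> linear_maps K X M"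
    and X: "module K X"
    and t: "t \<in> carrier (A \<boxtimes>\<^bsub>K\<^esub> B)"
  shows "(\<lambda>x. tensor_lift K A B M (\<phi> x) t) \<in> linear_maps K X M"
proof (rule linear_mapsI)
  interpret M: module K M by fact
  interpret X: module K X by fact
  note L = lift_linear[OF M \<phi>]
  show "tensor_lift K A B M (\<phi> x) t \<in> carrier M" if "x \<in> carrier X" for x
    using linear_maps_closed[OF L[OF that] t] .
  show "tensor_lift K A B M (\<phi> (x \<oplus>\<^bsub>X\<^esub> y)) t
      = tensor_lift K A B M (\<phi> x) t \<oplus>\<^bsub>M\<^esub> tensor_lift K A B M (\<phi> y) t"
    if x: "x \<in> carrier X" and y: "y \<in> carrier X" for x y
    using t
  proof (induction t rule: tensor_induct)
    case (pure a b)
    then show ?case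
      using x y linear_maps_add[OF lin] by (simp add: tensor_lift_ptens[OF M \<phi>])
  next
    case (add s t)
    then show ?case
      using linear_maps_closed[OF L[OF x]] linear_maps_closed[OF L[OF y]] x y
      by (simp add: linear_maps_add[OF L] M.a_ac)
  qed
  show "tensor_lift K A B M (\<phi> (c \<odot>\<^bsub>X\<^esub> x)) t = c \<odot>\<^bsub>M\<^esub> tensor_lift K A B M (\<phi> x) t"
    if c: "c \<in> carrier K" and x: "x \<in> carrier X" for c x
    using t
  proof (induction t rule: tensor_induct)
    case (pure a b)
    then show ?case
      using c x linear_maps_smult[OF lin] by (simp add: tensor_lift_ptens[OF M \<phi>])
  next
    case (add s t)
    then show ?case
      using linear_maps_closed[OF L[OF x]] c x
      by (simp add: linear_maps_add[OF L] M.smult_r_distr)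
  qed
qed

end

section \<open>Tensor products of associative algebras\<close>

locale algebra_pair = A: assoc_algebra K A + B: assoc_algebra K B
  for K (structure) and A (structure) and B (structure)
begin

sublocale tensor_pair K A B ..

text \<open>The product of \<open>A \<otimes> B\<close> is a linear extension in the left factor of a linear extension in the right
  one.  Both extensions need a bilinear map to start from.\<close>

lemma mult_inner_bilinear:
  assumes "a \<in> carrier A" "b \<in> carrier B"
  shows "(\<lambda>a' b'. ptens K A B (a \<otimes>\<^bsub>A\<^esub> a') (b \<otimes>\<^bsub>B\<^esub> b')) \<in> bilinear_maps K A B (A \<boxtimes>\<^bsub>K\<^esub> B)"
  using assms
  by (intro bilinear_mapsI linear_mapsI)
    (simp_all add: A.A.r_distr B.A.r_distr A.smult_mult_right B.smult_mult_right
      ptens_add_left ptens_add_right ptens_smult_left ptens_smult_right)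

lemma mult_outer_linear:
  assumes "a' \<in> carrier A" "b' \<in> carrier B"
  shows "b \<in> carrier B \<Longrightarrow>
      (\<lambda>a. ptens K A B (a \<otimes>\<^bsub>A\<^esub> a') (b \<otimes>\<^bsub>B\<^esub> b')) \<in> linear_maps K A (A \<boxtimes>\<^bsub>K\<^esub> B)"
    and "a \<in> carrier A \<Longrightarrow>
      (\<lambda>b. ptens K A B (a \<otimes>\<^bsub>A\<^esub> a') (b \<otimes>\<^bsub>B\<^esub> b')) \<in> linear_maps K B (A \<boxtimes>\<^bsub>K\<^esub> B)"
  using assms
  by (auto intro!: linear_mapsI simp: A.A.l_distr B.A.l_distr A.smult_mult_left B.smult_mult_left
      ptens_add_left ptens_add_right ptens_smult_left ptens_smult_right)

lemma bilinear_tensor_vs: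
  "bilinear_maps K X Y (tensor_vs K A B) = bilinear_maps K X Y (A \<boxtimes>\<^bsub>K\<^esub> B)"
  by (simp add: bilinear_maps_def linear_maps_tensor_algebra_cod)

lemma mult_bilinear:
  assumes t: "t \<in> carrier (A \<boxtimes>\<^bsub>K\<^esub> B)"
  shows "(\<lambda>a b. tensor_lift K A B (tensor_vs K A B)
        (\<lambda>a' b'. ptens K A B (a \<otimes>\<^bsub>A\<^esub> a') (b \<otimes>\<^bsub>B\<^esub> b')) t) \<in> bilinear_maps K A B (tensor_vs K A B)"
  by (rule bilinear_mapsI; rule lift_param[OF tensor_vs_module])
    (simp_all add: t bilinear_tensor_vs linear_maps_tensor_algebra_cod[symmetric]
      mult_inner_bilinear mult_outer_linear A.module_axioms B.module_axioms)

lemma tensor_mult_eq: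
  "s \<otimes>\<^bsub>A \<boxtimes>\<^bsub>K\<^esub> B\<^esub> t = tensor_lift K A B (tensor_vs K A B)
        (\<lambda>a b. tensor_lift K A B (tensor_vs K A B)
          (\<lambda>a' b'. ptens K A B (a \<otimes>\<^bsub>A\<^esub> a') (b \<otimes>\<^bsub>B\<^esub> b')) t) s"
  by (simp add: tensor_algebra_def)

lemma tensor_mult_linear_left:
  assumes "t \<in> carrier (A \<boxtimes>\<^bsub>K\<^esub> B)"
  shows "(\<lambda>s. s \<otimes>\<^bsub>A \<boxtimes>\<^bsub>K\<^esub> B\<^esub> t) \<in> linear_maps K (A \<boxtimes>\<^bsub>K\<^esub> B) (A \<boxtimes>\<^bsub>K\<^esub> B)"
  unfolding tensor_mult_eq linear_maps_tensor_algebra_cod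
  by (rule lift_linear[OF tensor_vs_module mult_bilinear[OF assms]])

lemma tensor_mult_pure_left:
  assumes "a \<in> carrier A" "b \<in> carrier B" "t \<in> carrier (A \<boxtimes>\<^bsub>K\<^esub> B)"
  shows "ptens K A B a b \<otimes>\<^bsub>A \<boxtimes>\<^bsub>K\<^esub> B\<^esub> t = tensor_lift K A B (tensor_vs K A B)
          (\<lambda>a' b'. ptens K A B (a \<otimes>\<^bsub>A\<^esub> a') (b \<otimes>\<^bsub>B\<^esub> b')) t"
  unfolding tensor_mult_eq
  by (rule tensor_lift_ptens[OF tensor_vs_module mult_bilinear[OF assms(3)] assms(1,2)])

lemma tensor_mult_pure_linear_right:
  assumes "a \<in> carrier A" "b \<in> carrier B"
  shows "(\<lambda>t. ptens K A B a b \<otimes>\<^bsub>A \<boxtimes>\<^bsub>K\<^esub> B\<^esub> t) \<in> linear_maps K (A \<boxtimes>\<^bsub>K\<^esub> B) (A \<boxtimes>\<^bsub>K\<^esub> B)"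
proof -
  have "tensor_lift K A B (tensor_vs K A B)
          (\<lambda>a' b'. ptens K A B (a \<otimes>\<^bsub>A\<^esub> a') (b \<otimes>\<^bsub>B\<^esub> b')) \<in> linear_maps K (A \<boxtimes>\<^bsub>K\<^esub> B) (A \<boxtimes>\<^bsub>K\<^esub> B)"
    unfolding linear_maps_tensor_algebra_cod
    by (rule lift_linear[OF tensor_vs_module])
      (simp add: bilinear_tensor_vs mult_inner_bilinear assms)
  then show ?thesis
    by (simp add: linear_maps_def tensor_mult_pure_left assms Pi_iff)
qed

lemma tensor_mult_ptens [simp]:
  assumes "a \<in> carrier A" "b \<in> carrier B" "a' \<in> carrier A" "b' \<in> carrier B"
  shows "ptens K A B a b \<otimes>\<^bsub>A \<boxtimes>\<^bsub>K\<^esub> B\<^esub> ptens K A B a' b' = ptens K A B (a \<otimes>\<^bsub>A\<^esub> a') (b \<otimes>\<^bsub>B\<^esub> b')"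
  using assms
  by (simp add: tensor_mult_pure_left tensor_lift_ptens[OF tensor_vs_module] bilinear_tensor_vs
      mult_inner_bilinear)

lemmas tensor_mult_left_simps =
  linear_maps_closed[OF tensor_mult_linear_left] linear_maps_add[OF tensor_mult_linear_left]
  linear_maps_smult[OF tensor_mult_linear_left]

lemma tensor_mult_linear_right:
  assumes s: "s \<in> carrier (A \<boxtimes>\<^bsub>K\<^esub> B)"
  shows "(\<lambda>t. s \<otimes>\<^bsub>A \<boxtimes>\<^bsub>K\<^esub> B\<^esub> t) \<in> linear_maps K (A \<boxtimes>\<^bsub>K\<^esub> B) (A \<boxtimes>\<^bsub>K\<^esub> B)"
  using s
proof (induction s rule: tensor_induct)
  case (pure a b)
  then show ?case by (rule tensor_mult_pure_linear_right)
next
  case (add s t)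
  then show ?case
    by (intro linear_mapsI)
      (simp_all add: tensor_mult_left_simps tensor.M.a_ac linear_maps_closed[OF add.IH(1)]
        linear_maps_add[OF add.IH(1)] linear_maps_add[OF add.IH(2)] linear_maps_smult[OF add.IH(1)]
        linear_maps_smult[OF add.IH(2)] tensor.smult_r_distr)
qed

lemmas tensor_mult_right_simps =
  linear_maps_closed[OF tensor_mult_linear_right] linear_maps_add[OF tensor_mult_linear_right]
  linear_maps_smult[OF tensor_mult_linear_right]

lemma tensor_one: "\<one>\<^bsub>A \<boxtimes>\<^bsub>K\<^esub> B\<^esub> = ptens K A B \<one>\<^bsub>A\<^esub> \<one>\<^bsub>B\<^esub>"
  by (simp add: tensor_algebra_def)

lemma tensor_assoc_algebra: "assoc_algebra K (A \<boxtimes>\<^bsub>K\<^esub> B)"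
proof (intro assoc_algebra.intro assoc_algebra_axioms.intro)
  let ?T = "A \<boxtimes>\<^bsub>K\<^esub> B"
  show "module K ?T" by (rule tensor_module)
  show "ring ?T"
  proof (rule ringI)
    show "abelian_group ?T" by (rule tensor.abelian_group_axioms)
    show "Group.monoid ?T"
    proof (rule monoidI)
      show "x \<otimes>\<^bsub>?T\<^esub> y \<in> carrier ?T" if "x \<in> carrier ?T" "y \<in> carrier ?T" for x y
        using that by (simp add: tensor_mult_left_simps)
      show "\<one>\<^bsub>?T\<^esub> \<in> carrier ?T" by (simp add: tensor_one)
      show "\<one>\<^bsub>?T\<^esub> \<otimes>\<^bsub>?T\<^esub> x = x" if "x \<in> carrier ?T" for x
        using that by (induction x rule: tensor_induct) (simp_all add: tensor_one tensor_mult_right_simps)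
      show "x \<otimes>\<^bsub>?T\<^esub> \<one>\<^bsub>?T\<^esub> = x" if "x \<in> carrier ?T" for x
        using that by (induction x rule: tensor_induct) (simp_all add: tensor_one tensor_mult_left_simps)
      show "x \<otimes>\<^bsub>?T\<^esub> y \<otimes>\<^bsub>?T\<^esub> z = x \<otimes>\<^bsub>?T\<^esub> (y \<otimes>\<^bsub>?T\<^esub> z)"
        if x: "x \<in> carrier ?T" and y: "y \<in> carrier ?T" and z: "z \<in> carrier ?T" for x y z
        using x
      proof (induction x rule: tensor_induct)
        case a: (pure a b)
        show ?case using y
        proof (induction y rule: tensor_induct)
          case a': (pure a' b')
          show ?case using z
            by (induction z rule: tensor_induct)
              (use a a' in \<open>simp_all add: A.A.m_assoc B.A.m_assoc tensor_mult_right_simps\<close>)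
        qed (use a z in \<open>simp_all add: tensor_mult_left_simps tensor_mult_right_simps\<close>)
      qed (use y z in \<open>simp_all add: tensor_mult_left_simps\<close>)
    qed
  qed (simp_all add: tensor_mult_left_simps tensor_mult_right_simps)
qed (simp_all add: tensor_mult_left_simps tensor_mult_right_simps)

sublocale tensor: assoc_algebra K "A \<boxtimes>\<^bsub>K\<^esub> B"
  by (rule tensor_assoc_algebra)

end

section \<open>Algebra homomorphisms and pairings\<close>

lemma (in monoid) inv_mult_Units:
  assumes "x \<in> Units G" "y \<in> Units G"
  shows "inv (x \<otimes> y) = inv y \<otimes> inv x"
proof (rule inv_unique'[symmetric])
  have c: "x \<in> carrier G" "y \<in> carrier G" "inv x \<in> carrier G" "inv y \<in> carrier G"
    using assms by auto
  show "x \<otimes> y \<in> carrier G" "inv y \<otimes> inv x \<in> carrier G" using c by auto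
  have "x \<otimes> y \<otimes> (inv y \<otimes> inv x) = x \<otimes> (y \<otimes> inv y) \<otimes> inv x"
    using c by (simp only: m_assoc m_closed)
  then show "x \<otimes> y \<otimes> (inv y \<otimes> inv x) = \<one>" using c assms by simp
  have "inv y \<otimes> inv x \<otimes> (x \<otimes> y) = inv y \<otimes> (inv x \<otimes> x) \<otimes> y"
    using c by (simp only: m_assoc m_closed)
  then show "inv y \<otimes> inv x \<otimes> (x \<otimes> y) = \<one>" using c assms by simp
qed

text \<open>Unital algebra homomorphisms between associative algebras.\<close>

locale alg_hom = X: assoc_algebra K X + T: assoc_algebra K T
  for K (structure) and X (structure) and T (structure) and f +
  assumes ring_hom: "f \<in> ring_hom X T"
    and linear: "f \<in> linear_maps K X T"
begin

lemmas closed [simp] = ring_hom_closed[OF ring_hom]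
  and add = ring_hom_add[OF ring_hom]
  and mult = ring_hom_mult[OF ring_hom]
  and one [simp] = ring_hom_one[OF ring_hom]
  and smult = linear_maps_smult[OF linear]

lemma Units_hom:
  assumes "x \<in> Units X" shows "f x \<in> Units T" "f (inv\<^bsub>X\<^esub> x) = inv\<^bsub>T\<^esub> (f x)"
proof -
  have "f x \<otimes>\<^bsub>T\<^esub> f (inv\<^bsub>X\<^esub> x) = \<one>\<^bsub>T\<^esub>" "f (inv\<^bsub>X\<^esub> x) \<otimes>\<^bsub>T\<^esub> f x = \<one>\<^bsub>T\<^esub>"
    using assms by (simp_all add: mult[symmetric] X.A.Units_closed)
  moreover have "f x \<in> carrier T" "f (inv\<^bsub>X\<^esub> x) \<in> carrier T"
    using assms by (simp_all add: X.A.Units_closed)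
  ultimately show "f x \<in> Units T" "f (inv\<^bsub>X\<^esub> x) = inv\<^bsub>T\<^esub> (f x)"
    using T.A.inv_unique'[of "f x" "f (inv\<^bsub>X\<^esub> x)"] by (auto simp: Units_def)
qed

end

lemma alg_homI:
  assumes "assoc_algebra K X" "assoc_algebra K T"
    and "\<And>x. x \<in> carrier X \<Longrightarrow> f x \<in> carrier T"
    and "\<And>x y. \<lbrakk>x \<in> carrier X; y \<in> carrier X\<rbrakk> \<Longrightarrow> f (x \<oplus>\<^bsub>X\<^esub> y) = f x \<oplus>\<^bsub>T\<^esub> f y"
    and "\<And>c x. \<lbrakk>c \<in> carrier K; x \<in> carrier X\<rbrakk> \<Longrightarrow> f (c \<odot>\<^bsub>X\<^esub> x) = c \<odot>\<^bsub>T\<^esub> f x"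
    and "\<And>x y. \<lbrakk>x \<in> carrier X; y \<in> carrier X\<rbrakk> \<Longrightarrow> f (x \<otimes>\<^bsub>X\<^esub> y) = f x \<otimes>\<^bsub>T\<^esub> f y"
    and "f \<one>\<^bsub>X\<^esub> = \<one>\<^bsub>T\<^esub>"
  shows "alg_hom K X T f"
  by (intro alg_hom.intro alg_hom_axioms.intro ring_hom_memI linear_mapsI assms)

lemma alg_hom_cong:
  assumes "alg_hom K X T f" "\<And>x. x \<in> carrier X \<Longrightarrow> g x = f x"
  shows "alg_hom K X T g"
proof -
  interpret f: alg_hom K X T f by fact
  show ?thesis
    by (rule alg_homI) (simp_all add: assms(2) f.add f.mult f.smult
        f.X.assoc_algebra_axioms f.T.assoc_algebra_axioms)
qed

lemma alg_hom_comp: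
  assumes "alg_hom K X Y f" "alg_hom K Y Z g"
  shows "alg_hom K X Z (\<lambda>x. g (f x))"
proof -
  interpret f: alg_hom K X Y f by fact
  interpret g: alg_hom K Y Z g by fact
  show ?thesis
    by (rule alg_homI) (simp_all add: f.add f.mult f.smult g.add g.mult g.smult
        f.X.assoc_algebra_axioms g.T.assoc_algebra_axioms)
qed

lemma alg_hom_id: "assoc_algebra K X \<Longrightarrow> alg_hom K X X (\<lambda>x. x)"
  by (rule alg_homI) simp_all

text \<open>Conjugation by a unit; this is how a twist changes a comultiplication.\<close>

lemma alg_hom_conj:
  assumes "alg_hom K X T f" "u \<in> Units T"
  shows "alg_hom K X T (\<lambda>x. u \<otimes>\<^bsub>T\<^esub> f x \<otimes>\<^bsub>T\<^esub> inv\<^bsub>T\<^esub> u)"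
proof -
  interpret f: alg_hom K X T f by fact
  have u: "u \<in> carrier T" "inv\<^bsub>T\<^esub> u \<in> carrier T" "u \<otimes>\<^bsub>T\<^esub> inv\<^bsub>T\<^esub> u = \<one>\<^bsub>T\<^esub>" "inv\<^bsub>T\<^esub> u \<otimes>\<^bsub>T\<^esub> u = \<one>\<^bsub>T\<^esub>"
    using assms(2) by auto
  have c: "inv\<^bsub>T\<^esub> u \<otimes>\<^bsub>T\<^esub> (u \<otimes>\<^bsub>T\<^esub> z) = z" if "z \<in> carrier T" for z
    using that u by (simp add: f.T.A.m_assoc[symmetric])
  show ?thesis
    by (rule alg_homI) (simp_all add: u c f.add f.mult f.smult f.T.A.r_distr f.T.A.l_distr
        f.T.A.m_assoc f.T.smult_mult_left f.T.smult_mult_right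
        f.X.assoc_algebra_axioms f.T.assoc_algebra_axioms)
qed

text \<open>The images of \<open>f : X \<rightarrow> T\<close> and \<open>g : Y \<rightarrow> T\<close> commute elementwise.\<close>

definition commuting ::
    "('a, 'm) ring_scheme \<Rightarrow> ('b, 'n) ring_scheme \<Rightarrow> ('c, 'l) ring_scheme
      \<Rightarrow> ('a \<Rightarrow> 'c) \<Rightarrow> ('b \<Rightarrow> 'c) \<Rightarrow> bool" where
  "commuting X Y T f g \<longleftrightarrow>
    (\<forall>x\<in>carrier X. \<forall>y\<in>carrier Y. f x \<otimes>\<^bsub>T\<^esub> g y = g y \<otimes>\<^bsub>T\<^esub> f x)"

lemma commutingD:
  "\<lbrakk>commuting X Y T f g; x \<in> carrier X; y \<in> carrier Y\<rbrakk> \<Longrightarrow> f x \<otimes>\<^bsub>T\<^esub> g y = g y \<otimes>\<^bsub>T\<^esub> f x"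
  by (simp add: commuting_def)

lemma commuting_sym: "commuting X Y T f g \<Longrightarrow> commuting Y X T g f"
  unfolding commuting_def by (auto dest: sym)

lemma commuting_comp:
  "\<lbrakk>commuting X Y T f g; alg_hom K Z X d\<rbrakk> \<Longrightarrow> commuting Z Y T (\<lambda>z. f (d z)) g"
  by (simp add: commuting_def ring_hom_closed[OF alg_hom.ring_hom])

text \<open>The map \<open>X \<otimes> Y \<rightarrow> T\<close>, \<open>x \<otimes> y \<mapsto> f(x) g(y)\<close>.  For algebra homomorphisms with commuting images
  it is the algebra homomorphism given by the universal property of \<open>X \<otimes> Y\<close>.\<close>

definition pairing ::
    "('k, 'r) ring_scheme \<Rightarrow> ('k, 'a, 'm) module_scheme \<Rightarrow> ('k, 'b, 'n) module_scheme
      \<Rightarrow> ('k, 'c, 'l) module_scheme \<Rightarrow> ('a \<Rightarrow> 'c) \<Rightarrow> ('b \<Rightarrow> 'c) \<Rightarrow> ('k, 'a, 'b) tensor \<Rightarrow> 'c" where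
  "pairing K X Y T f g = tensor_lift K X Y T (\<lambda>x y. f x \<otimes>\<^bsub>T\<^esub> g y)"

text \<open>Two algebra homomorphisms with a common target; the images need not commute.\<close>

locale hom_pair = f: alg_hom K X T f + g: alg_hom K Y T g
  for K (structure) and X (structure) and Y (structure) and T (structure) and f g
begin

sublocale XY: algebra_pair K X Y ..

lemma pairing_bilinear: "(\<lambda>x y. f x \<otimes>\<^bsub>T\<^esub> g y) \<in> bilinear_maps K X Y T"
  by (intro bilinear_mapsI linear_mapsI)
    (simp_all add: f.add f.smult g.add g.smult f.T.A.l_distr f.T.A.r_distr
      f.T.smult_mult_left f.T.smult_mult_right)

lemma pairing_linear: "pairing K X Y T f g \<in> linear_maps K (X \<boxtimes>\<^bsub>K\<^esub> Y) T"
  unfolding pairing_def by (rule XY.lift_linear[OF f.T.module_axioms pairing_bilinear])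

lemmas pairing_closed [simp] = linear_maps_closed[OF pairing_linear]
  and pairing_add = linear_maps_add[OF pairing_linear]
  and pairing_smult = linear_maps_smult[OF pairing_linear]

lemma pairing_ptens [simp]:
  "\<lbrakk>x \<in> carrier X; y \<in> carrier Y\<rbrakk> \<Longrightarrow> pairing K X Y T f g (ptens K X Y x y) = f x \<otimes>\<^bsub>T\<^esub> g y"
  unfolding pairing_def by (rule XY.tensor_lift_ptens[OF f.T.module_axioms pairing_bilinear])

lemma pairing_unique:
  assumes "h \<in> linear_maps K (X \<boxtimes>\<^bsub>K\<^esub> Y) T"
    and "\<And>x y. \<lbrakk>x \<in> carrier X; y \<in> carrier Y\<rbrakk> \<Longrightarrow> h (ptens K X Y x y) = f x \<otimes>\<^bsub>T\<^esub> g y"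
    and "t \<in> carrier (X \<boxtimes>\<^bsub>K\<^esub> Y)"
  shows "h t = pairing K X Y T f g t"
  by (rule XY.tensor_linear_ext[OF assms(1) pairing_linear _ assms(3)]) (simp add: assms(2))

lemma pairing_alg_hom:
  assumes c: "commuting X Y T f g"
  shows "alg_hom K (X \<boxtimes>\<^bsub>K\<^esub> Y) T (pairing K X Y T f g)"
proof (rule alg_homI)
  let ?p = "pairing K X Y T f g"
  show "?p (s \<otimes>\<^bsub>X \<boxtimes>\<^bsub>K\<^esub> Y\<^esub> t) = ?p s \<otimes>\<^bsub>T\<^esub> ?p t"
    if s: "s \<in> carrier (X \<boxtimes>\<^bsub>K\<^esub> Y)" and t: "t \<in> carrier (X \<boxtimes>\<^bsub>K\<^esub> Y)" for s t
    using s
  proof (induction s rule: XY.tensor_induct)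
    case xy: (pure x y)
    show ?case using t
    proof (induction t rule: XY.tensor_induct)
      case (pure x' y')
      have "f x \<otimes>\<^bsub>T\<^esub> f x' \<otimes>\<^bsub>T\<^esub> (g y \<otimes>\<^bsub>T\<^esub> g y') = f x \<otimes>\<^bsub>T\<^esub> (f x' \<otimes>\<^bsub>T\<^esub> g y) \<otimes>\<^bsub>T\<^esub> g y'"
        using xy pure by (simp add: f.T.A.m_assoc)
      also have "f x' \<otimes>\<^bsub>T\<^esub> g y = g y \<otimes>\<^bsub>T\<^esub> f x'"
        by (rule commutingD[OF c pure(1) xy(2)])
      finally show ?case
        using xy pure by (simp add: f.mult g.mult f.T.A.m_assoc)
    qed (use xy in \<open>simp_all add: XY.tensor.A.r_distr pairing_add f.T.A.r_distr\<close>)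
  qed (use t in \<open>simp_all add: XY.tensor.A.l_distr pairing_add f.T.A.l_distr\<close>)
qed (simp_all add: pairing_add pairing_smult XY.tensor_one XY.tensor_assoc_algebra f.T.assoc_algebra_axioms)

lemma pairing_cong:
  assumes "\<And>x. x \<in> carrier X \<Longrightarrow> f' x = f x" "\<And>y. y \<in> carrier Y \<Longrightarrow> g' y = g y"
    and "t \<in> carrier (X \<boxtimes>\<^bsub>K\<^esub> Y)"
  shows "pairing K X Y T f' g' t = pairing K X Y T f g t"
proof -
  interpret f': alg_hom K X T f' by (rule alg_hom_cong[OF f.alg_hom_axioms assms(1)])
  interpret g': alg_hom K Y T g' by (rule alg_hom_cong[OF g.alg_hom_axioms assms(2)])
  interpret p': hom_pair K X Y T f' g' ..
  show ?thesis
    by (rule pairing_unique[OF p'.pairing_linear _ assms(3)]) (simp add: assms)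
qed

lemma pairing_comp:
  assumes "alg_hom K T U h" "t \<in> carrier (X \<boxtimes>\<^bsub>K\<^esub> Y)"
  shows "h (pairing K X Y T f g t) = pairing K X Y U (\<lambda>x. h (f x)) (\<lambda>y. h (g y)) t"
proof -
  interpret h: alg_hom K T U h by fact
  interpret p': hom_pair K X Y U "\<lambda>x. h (f x)" "\<lambda>y. h (g y)"
    by (intro hom_pair.intro alg_hom_comp[OF _ assms(1)] f.alg_hom_axioms g.alg_hom_axioms)
  show ?thesis
    by (rule p'.pairing_unique[OF linear_maps_comp[OF pairing_linear h.linear] _ assms(2)])
      (simp add: h.mult)
qed

lemma commuting_pairing:
  assumes "commuting X W T f h" "commuting Y W T g h" "alg_hom K W T h"
  shows "commuting (X \<boxtimes>\<^bsub>K\<^esub> Y) W T (pairing K X Y T f g) h"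
  unfolding commuting_def
proof (intro ballI)
  interpret h: alg_hom K W T h by fact
  fix t w assume t: "t \<in> carrier (X \<boxtimes>\<^bsub>K\<^esub> Y)" and w: "w \<in> carrier W"
  show "pairing K X Y T f g t \<otimes>\<^bsub>T\<^esub> h w = h w \<otimes>\<^bsub>T\<^esub> pairing K X Y T f g t"
    using t
  proof (induction t rule: XY.tensor_induct)
    case (pure x y)
    have "f x \<otimes>\<^bsub>T\<^esub> g y \<otimes>\<^bsub>T\<^esub> h w = f x \<otimes>\<^bsub>T\<^esub> (h w \<otimes>\<^bsub>T\<^esub> g y)"
      using pure w by (simp add: f.T.A.m_assoc commutingD[OF assms(2)])
    also have "\<dots> = h w \<otimes>\<^bsub>T\<^esub> (f x \<otimes>\<^bsub>T\<^esub> g y)"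
      using pure w by (simp add: f.T.A.m_assoc[symmetric] commutingD[OF assms(1)])
    finally show ?case using pure by simp
  qed (use w in \<open>simp_all add: pairing_add f.T.A.l_distr f.T.A.r_distr\<close>)
qed

text \<open>Conjugating \<open>f\<close> by a unit \<open>u\<close> conjugates the whole pairing when \<open>u\<close> commutes with the image of \<open>g\<close>.\<close>

lemma pairing_conj_left:
  assumes "u \<in> Units T" "\<And>y. y \<in> carrier Y \<Longrightarrow> u \<otimes>\<^bsub>T\<^esub> g y = g y \<otimes>\<^bsub>T\<^esub> u"
    and "t \<in> carrier (X \<boxtimes>\<^bsub>K\<^esub> Y)"
  shows "pairing K X Y T (\<lambda>x. u \<otimes>\<^bsub>T\<^esub> f x \<otimes>\<^bsub>T\<^esub> inv\<^bsub>T\<^esub> u) g t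
    = u \<otimes>\<^bsub>T\<^esub> pairing K X Y T f g t \<otimes>\<^bsub>T\<^esub> inv\<^bsub>T\<^esub> u"
proof -
  interpret c: hom_pair K X Y T "\<lambda>x. u \<otimes>\<^bsub>T\<^esub> f x \<otimes>\<^bsub>T\<^esub> inv\<^bsub>T\<^esub> u" g
    by (intro hom_pair.intro alg_hom_conj f.alg_hom_axioms g.alg_hom_axioms assms(1))
  have u: "u \<in> carrier T" "inv\<^bsub>T\<^esub> u \<in> carrier T" using assms(1) by auto
  have g: "inv\<^bsub>T\<^esub> u \<otimes>\<^bsub>T\<^esub> g y = g y \<otimes>\<^bsub>T\<^esub> inv\<^bsub>T\<^esub> u" if "y \<in> carrier Y" for y
  proof -
    have "inv\<^bsub>T\<^esub> u \<otimes>\<^bsub>T\<^esub> g y = inv\<^bsub>T\<^esub> u \<otimes>\<^bsub>T\<^esub> (g y \<otimes>\<^bsub>T\<^esub> u) \<otimes>\<^bsub>T\<^esub> inv\<^bsub>T\<^esub> u"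
      using that u assms(1) by (simp add: f.T.A.m_assoc)
    also have "\<dots> = g y \<otimes>\<^bsub>T\<^esub> inv\<^bsub>T\<^esub> u"
      using that u assms(1) by (simp add: assms(2)[symmetric] f.T.A.m_assoc[symmetric])
    finally show ?thesis .
  qed
  show ?thesis
    using assms(3)
  proof (induction t rule: XY.tensor_induct)
    case (pure x y)
    then show ?case using u by (simp add: f.T.A.m_assoc g)
  qed (simp_all add: u c.pairing_add pairing_add f.T.A.l_distr f.T.A.r_distr)
qed

lemma pairing_conj_right:
  assumes "u \<in> Units T" "\<And>x. x \<in> carrier X \<Longrightarrow> u \<otimes>\<^bsub>T\<^esub> f x = f x \<otimes>\<^bsub>T\<^esub> u"
    and "t \<in> carrier (X \<boxtimes>\<^bsub>K\<^esub> Y)"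
  shows "pairing K X Y T f (\<lambda>y. u \<otimes>\<^bsub>T\<^esub> g y \<otimes>\<^bsub>T\<^esub> inv\<^bsub>T\<^esub> u) t
    = u \<otimes>\<^bsub>T\<^esub> pairing K X Y T f g t \<otimes>\<^bsub>T\<^esub> inv\<^bsub>T\<^esub> u"
proof -
  interpret c: hom_pair K X Y T f "\<lambda>y. u \<otimes>\<^bsub>T\<^esub> g y \<otimes>\<^bsub>T\<^esub> inv\<^bsub>T\<^esub> u"
    by (intro hom_pair.intro alg_hom_conj f.alg_hom_axioms g.alg_hom_axioms assms(1))
  have u: "u \<in> carrier T" "inv\<^bsub>T\<^esub> u \<in> carrier T" using assms(1) by auto
  show ?thesis
    using assms(3)
  proof (induction t rule: XY.tensor_induct)
    case (pure x y)
    then show ?case using u by (simp add: f.T.A.m_assoc[symmetric] assms(2))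
  qed (simp_all add: u c.pairing_add pairing_add f.T.A.l_distr f.T.A.r_distr)
qed

end

lemma pairings_commute:
  assumes "alg_hom K X T f" "alg_hom K Y T g" "alg_hom K X' T f'" "alg_hom K Y' T g'"
    and "commuting X X' T f f'" "commuting X Y' T f g'" "commuting Y X' T g f'" "commuting Y Y' T g g'"
    and "commuting X' Y' T f' g'"
    and "t \<in> carrier (X \<boxtimes>\<^bsub>K\<^esub> Y)" "t' \<in> carrier (X' \<boxtimes>\<^bsub>K\<^esub> Y')"
  shows "pairing K X Y T f g t \<otimes>\<^bsub>T\<^esub> pairing K X' Y' T f' g' t'
    = pairing K X' Y' T f' g' t' \<otimes>\<^bsub>T\<^esub> pairing K X Y T f g t"
proof -
  interpret p: hom_pair K X Y T f g by (intro hom_pair.intro assms)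
  interpret q: hom_pair K X' Y' T f' g' by (intro hom_pair.intro assms)
  have "commuting X (X' \<boxtimes>\<^bsub>K\<^esub> Y') T f (pairing K X' Y' T f' g')"
    "commuting Y (X' \<boxtimes>\<^bsub>K\<^esub> Y') T g (pairing K X' Y' T f' g')"
    by (intro commuting_sym[OF q.commuting_pairing] commuting_sym[OF assms(5)]
        commuting_sym[OF assms(6)] commuting_sym[OF assms(7)] commuting_sym[OF assms(8)] assms(1,2))+
  then have "commuting (X \<boxtimes>\<^bsub>K\<^esub> Y) (X' \<boxtimes>\<^bsub>K\<^esub> Y') T (pairing K X Y T f g) (pairing K X' Y' T f' g')"
    by (rule p.commuting_pairing[OF _ _ q.pairing_alg_hom[OF assms(9)]])
  then show ?thesis using assms(10,11) by (rule commutingD)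
qed

text \<open>The embeddings \<open>x \<mapsto> x \<otimes> 1\<close> and \<open>y \<mapsto> 1 \<otimes> y\<close> of the two factors into \<open>X \<otimes> Y\<close>.\<close>

definition left_factor :: "('k, 'r) ring_scheme \<Rightarrow> ('k, 'a, 'm) module_scheme
    \<Rightarrow> ('k, 'b, 'n) module_scheme \<Rightarrow> 'a \<Rightarrow> ('k, 'a, 'b) tensor" where
  "left_factor K X Y x = ptens K X Y x \<one>\<^bsub>Y\<^esub>"

definition right_factor :: "('k, 'r) ring_scheme \<Rightarrow> ('k, 'a, 'm) module_scheme
    \<Rightarrow> ('k, 'b, 'n) module_scheme \<Rightarrow> 'b \<Rightarrow> ('k, 'a, 'b) tensor" where
  "right_factor K X Y y = ptens K X Y \<one>\<^bsub>X\<^esub> y"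

context algebra_pair
begin

lemma left_factor_alg_hom: "alg_hom K A (A \<boxtimes>\<^bsub>K\<^esub> B) (left_factor K A B)"
  unfolding left_factor_def
  by (rule alg_homI) (simp_all add: ptens_add_left ptens_smult_left tensor_one
      A.assoc_algebra_axioms tensor_assoc_algebra)

lemma right_factor_alg_hom: "alg_hom K B (A \<boxtimes>\<^bsub>K\<^esub> B) (right_factor K A B)"
  unfolding right_factor_def
  by (rule alg_homI) (simp_all add: ptens_add_right ptens_smult_right tensor_one
      B.assoc_algebra_axioms tensor_assoc_algebra)

lemma factors_commuting:
  "commuting A B (A \<boxtimes>\<^bsub>K\<^esub> B) (left_factor K A B) (right_factor K A B)"
  by (simp add: commuting_def left_factor_def right_factor_def)

lemma pairing_factors:
  assumes "t \<in> carrier (A \<boxtimes>\<^bsub>K\<^esub> B)"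
  shows "pairing K A B (A \<boxtimes>\<^bsub>K\<^esub> B) (left_factor K A B) (right_factor K A B) t = t"
proof -
  interpret hom_pair K A B "A \<boxtimes>\<^bsub>K\<^esub> B" "left_factor K A B" "right_factor K A B"
    by (intro hom_pair.intro left_factor_alg_hom right_factor_alg_hom)
  show ?thesis
    by (rule pairing_unique[symmetric, OF _ _ assms, of "\<lambda>t. t"])
      (auto intro: linear_mapsI simp: left_factor_def right_factor_def)
qed

end

section \<open>Structural maps between iterated tensor products\<close>

lemma tensor_map_linear_ptens:
  fixes K (structure) and A B C D
  assumes "module K A" "module K B" "module K C" "module K D"
    and f: "f \<in> linear_maps K A C" and g: "g \<in> linear_maps K B D"
  shows tensor_map_linear: "tensor_map K A B C D f g \<in> linear_maps K (A \<boxtimes> B) (C \<boxtimes> D)"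
    and tensor_map_ptens: "\<lbrakk>a \<in> carrier A; b \<in> carrier B\<rbrakk>
      \<Longrightarrow> tensor_map K A B C D f g (ptens K A B a b) = ptens K C D (f a) (g b)"
proof -
  interpret AB: tensor_pair K A B using assms by (intro tensor_pair.intro)
  interpret CD: tensor_pair K C D using assms by (intro tensor_pair.intro)
  have bil: "(\<lambda>a b. ptens K C D (f a) (g b)) \<in> bilinear_maps K A B (C \<boxtimes> D)"
    by (rule bilinear_mapsI)
      (auto intro: linear_maps_comp[OF g CD.ptens_linear_right] linear_maps_comp[OF f CD.ptens_linear_left]
        linear_maps_closed[OF f] linear_maps_closed[OF g])
  show "tensor_map K A B C D f g \<in> linear_maps K (A \<boxtimes> B) (C \<boxtimes> D)"
    unfolding tensor_map_def by (rule AB.lift_linear[OF CD.tensor_module bil])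
  show "tensor_map K A B C D f g (ptens K A B a b) = ptens K C D (f a) (g b)"
    if "a \<in> carrier A" "b \<in> carrier B"
    unfolding tensor_map_def by (rule AB.tensor_lift_ptens[OF CD.tensor_module bil that])
qed

lemma tensor_assoc_linear_ptens:
  fixes K (structure) and A B C
  assumes "module K A" "module K B" "module K C"
  shows tensor_assoc_linear:
      "tensor_assoc K A B C \<in> linear_maps K ((A \<boxtimes> B) \<boxtimes> C) (A \<boxtimes> (B \<boxtimes> C))"
    and tensor_assoc_ptens: "\<lbrakk>a \<in> carrier A; b \<in> carrier B; c \<in> carrier C\<rbrakk>
      \<Longrightarrow> tensor_assoc K A B C (ptens K (A \<boxtimes> B) C (ptens K A B a b) c)
        = ptens K A (B \<boxtimes> C) a (ptens K B C b c)"
proof -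
  interpret AB: tensor_pair K A B using assms by (intro tensor_pair.intro)
  interpret BC: tensor_pair K B C using assms by (intro tensor_pair.intro)
  interpret A_BC: tensor_pair K A "B \<boxtimes> C" using assms BC.tensor_module by (intro tensor_pair.intro)
  interpret AB_C: tensor_pair K "A \<boxtimes> B" C using assms AB.tensor_module by (intro tensor_pair.intro)
  let ?M = "A \<boxtimes> (B \<boxtimes> C)"
  have bil: "(\<lambda>a b. ptens K A (B \<boxtimes> C) a (ptens K B C b c)) \<in> bilinear_maps K A B ?M"
    if "c \<in> carrier C" for c
    by (rule bilinear_mapsI,
        rule linear_maps_comp[OF BC.ptens_linear_left[OF that] A_BC.ptens_linear_right],
        assumption, rule A_BC.ptens_linear_left, rule BC.ptens_closed[OF _ that])
  have bil2: "(\<lambda>t c. tensor_lift K A B ?M (\<lambda>a b. ptens K A (B \<boxtimes> C) a (ptens K B C b c)) t)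
      \<in> bilinear_maps K (A \<boxtimes> B) C ?M"
    by (rule bilinear_mapsI, rule AB.lift_param[OF A_BC.tensor_module bil],
        assumption, rule linear_maps_comp[OF BC.ptens_linear_right A_BC.ptens_linear_right],
        assumption, assumption, rule assms, assumption,
        rule AB.lift_linear[OF A_BC.tensor_module bil])
  show "tensor_assoc K A B C \<in> linear_maps K ((A \<boxtimes> B) \<boxtimes> C) ?M"
    unfolding tensor_assoc_def by (rule AB_C.lift_linear[OF A_BC.tensor_module bil2])
  show "tensor_assoc K A B C (ptens K (A \<boxtimes> B) C (ptens K A B a b) c)
        = ptens K A (B \<boxtimes> C) a (ptens K B C b c)"
    if "a \<in> carrier A" "b \<in> carrier B" "c \<in> carrier C"
    using that unfolding tensor_assoc_def
    by (simp add: AB_C.tensor_lift_ptens[OF A_BC.tensor_module bil2]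
        AB.tensor_lift_ptens[OF A_BC.tensor_module bil])
qed

lemma middle_flip_linear_ptens:
  fixes K (structure) and A B C D
  assumes "module K A" "module K B" "module K C" "module K D"
  shows middle_flip_linear: "middle_flip K A B C D
      \<in> linear_maps K ((A \<boxtimes> B) \<boxtimes> (C \<boxtimes> D)) ((A \<boxtimes> C) \<boxtimes> (B \<boxtimes> D))"
    and middle_flip_ptens:
      "\<lbrakk>a \<in> carrier A; b \<in> carrier B; c \<in> carrier C; d \<in> carrier D\<rbrakk>
      \<Longrightarrow> middle_flip K A B C D (ptens K (A \<boxtimes> B) (C \<boxtimes> D) (ptens K A B a b) (ptens K C D c d))
        = ptens K (A \<boxtimes> C) (B \<boxtimes> D) (ptens K A C a c) (ptens K B D b d)"
proof -
  interpret AB: tensor_pair K A B using assms by (intro tensor_pair.intro)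
  interpret CD: tensor_pair K C D using assms by (intro tensor_pair.intro)
  interpret AC: tensor_pair K A C using assms by (intro tensor_pair.intro)
  interpret BD: tensor_pair K B D using assms by (intro tensor_pair.intro)
  interpret ABCD: tensor_pair K "A \<boxtimes> B" "C \<boxtimes> D"
    using AB.tensor_module CD.tensor_module by (intro tensor_pair.intro)
  interpret ACBD: tensor_pair K "A \<boxtimes> C" "B \<boxtimes> D"
    using AC.tensor_module BD.tensor_module by (intro tensor_pair.intro)
  let ?T = "(A \<boxtimes> C) \<boxtimes> (B \<boxtimes> D)"
  let ?p = "\<lambda>a b c d. ptens K (A \<boxtimes> C) (B \<boxtimes> D) (ptens K A C a c) (ptens K B D b d)"
  note T = ACBD.tensor_module
  have bil: "?p a b \<in> bilinear_maps K C D ?T" if "a \<in> carrier A" "b \<in> carrier B" for a b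
    by (rule bilinear_mapsI,
        rule linear_maps_comp[OF BD.ptens_linear_right[OF that(2)] ACBD.ptens_linear_right],
        rule AC.ptens_closed[OF that(1)], assumption,
        rule linear_maps_comp[OF AC.ptens_linear_right[OF that(1)] ACBD.ptens_linear_left],
        rule BD.ptens_closed[OF that(2)])
  have bil2: "(\<lambda>a b. tensor_lift K C D ?T (?p a b) t) \<in> bilinear_maps K A B ?T"
    if t: "t \<in> carrier (C \<boxtimes> D)" for t
  proof (rule bilinear_mapsI; rule CD.lift_param[OF T _ _ _ t])
    show "(\<lambda>b. ?p a b c d) \<in> linear_maps K B ?T"
      if "a \<in> carrier A" "c \<in> carrier C" "d \<in> carrier D" for a c d
      by (rule linear_maps_comp[OF BD.ptens_linear_left[OF that(3)]
            ACBD.ptens_linear_right[OF AC.ptens_closed[OF that(1,2)]]])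
    show "(\<lambda>a. ?p a b c d) \<in> linear_maps K A ?T"
      if "b \<in> carrier B" "c \<in> carrier C" "d \<in> carrier D" for b c d
      by (rule linear_maps_comp[OF AC.ptens_linear_left[OF that(2)]
            ACBD.ptens_linear_left[OF BD.ptens_closed[OF that(1,3)]]])
  qed (auto intro: bil assms)
  have bil3: "(\<lambda>s t. tensor_lift K A B ?T (\<lambda>a b. tensor_lift K C D ?T (?p a b) t) s)
      \<in> bilinear_maps K (A \<boxtimes> B) (C \<boxtimes> D) ?T"
    by (rule bilinear_mapsI, rule AB.lift_param[OF T bil2], assumption,
        rule CD.lift_linear[OF T bil], assumption, assumption, rule CD.tensor_module, assumption,
        rule AB.lift_linear[OF T bil2])
  show "middle_flip K A B C D \<in> linear_maps K ((A \<boxtimes> B) \<boxtimes> (C \<boxtimes> D)) ?T"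
    unfolding middle_flip_def Let_def by (rule ABCD.lift_linear[OF T bil3])
  show "middle_flip K A B C D (ptens K (A \<boxtimes> B) (C \<boxtimes> D) (ptens K A B a b) (ptens K C D c d))
        = ?p a b c d"
    if "a \<in> carrier A" "b \<in> carrier B" "c \<in> carrier C" "d \<in> carrier D"
    using that unfolding middle_flip_def Let_def
    by (simp add: ABCD.tensor_lift_ptens[OF T bil3] AB.tensor_lift_ptens[OF T bil2]
        CD.tensor_lift_ptens[OF T bil])
qed

section \<open>Three commuting homomorphisms\<close>

text \<open>Three algebra homomorphisms into \<open>T\<close> whose images commute pairwise.  Through the map \<open>triple\<close>,
  \<open>x \<otimes> (y \<otimes> z) \<mapsto> f(x) g(y) h(z)\<close>, every identity in a triple tensor product becomes an identity
  in \<open>T\<close>, and a leg of an element becomes a pairing.\<close>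

locale hom_triple = f: alg_hom K X T f + g: alg_hom K Y T g + h: alg_hom K Z T h
  for K (structure) and X (structure) and Y (structure) and Z (structure) and T (structure)
    and f g h +
  assumes fg: "commuting X Y T f g" and fh: "commuting X Z T f h" and gh: "commuting Y Z T g h"
begin

sublocale fg: hom_pair K X Y T f g ..
sublocale fh: hom_pair K X Z T f h ..
sublocale gh: hom_pair K Y Z T g h ..

sublocale pgh: alg_hom K "Y \<boxtimes>\<^bsub>K\<^esub> Z" T "pairing K Y Z T g h"
  by (rule gh.pairing_alg_hom[OF gh])

sublocale pfg: alg_hom K "X \<boxtimes>\<^bsub>K\<^esub> Y" T "pairing K X Y T f g"
  by (rule fg.pairing_alg_hom[OF fg])

sublocale f_gh: hom_pair K X "Y \<boxtimes>\<^bsub>K\<^esub> Z" T f "pairing K Y Z T g h" ..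
sublocale fg_h: hom_pair K "X \<boxtimes>\<^bsub>K\<^esub> Y" Z T "pairing K X Y T f g" h ..

lemma commuting_f_gh: "commuting X (Y \<boxtimes>\<^bsub>K\<^esub> Z) T f (pairing K Y Z T g h)"
  by (intro commuting_sym[OF gh.commuting_pairing] commuting_sym[OF fg] commuting_sym[OF fh]
      f.alg_hom_axioms)

lemma commuting_fg_h: "commuting (X \<boxtimes>\<^bsub>K\<^esub> Y) Z T (pairing K X Y T f g) h"
  by (rule fg.commuting_pairing[OF fh gh h.alg_hom_axioms])

definition triple where
  "triple = pairing K X (Y \<boxtimes>\<^bsub>K\<^esub> Z) T f (pairing K Y Z T g h)"

sublocale triple: alg_hom K "X \<boxtimes>\<^bsub>K\<^esub> (Y \<boxtimes>\<^bsub>K\<^esub> Z)" T triple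
  unfolding triple_def by (rule f_gh.pairing_alg_hom[OF commuting_f_gh])

lemma assoc_closed:
  "t \<in> carrier ((X \<boxtimes>\<^bsub>K\<^esub> Y) \<boxtimes>\<^bsub>K\<^esub> Z) \<Longrightarrow> tensor_assoc K X Y Z t \<in> carrier (X \<boxtimes>\<^bsub>K\<^esub> (Y \<boxtimes>\<^bsub>K\<^esub> Z))"
  by (rule linear_maps_closed[OF tensor_assoc_linear])
    (auto intro: f.X.module_axioms g.X.module_axioms h.X.module_axioms)

lemma triple_assoc:
  assumes "s \<in> carrier (X \<boxtimes>\<^bsub>K\<^esub> Y)" "z \<in> carrier Z"
  shows "triple (tensor_assoc K X Y Z (ptens K (X \<boxtimes>\<^bsub>K\<^esub> Y) Z s z)) = pairing K X Y T f g s \<otimes>\<^bsub>T\<^esub> h z"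
  using assms(1)
proof (induction s rule: fg.XY.tensor_induct)
  case (pure x y)
  then show ?case using assms(2)
    by (simp add: tensor_assoc_ptens f.X.module_axioms g.X.module_axioms h.X.module_axioms
        triple_def f.T.A.m_assoc)
next
  case (add s t)
  have "tensor_assoc K X Y Z (ptens K (X \<boxtimes>\<^bsub>K\<^esub> Y) Z (s \<oplus>\<^bsub>X \<boxtimes>\<^bsub>K\<^esub> Y\<^esub> t) z)
    = tensor_assoc K X Y Z (ptens K (X \<boxtimes>\<^bsub>K\<^esub> Y) Z s z)
      \<oplus>\<^bsub>X \<boxtimes>\<^bsub>K\<^esub> (Y \<boxtimes>\<^bsub>K\<^esub> Z)\<^esub> tensor_assoc K X Y Z (ptens K (X \<boxtimes>\<^bsub>K\<^esub> Y) Z t z)"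
    using add assms(2)
    by (simp add: fg_h.XY.ptens_add_left linear_maps_add[OF tensor_assoc_linear]
        f.X.module_axioms g.X.module_axioms h.X.module_axioms)
  then show ?case
    using add assms(2)
    by (simp add: triple.add assoc_closed fg.pairing_add f.T.A.l_distr)
qed

lemma leg12_closed: "t \<in> carrier (X \<boxtimes>\<^bsub>K\<^esub> Y) \<Longrightarrow> leg12 K X Y Z t \<in> carrier (X \<boxtimes>\<^bsub>K\<^esub> (Y \<boxtimes>\<^bsub>K\<^esub> Z))"
  by (simp add: leg12_def assoc_closed)

lemma leg23_closed: "t \<in> carrier (Y \<boxtimes>\<^bsub>K\<^esub> Z) \<Longrightarrow> leg23 K X Y Z t \<in> carrier (X \<boxtimes>\<^bsub>K\<^esub> (Y \<boxtimes>\<^bsub>K\<^esub> Z))"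
  by (simp add: leg23_def)

lemma leg13_linear: "leg13 K X Y Z \<in> linear_maps K (X \<boxtimes>\<^bsub>K\<^esub> Z) (X \<boxtimes>\<^bsub>K\<^esub> (Y \<boxtimes>\<^bsub>K\<^esub> Z))"
  and leg13_ptens: "\<lbrakk>x \<in> carrier X; z \<in> carrier Z\<rbrakk> \<Longrightarrow>
    leg13 K X Y Z (ptens K X Z x z) = ptens K X (Y \<boxtimes>\<^bsub>K\<^esub> Z) x (ptens K Y Z \<one>\<^bsub>Y\<^esub> z)"
proof -
  have bil: "(\<lambda>a c. ptens K X (Y \<boxtimes>\<^bsub>K\<^esub> Z) a (ptens K Y Z \<one>\<^bsub>Y\<^esub> c))
      \<in> bilinear_maps K X Z (X \<boxtimes>\<^bsub>K\<^esub> (Y \<boxtimes>\<^bsub>K\<^esub> Z))"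
    by (rule bilinear_mapsI; rule linear_mapsI)
      (simp_all add: gh.XY.ptens_add_right gh.XY.ptens_smult_right f_gh.XY.ptens_add_right
        f_gh.XY.ptens_smult_right f_gh.XY.ptens_add_left f_gh.XY.ptens_smult_left)
  show "leg13 K X Y Z \<in> linear_maps K (X \<boxtimes>\<^bsub>K\<^esub> Z) (X \<boxtimes>\<^bsub>K\<^esub> (Y \<boxtimes>\<^bsub>K\<^esub> Z))"
    unfolding leg13_def by (rule fh.XY.lift_linear[OF f_gh.XY.tensor_module bil])
  show "leg13 K X Y Z (ptens K X Z x z) = ptens K X (Y \<boxtimes>\<^bsub>K\<^esub> Z) x (ptens K Y Z \<one>\<^bsub>Y\<^esub> z)"
    if "x \<in> carrier X" "z \<in> carrier Z"
    unfolding leg13_def by (rule fh.XY.tensor_lift_ptens[OF f_gh.XY.tensor_module bil that])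
qed

lemmas leg13_closed = linear_maps_closed[OF leg13_linear]

lemma triple_leg12:
  "t \<in> carrier (X \<boxtimes>\<^bsub>K\<^esub> Y) \<Longrightarrow> triple (leg12 K X Y Z t) = pairing K X Y T f g t"
  by (simp add: leg12_def triple_assoc)

lemma triple_leg23:
  "t \<in> carrier (Y \<boxtimes>\<^bsub>K\<^esub> Z) \<Longrightarrow> triple (leg23 K X Y Z t) = pairing K Y Z T g h t"
  by (simp add: leg23_def triple_def)

lemma triple_leg13:
  "t \<in> carrier (X \<boxtimes>\<^bsub>K\<^esub> Z) \<Longrightarrow> triple (leg13 K X Y Z t) = pairing K X Z T f h t"
  by (rule fh.pairing_unique[OF linear_maps_comp[OF leg13_linear triple.linear]])
    (simp_all add: leg13_ptens triple_def)

text \<open>The map \<open>d\<close> stands for a comultiplication, possibly a twisted one or that of a tensor product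
  bialgebra.\<close>

lemma
  assumes "alg_hom K W (X \<boxtimes>\<^bsub>K\<^esub> Y) d" and t: "t \<in> carrier (W \<boxtimes>\<^bsub>K\<^esub> Z)"
  shows comult_left_closed: "tensor_assoc K X Y Z (tensor_map K W Z (X \<boxtimes>\<^bsub>K\<^esub> Y) Z d (\<lambda>z. z) t)
      \<in> carrier (X \<boxtimes>\<^bsub>K\<^esub> (Y \<boxtimes>\<^bsub>K\<^esub> Z))"
    and triple_comult_left: "triple (tensor_assoc K X Y Z (tensor_map K W Z (X \<boxtimes>\<^bsub>K\<^esub> Y) Z d (\<lambda>z. z) t))
      = pairing K W Z T (\<lambda>w. pairing K X Y T f g (d w)) h t"
proof -
  interpret d: alg_hom K W "X \<boxtimes>\<^bsub>K\<^esub> Y" d by fact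
  interpret p: hom_pair K W Z T "\<lambda>w. pairing K X Y T f g (d w)" h
    by (intro hom_pair.intro alg_hom_comp[OF d.alg_hom_axioms] pfg.alg_hom_axioms h.alg_hom_axioms)
  note mods = d.X.module_axioms h.X.module_axioms fg.XY.tensor_module
    d.linear alg_hom.linear[OF alg_hom_id[OF h.X.assoc_algebra_axioms]]
  note lin = linear_maps_comp[OF tensor_map_linear[OF mods(1,2,3,2,4,5)]
      tensor_assoc_linear[OF f.X.module_axioms g.X.module_axioms h.X.module_axioms]]
  show "tensor_assoc K X Y Z (tensor_map K W Z (X \<boxtimes>\<^bsub>K\<^esub> Y) Z d (\<lambda>z. z) t)
      \<in> carrier (X \<boxtimes>\<^bsub>K\<^esub> (Y \<boxtimes>\<^bsub>K\<^esub> Z))"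
    by (rule linear_maps_closed[OF lin t])
  show "triple (tensor_assoc K X Y Z (tensor_map K W Z (X \<boxtimes>\<^bsub>K\<^esub> Y) Z d (\<lambda>z. z) t))
      = pairing K W Z T (\<lambda>w. pairing K X Y T f g (d w)) h t"
    by (rule p.pairing_unique[OF linear_maps_comp[OF lin triple.linear] _ t])
      (simp add: tensor_map_ptens[OF mods(1,2,3,2,4,5)] triple_assoc)
qed

lemma
  assumes "alg_hom K W (Y \<boxtimes>\<^bsub>K\<^esub> Z) d" and t: "t \<in> carrier (X \<boxtimes>\<^bsub>K\<^esub> W)"
  shows comult_right_closed: "tensor_map K X W X (Y \<boxtimes>\<^bsub>K\<^esub> Z) (\<lambda>x. x) d t
      \<in> carrier (X \<boxtimes>\<^bsub>K\<^esub> (Y \<boxtimes>\<^bsub>K\<^esub> Z))"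
    and triple_comult_right: "triple (tensor_map K X W X (Y \<boxtimes>\<^bsub>K\<^esub> Z) (\<lambda>x. x) d t)
      = pairing K X W T f (\<lambda>w. pairing K Y Z T g h (d w)) t"
proof -
  interpret d: alg_hom K W "Y \<boxtimes>\<^bsub>K\<^esub> Z" d by fact
  interpret p: hom_pair K X W T f "\<lambda>w. pairing K Y Z T g h (d w)"
    by (intro hom_pair.intro alg_hom_comp[OF d.alg_hom_axioms] pgh.alg_hom_axioms f.alg_hom_axioms)
  note mods = f.X.module_axioms d.X.module_axioms gh.XY.tensor_module
    alg_hom.linear[OF alg_hom_id[OF f.X.assoc_algebra_axioms]] d.linear
  note lin = tensor_map_linear[OF mods(1,2,1,3,4,5)]
  show "tensor_map K X W X (Y \<boxtimes>\<^bsub>K\<^esub> Z) (\<lambda>x. x) d t \<in> carrier (X \<boxtimes>\<^bsub>K\<^esub> (Y \<boxtimes>\<^bsub>K\<^esub> Z))"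
    by (rule linear_maps_closed[OF lin t])
  show "triple (tensor_map K X W X (Y \<boxtimes>\<^bsub>K\<^esub> Z) (\<lambda>x. x) d t)
      = pairing K X W T f (\<lambda>w. pairing K Y Z T g h (d w)) t"
    by (rule p.pairing_unique[OF linear_maps_comp[OF lin triple.linear] _ t])
      (simp add: tensor_map_ptens[OF mods(1,2,1,3,4,5)] triple_def)
qed

end

text \<open>The three embeddings of \<open>H\<close> into \<open>H \<otimes> (H \<otimes> H)\<close>.  For them \<open>triple\<close> is the identity, so that
  an identity in \<open>H \<otimes> (H \<otimes> H)\<close> is equivalent to its image under these embeddings.\<close>

lemma triple_embeddings:
  fixes K (structure) and H (structure)
  assumes "assoc_algebra K H"
  defines "i1 \<equiv> left_factor K H (H \<boxtimes>\<^bsub>K\<^esub> H)"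
    and "i2 \<equiv> \<lambda>x. right_factor K H (H \<boxtimes>\<^bsub>K\<^esub> H) (left_factor K H H x)"
    and "i3 \<equiv> \<lambda>x. right_factor K H (H \<boxtimes>\<^bsub>K\<^esub> H) (right_factor K H H x)"
  shows "hom_triple K H H H (H \<boxtimes>\<^bsub>K\<^esub> (H \<boxtimes>\<^bsub>K\<^esub> H)) i1 i2 i3"
    and "t \<in> carrier (H \<boxtimes>\<^bsub>K\<^esub> (H \<boxtimes>\<^bsub>K\<^esub> H)) \<Longrightarrow>
      hom_triple.triple K H H H (H \<boxtimes>\<^bsub>K\<^esub> (H \<boxtimes>\<^bsub>K\<^esub> H)) i1 i2 i3 t = t"
proof -
  interpret H: assoc_algebra K H by fact
  interpret HH: algebra_pair K H H ..
  interpret HHH: algebra_pair K H "H \<boxtimes>\<^bsub>K\<^esub> H" ..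
  note emb = HH.left_factor_alg_hom HH.right_factor_alg_hom
    HHH.left_factor_alg_hom HHH.right_factor_alg_hom
  have c: "commuting H H (H \<boxtimes>\<^bsub>K\<^esub> (H \<boxtimes>\<^bsub>K\<^esub> H)) i1 i2" "commuting H H (H \<boxtimes>\<^bsub>K\<^esub> (H \<boxtimes>\<^bsub>K\<^esub> H)) i1 i3"
      "commuting H H (H \<boxtimes>\<^bsub>K\<^esub> (H \<boxtimes>\<^bsub>K\<^esub> H)) i2 i3"
    by (auto simp: commuting_def i1_def i2_def i3_def left_factor_def right_factor_def)
  interpret hom_triple K H H H "H \<boxtimes>\<^bsub>K\<^esub> (H \<boxtimes>\<^bsub>K\<^esub> H)" i1 i2 i3
    unfolding i1_def i2_def i3_def
    by (intro hom_triple.intro hom_triple_axioms.intro alg_hom_comp[OF _ emb(4)] emb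
        c[unfolded i1_def i2_def i3_def])
  show "hom_triple K H H H (H \<boxtimes>\<^bsub>K\<^esub> (H \<boxtimes>\<^bsub>K\<^esub> H)) i1 i2 i3" by (rule hom_triple_axioms)
  have id: "pairing K H H (H \<boxtimes>\<^bsub>K\<^esub> (H \<boxtimes>\<^bsub>K\<^esub> H)) i2 i3 s = right_factor K H (H \<boxtimes>\<^bsub>K\<^esub> H) s"
    if "s \<in> carrier (H \<boxtimes>\<^bsub>K\<^esub> H)" for s
    using hom_pair.pairing_comp[OF hom_pair.intro[OF emb(1,2)] emb(4) that]
    by (simp add: HH.pairing_factors that i2_def i3_def)
  show "triple t = t" if "t \<in> carrier (H \<boxtimes>\<^bsub>K\<^esub> (H \<boxtimes>\<^bsub>K\<^esub> H))"
    unfolding triple_def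
    using that
    by (subst hom_pair.pairing_cong[OF hom_pair.intro[OF emb(3,4)] _ id])
      (simp_all add: i1_def HHH.pairing_factors)
qed

section \<open>Independence of tensor products from the coalgebra structure\<close>

text \<open>Tensor products and the maps between them use only the algebra structure of a bialgebra.  Hence they are the same for \<open>H\<^sub>F\<close> as for \<open>H\<close>, and the same for the tensor product
  bialgebra as for the underlying algebra.\<close>

lemma tensor_vs_extend [simp]:
  "tensor_vs K (module.extend X r) B = tensor_vs K X B"
  "tensor_vs K A (module.extend X r) = tensor_vs K A X"
  by (simp_all add: tensor_vs_def tensor_null_def tensor_relators_def Let_def module.defs)

lemma ptens_extend [simp]:
  "ptens K (module.extend X r) B = ptens K X B"
  "ptens K A (module.extend X r) = ptens K A X"
  by (simp_all add: ptens_def tensor_null_def tensor_relators_def Let_def module.defs fun_eq_iff)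

lemma tensor_algebra_extend [simp]:
  "module.extend X r \<boxtimes>\<^bsub>K\<^esub> B = X \<boxtimes>\<^bsub>K\<^esub> B"
  "A \<boxtimes>\<^bsub>K\<^esub> module.extend X r = A \<boxtimes>\<^bsub>K\<^esub> X"
  by (simp_all add: tensor_algebra_def tensor_lift_def[abs_def]) (simp_all add: module.defs)

lemma tensor_lift_extend [simp]:
  "tensor_lift K (module.extend X r) B M \<phi> = tensor_lift K X B M \<phi>"
  "tensor_lift K A (module.extend X r) M \<psi> = tensor_lift K A X M \<psi>"
  by (simp_all add: tensor_lift_def[abs_def])

lemma tensor_vs_comult [simp]:
  "tensor_vs K (X\<lparr>comult := d\<rparr>) B = tensor_vs K X B"
  "tensor_vs K A (X\<lparr>comult := d\<rparr>) = tensor_vs K A X"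
  by (simp_all add: tensor_vs_def tensor_null_def tensor_relators_def Let_def)

lemma ptens_comult [simp]:
  "ptens K (X\<lparr>comult := d\<rparr>) B = ptens K X B"
  "ptens K A (X\<lparr>comult := d\<rparr>) = ptens K A X"
  by (simp_all add: ptens_def tensor_null_def tensor_relators_def Let_def fun_eq_iff)

lemma tensor_algebra_comult [simp]:
  "X\<lparr>comult := d\<rparr> \<boxtimes>\<^bsub>K\<^esub> B = X \<boxtimes>\<^bsub>K\<^esub> B"
  "A \<boxtimes>\<^bsub>K\<^esub> X\<lparr>comult := d\<rparr> = A \<boxtimes>\<^bsub>K\<^esub> X"
  by (simp_all add: tensor_algebra_def tensor_lift_def[abs_def])

lemma tensor_lift_comult [simp]:
  "tensor_lift K (X\<lparr>comult := d\<rparr>) B M \<phi> = tensor_lift K X B M \<phi>"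
  "tensor_lift K A (X\<lparr>comult := d\<rparr>) M \<psi> = tensor_lift K A X M \<psi>"
  by (simp_all add: tensor_lift_def[abs_def])

lemma weak_R_matrix_twisted:
  "weak_R_matrix K (twisted_bialgebra K B F2) (twisted_bialgebra K A F1) R \<longleftrightarrow>
    R \<in> Units (B \<boxtimes>\<^bsub>K\<^esub> A) \<and>
    tensor_map K B A B (A \<boxtimes>\<^bsub>K\<^esub> A) (\<lambda>b. b)
        (\<lambda>x. F1 \<otimes>\<^bsub>A \<boxtimes>\<^bsub>K\<^esub> A\<^esub> comult A x \<otimes>\<^bsub>A \<boxtimes>\<^bsub>K\<^esub> A\<^esub> inv\<^bsub>A \<boxtimes>\<^bsub>K\<^esub> A\<^esub> F1) R
      = leg13 K B A A R \<otimes>\<^bsub>B \<boxtimes>\<^bsub>K\<^esub> (A \<boxtimes>\<^bsub>K\<^esub> A)\<^esub> leg12 K B A A R \<and>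
    tensor_assoc K B B A (tensor_map K B A (B \<boxtimes>\<^bsub>K\<^esub> B) A
        (\<lambda>x. F2 \<otimes>\<^bsub>B \<boxtimes>\<^bsub>K\<^esub> B\<^esub> comult B x \<otimes>\<^bsub>B \<boxtimes>\<^bsub>K\<^esub> B\<^esub> inv\<^bsub>B \<boxtimes>\<^bsub>K\<^esub> B\<^esub> F2) (\<lambda>a. a) R)
      = leg13 K B B A R \<otimes>\<^bsub>B \<boxtimes>\<^bsub>K\<^esub> (B \<boxtimes>\<^bsub>K\<^esub> A)\<^esub> leg23 K B B A R"
  by (simp add: weak_R_matrix_def twisted_bialgebra_def comult_right_def comult_left_def
      tensor_map_def[abs_def] tensor_assoc_def leg12_def leg13_def leg23_def)

lemma tensor_lift_extend_cod [simp]: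
  "tensor_lift K A B (module.extend X r) \<phi> = tensor_lift K A B X \<phi>"
  by (simp add: tensor_lift_def[abs_def] Let_def finsum_def finprod_def module.defs cong: if_cong)

lemma twist_tensor_bialgebra:
  fixes K :: "('k, 'r) ring_scheme"
    and A :: "('k, 'a, 'm) bialgebra_scheme" and B :: "('k, 'b, 'n) bialgebra_scheme"
  defines "P \<equiv> A \<boxtimes>\<^bsub>K\<^esub> B"
    and "\<Delta> \<equiv> \<lambda>t. middle_flip K A A B B
        (tensor_map K A B (A \<boxtimes>\<^bsub>K\<^esub> A) (B \<boxtimes>\<^bsub>K\<^esub> B) (comult A) (comult B) t)"
    and "\<epsilon> \<equiv> tensor_lift K A B (base_algebra K) (\<lambda>a b. counit A a \<otimes>\<^bsub>K\<^esub> counit B b)"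
  shows "twist K (tensor_bialgebra K A B) F \<longleftrightarrow>
    F \<in> Units (P \<boxtimes>\<^bsub>K\<^esub> P) \<and>
    leg12 K P P P F \<otimes>\<^bsub>P \<boxtimes>\<^bsub>K\<^esub> (P \<boxtimes>\<^bsub>K\<^esub> P)\<^esub>
        tensor_assoc K P P P (tensor_map K P P (P \<boxtimes>\<^bsub>K\<^esub> P) P \<Delta> (\<lambda>x. x) F)
      = leg23 K P P P F \<otimes>\<^bsub>P \<boxtimes>\<^bsub>K\<^esub> (P \<boxtimes>\<^bsub>K\<^esub> P)\<^esub> tensor_map K P P P (P \<boxtimes>\<^bsub>K\<^esub> P) (\<lambda>x. x) \<Delta> F \<and>
    tensor_lift K P P P (\<lambda>x y. \<epsilon> x \<odot>\<^bsub>P\<^esub> y) F = \<one>\<^bsub>P\<^esub> \<and>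
    tensor_lift K P P P (\<lambda>x y. \<epsilon> y \<odot>\<^bsub>P\<^esub> x) F = \<one>\<^bsub>P\<^esub>"
proof -
  have sel: "comult (tensor_bialgebra K A B) = \<Delta>" "counit (tensor_bialgebra K A B) = \<epsilon>"
    "one (tensor_bialgebra K A B) = \<one>\<^bsub>P\<^esub>" "smult (tensor_bialgebra K A B) = smult P"
    by (simp_all add: tensor_bialgebra_def module.defs \<Delta>_def \<epsilon>_def P_def)
  have cong [simp]: "tensor_bialgebra K A B \<boxtimes>\<^bsub>K\<^esub> Y = P \<boxtimes>\<^bsub>K\<^esub> Y"
    "X \<boxtimes>\<^bsub>K\<^esub> tensor_bialgebra K A B = X \<boxtimes>\<^bsub>K\<^esub> P"
    "ptens K (tensor_bialgebra K A B) Y = ptens K P Y"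
    "ptens K X (tensor_bialgebra K A B) = ptens K X P"
    "tensor_lift K (tensor_bialgebra K A B) Y M \<phi> = tensor_lift K P Y M \<phi>"
    "tensor_lift K X (tensor_bialgebra K A B) M \<phi>' = tensor_lift K X P M \<phi>'"
    "tensor_lift K X Y (tensor_bialgebra K A B) \<psi> = tensor_lift K X Y P \<psi>" for X Y M \<phi> \<phi>' \<psi>
    by (simp_all add: tensor_bialgebra_def P_def)
  show ?thesis
    by (simp add: twist_def leg12_def leg23_def comult_left_def comult_right_def
        counit_left_def counit_right_def tensor_map_def[abs_def] tensor_assoc_def sel)
qed

section \<open>Characters and bialgebras\<close>

lemma base_algebra_sel [simp]:
  "carrier (base_algebra K) = carrier K" "mult (base_algebra K) = mult K"
  "one (base_algebra K) = one K" "zero (base_algebra K) = zero K"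
  "add (base_algebra K) = add K" "smult (base_algebra K) = mult K"
  by (simp_all add: base_algebra_def)

lemma base_assoc_algebra:
  assumes "cring K" shows "assoc_algebra K (base_algebra K)"
proof -
  interpret K: cring K by fact
  have ring: "ring (base_algebra K)"
  proof (rule ringI)
    show "abelian_group (base_algebra K)"
    proof (rule abelian_groupI)
      show "\<exists>y\<in>carrier (base_algebra K). y \<oplus>\<^bsub>base_algebra K\<^esub> x = \<zero>\<^bsub>base_algebra K\<^esub>"
        if "x \<in> carrier (base_algebra K)" for x
        by (rule bexI[of _ "\<ominus>\<^bsub>K\<^esub> x"]) (use that in \<open>simp_all add: K.l_neg\<close>)
    qed (simp_all add: K.a_ac)
    show "Group.monoid (base_algebra K)"
      by (rule monoidI) (simp_all add: K.m_assoc)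
  qed (simp_all add: K.l_distr K.r_distr)
  show ?thesis
    by (intro assoc_algebra.intro assoc_algebra_axioms.intro moduleI ring.is_abelian_group ring assms)
      (simp_all add: K.m_assoc K.l_distr K.r_distr K.m_lcomm)
qed

context assoc_algebra
begin

lemma unit_alg_hom: "alg_hom K (base_algebra K) A (\<lambda>c. c \<odot>\<^bsub>A\<^esub> \<one>\<^bsub>A\<^esub>)"
  by (rule alg_homI[OF base_assoc_algebra[OF R.is_cring] assoc_algebra_axioms])
    (simp_all add: smult_l_distr smult_assoc1 smult_mult_left)

lemma scalar_central:
  "\<lbrakk>c \<in> carrier K; x \<in> carrier A\<rbrakk> \<Longrightarrow> (c \<odot>\<^bsub>A\<^esub> \<one>\<^bsub>A\<^esub>) \<otimes>\<^bsub>A\<^esub> x = x \<otimes>\<^bsub>A\<^esub> (c \<odot>\<^bsub>A\<^esub> \<one>\<^bsub>A\<^esub>)"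
  by (simp add: smult_mult_left smult_mult_right)

end

text \<open>Characters, that is, algebra homomorphisms to the ground field such as the counit.  Composed with
  \<open>c \<mapsto> c 1\<close> they take values in the centre of any algebra \<open>T\<close>, so they pair with every homomorphism.\<close>

locale character = alg_hom K X "base_algebra K" \<epsilon> for K (structure) and X (structure) and \<epsilon>
begin

lemma char_closed [simp]: "x \<in> carrier X \<Longrightarrow> \<epsilon> x \<in> carrier K"
  using closed by simp

lemma scalar_alg_hom:
  "assoc_algebra K T \<Longrightarrow> alg_hom K X T (\<lambda>x. \<epsilon> x \<odot>\<^bsub>T\<^esub> \<one>\<^bsub>T\<^esub>)"
  by (rule alg_hom_comp[OF alg_hom_axioms assoc_algebra.unit_alg_hom])

lemma scalar_commuting:
  "alg_hom K Y T g \<Longrightarrow> commuting X Y T (\<lambda>x. \<epsilon> x \<odot>\<^bsub>T\<^esub> \<one>\<^bsub>T\<^esub>) g"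
  unfolding commuting_def
  by (intro ballI assoc_algebra.scalar_central char_closed)
    (auto simp: alg_hom_def intro: ring_hom_closed[OF alg_hom.ring_hom])

text \<open>\<open>(\<epsilon> \<otimes> Id)\<close> as a pairing; for \<open>X = Y\<close> a bialgebra and \<open>\<epsilon>\<close> its counit the argument of \<open>g\<close> is \<open>counit_left\<close>.\<close>

lemma pairing_scalar_left:
  assumes g: "alg_hom K Y T g" and t: "t \<in> carrier (X \<boxtimes>\<^bsub>K\<^esub> Y)"
  shows "pairing K X Y T (\<lambda>x. \<epsilon> x \<odot>\<^bsub>T\<^esub> \<one>\<^bsub>T\<^esub>) g t
      = g (tensor_lift K X Y Y (\<lambda>x y. \<epsilon> x \<odot>\<^bsub>Y\<^esub> y) t)"
proof -
  interpret g: alg_hom K Y T g by fact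
  interpret p: hom_pair K X Y T "\<lambda>x. \<epsilon> x \<odot>\<^bsub>T\<^esub> \<one>\<^bsub>T\<^esub>" g
    by (intro hom_pair.intro g scalar_alg_hom g.T.assoc_algebra_axioms)
  have bil: "(\<lambda>x y. \<epsilon> x \<odot>\<^bsub>Y\<^esub> y) \<in> bilinear_maps K X Y Y"
    by (rule bilinear_mapsI; rule linear_mapsI)
      (use add smult in \<open>simp_all add: g.X.smult_r_distr g.X.smult_l_distr
        g.X.smult_assoc1[symmetric] X.R.m_comm\<close>)
  note lin = p.XY.lift_linear[OF g.X.module_axioms bil]
  show "pairing K X Y T (\<lambda>x. \<epsilon> x \<odot>\<^bsub>T\<^esub> \<one>\<^bsub>T\<^esub>) g t = g (tensor_lift K X Y Y (\<lambda>x y. \<epsilon> x \<odot>\<^bsub>Y\<^esub> y) t)"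
    by (rule p.pairing_unique[symmetric, OF linear_maps_comp[OF lin g.linear] _ t])
      (simp add: p.XY.tensor_lift_ptens[OF g.X.module_axioms bil] g.smult g.T.smult_mult_left)
qed

lemma pairing_scalar_right:
  assumes g: "alg_hom K Y T g" and t: "t \<in> carrier (Y \<boxtimes>\<^bsub>K\<^esub> X)"
  shows "pairing K Y X T g (\<lambda>x. \<epsilon> x \<odot>\<^bsub>T\<^esub> \<one>\<^bsub>T\<^esub>) t
      = g (tensor_lift K Y X Y (\<lambda>y x. \<epsilon> x \<odot>\<^bsub>Y\<^esub> y) t)"
proof -
  interpret g: alg_hom K Y T g by fact
  interpret p: hom_pair K Y X T g "\<lambda>x. \<epsilon> x \<odot>\<^bsub>T\<^esub> \<one>\<^bsub>T\<^esub>"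
    by (intro hom_pair.intro g scalar_alg_hom g.T.assoc_algebra_axioms)
  have bil: "(\<lambda>y x. \<epsilon> x \<odot>\<^bsub>Y\<^esub> y) \<in> bilinear_maps K Y X Y"
    by (rule bilinear_mapsI; rule linear_mapsI)
      (use add smult in \<open>simp_all add: g.X.smult_r_distr g.X.smult_l_distr
        g.X.smult_assoc1[symmetric] X.R.m_comm\<close>)
  note lin = p.XY.lift_linear[OF g.X.module_axioms bil]
  show "pairing K Y X T g (\<lambda>x. \<epsilon> x \<odot>\<^bsub>T\<^esub> \<one>\<^bsub>T\<^esub>) t = g (tensor_lift K Y X Y (\<lambda>y x. \<epsilon> x \<odot>\<^bsub>Y\<^esub> y) t)"
    by (rule p.pairing_unique[symmetric, OF linear_maps_comp[OF lin g.linear] _ t])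
      (simp add: p.XY.tensor_lift_ptens[OF g.X.module_axioms bil] g.smult g.T.smult_mult_right)
qed

end

context bialgebra
begin

sublocale HH: algebra_pair K H H ..

lemma comult_alg_hom: "alg_hom K H (H \<boxtimes>\<^bsub>K\<^esub> H) (comult H)"
  using comult_hom
  by (intro alg_hom.intro alg_hom_axioms.intro assoc_algebra_axioms HH.tensor_assoc_algebra) auto

lemma counit_character: "character K H (counit H)"
  using counit_hom
  by (intro character.intro alg_hom.intro alg_hom_axioms.intro assoc_algebra_axioms
      base_assoc_algebra K.is_cring) (auto simp: ring_hom_def)

lemma twisted_comult_alg_hom:
  "F \<in> Units (H \<boxtimes>\<^bsub>K\<^esub> H) \<Longrightarrow> alg_hom K H (H \<boxtimes>\<^bsub>K\<^esub> H)
    (\<lambda>x. F \<otimes>\<^bsub>H \<boxtimes>\<^bsub>K\<^esub> H\<^esub> comult H x \<otimes>\<^bsub>H \<boxtimes>\<^bsub>K\<^esub> H\<^esub> inv\<^bsub>H \<boxtimes>\<^bsub>K\<^esub> H\<^esub> F)"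
  by (rule alg_hom_conj[OF comult_alg_hom])

text \<open>The twist equation in an arbitrary algebra \<open>T\<close> that receives three commuting copies of \<open>H\<close>.\<close>

lemma twist_in:
  assumes F: "twist K H F" and hom: "hom_triple K H H H T f g h"
  shows "pairing K H H T f g F \<otimes>\<^bsub>T\<^esub> pairing K H H T (\<lambda>x. pairing K H H T f g (comult H x)) h F
    = pairing K H H T g h F \<otimes>\<^bsub>T\<^esub> pairing K H H T f (\<lambda>x. pairing K H H T g h (comult H x)) F"
proof -
  interpret hom_triple K H H H T f g h by fact
  have Fc: "F \<in> carrier (H \<boxtimes>\<^bsub>K\<^esub> H)" using F by (auto simp: twist_def Units_def)
  have "triple (leg12 K H H H F \<otimes>\<^bsub>H \<boxtimes>\<^bsub>K\<^esub> (H \<boxtimes>\<^bsub>K\<^esub> H)\<^esub> comult_left K H H F)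
      = triple (leg23 K H H H F \<otimes>\<^bsub>H \<boxtimes>\<^bsub>K\<^esub> (H \<boxtimes>\<^bsub>K\<^esub> H)\<^esub> comult_right K H H F)"
    using F by (simp add: twist_def)
  then show ?thesis
    by (simp add: comult_left_def comult_right_def triple.mult leg12_closed leg23_closed Fc
        comult_left_closed[OF comult_alg_hom] comult_right_closed[OF comult_alg_hom]
        triple_leg12 triple_leg23 triple_comult_left[OF comult_alg_hom]
        triple_comult_right[OF comult_alg_hom])
qed

lemma twist_Units: "twist K H F \<Longrightarrow> F \<in> Units (H \<boxtimes>\<^bsub>K\<^esub> H)"
  by (simp add: twist_def)

text \<open>\<open>(\<epsilon> \<otimes> \<epsilon>) \<Delta>\<^sub>F = \<epsilon>\<close>, with values in the centre of an algebra \<open>T\<close>.\<close>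

lemma scalar_twisted_comult:
  assumes F: "twist K H F" and T: "assoc_algebra K T" and x: "x \<in> carrier H"
  defines "\<eta> \<equiv> \<lambda>x. counit H x \<odot>\<^bsub>T\<^esub> \<one>\<^bsub>T\<^esub>"
  shows "pairing K H H T \<eta> \<eta> (F \<otimes>\<^bsub>H \<boxtimes>\<^bsub>K\<^esub> H\<^esub> comult H x \<otimes>\<^bsub>H \<boxtimes>\<^bsub>K\<^esub> H\<^esub> inv\<^bsub>H \<boxtimes>\<^bsub>K\<^esub> H\<^esub> F) = \<eta> x"
proof -
  interpret c: character K H "counit H" by (rule counit_character)
  have hom: "alg_hom K H T \<eta>" unfolding \<eta>_def by (rule c.scalar_alg_hom[OF T])
  interpret e: alg_hom K H T \<eta> by (rule hom)
  interpret hom_pair K H H T \<eta> \<eta> ..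
  interpret p: alg_hom K "H \<boxtimes>\<^bsub>K\<^esub> H" T "pairing K H H T \<eta> \<eta>"
    by (rule pairing_alg_hom, subst (1) \<eta>_def) (rule c.scalar_commuting[OF hom])
  interpret D: alg_hom K H "H \<boxtimes>\<^bsub>K\<^esub> H" "comult H" by (rule comult_alg_hom)
  have eval: "pairing K H H T \<eta> \<eta> t = \<eta> (counit_left K H t)" if "t \<in> carrier (H \<boxtimes>\<^bsub>K\<^esub> H)" for t
    using c.pairing_scalar_left[OF hom that] by (simp add: \<eta>_def counit_left_def)
  have U: "F \<in> Units (H \<boxtimes>\<^bsub>K\<^esub> H)" using F by (rule twist_Units)
  then have Fc: "F \<in> carrier (H \<boxtimes>\<^bsub>K\<^esub> H)" by auto
  have F1: "pairing K H H T \<eta> \<eta> F = \<one>\<^bsub>T\<^esub>"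
    using F eval[OF Fc] e.one by (simp add: twist_def)
  have "pairing K H H T \<eta> \<eta> (comult H x) = \<eta> x"
    using eval[OF D.closed[OF x]] counit_left[OF x] by simp
  then show ?thesis
    using p.Units_hom[OF U] U Fc F1 x by (simp add: p.mult)
qed

end

section \<open>Evaluating the twist on commuting copies of the tensor product\<close>

context algebra_pair
begin

text \<open>The tensor product \<open>H = A \<otimes> B\<close> with the embeddings of its factors.\<close>

abbreviation "H \<equiv> A \<boxtimes>\<^bsub>K\<^esub> B"
abbreviation "iA \<equiv> left_factor K A B"
abbreviation "iB \<equiv> right_factor K A B"

interpretation HH: algebra_pair K H H ..

lemma inner_legs_linear: "inner_legs K A B A B \<in> linear_maps K (B \<boxtimes>\<^bsub>K\<^esub> A) (H \<boxtimes>\<^bsub>K\<^esub> H)"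
  and inner_legs_ptens: "\<lbrakk>b \<in> carrier B; a \<in> carrier A\<rbrakk> \<Longrightarrow>
    inner_legs K A B A B (ptens K B A b a) = ptens K H H (iB b) (iA a)"
proof -
  interpret BA: algebra_pair K B A ..
  have bil: "(\<lambda>b c. ptens K H H (ptens K A B \<one>\<^bsub>A\<^esub> b) (ptens K A B c \<one>\<^bsub>B\<^esub>))
      \<in> bilinear_maps K B A (H \<boxtimes>\<^bsub>K\<^esub> H)"
    by (rule bilinear_mapsI; rule linear_mapsI)
      (simp_all add: ptens_add_right ptens_smult_right ptens_add_left ptens_smult_left
        HH.ptens_add_right HH.ptens_smult_right HH.ptens_add_left HH.ptens_smult_left)
  show "inner_legs K A B A B \<in> linear_maps K (B \<boxtimes>\<^bsub>K\<^esub> A) (H \<boxtimes>\<^bsub>K\<^esub> H)"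
    unfolding inner_legs_def by (rule BA.lift_linear[OF HH.tensor_module bil])
  show "inner_legs K A B A B (ptens K B A b a) = ptens K H H (iB b) (iA a)"
    if "b \<in> carrier B" "a \<in> carrier A"
    unfolding inner_legs_def left_factor_def right_factor_def
    by (rule BA.tensor_lift_ptens[OF HH.tensor_module bil that])
qed

text \<open>The two evaluation rules behind the whole proof: when \<open>u, v : A \<otimes> B \<rightarrow> T\<close> are paired, the element
  \<open>1 \<otimes> S \<otimes> 1\<close> is seen as \<open>S\<close> with its \<open>B\<close>-leg in the first copy and its \<open>A\<close>-leg in the second, and
  \<open>(Id \<otimes> \<tau> \<otimes> Id)(s \<otimes> t)\<close> factors into the pairings of \<open>s\<close> and \<open>t\<close>.\<close>

lemma pairing_inner_legs:
  assumes "alg_hom K H T u" "alg_hom K H T v" "S \<in> carrier (B \<boxtimes>\<^bsub>K\<^esub> A)"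
  shows "pairing K H H T u v (inner_legs K A B A B S)
    = pairing K B A T (\<lambda>b. u (iB b)) (\<lambda>a. v (iA a)) S"
proof -
  interpret uv: hom_pair K H H T u v by (rule hom_pair.intro[OF assms(1,2)])
  interpret p: hom_pair K B A T "\<lambda>b. u (iB b)" "\<lambda>a. v (iA a)"
    by (intro hom_pair.intro alg_hom_comp[OF right_factor_alg_hom assms(1)]
        alg_hom_comp[OF left_factor_alg_hom assms(2)])
  show ?thesis
    by (rule p.pairing_unique[OF linear_maps_comp[OF inner_legs_linear uv.pairing_linear] _ assms(3)])
      (simp add: inner_legs_ptens ring_hom_closed[OF alg_hom.ring_hom[OF left_factor_alg_hom]]
        ring_hom_closed[OF alg_hom.ring_hom[OF right_factor_alg_hom]])
qed

lemma pairing_middle_flip: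
  assumes u: "alg_hom K H T u" and v: "alg_hom K H T v" and c: "commuting H H T u v"
    and s: "s \<in> carrier (A \<boxtimes>\<^bsub>K\<^esub> A)" and t: "t \<in> carrier (B \<boxtimes>\<^bsub>K\<^esub> B)"
  shows "pairing K H H T u v (middle_flip K A A B B (ptens K (A \<boxtimes>\<^bsub>K\<^esub> A) (B \<boxtimes>\<^bsub>K\<^esub> B) s t))
    = pairing K A A T (\<lambda>a. u (iA a)) (\<lambda>a. v (iA a)) s \<otimes>\<^bsub>T\<^esub> pairing K B B T (\<lambda>b. u (iB b)) (\<lambda>b. v (iB b)) t"
proof -
  interpret AA: algebra_pair K A A ..
  interpret BB: algebra_pair K B B ..
  interpret AABB: algebra_pair K "A \<boxtimes>\<^bsub>K\<^esub> A" "B \<boxtimes>\<^bsub>K\<^esub> B" ..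
  interpret u: alg_hom K H T u by (rule u)
  interpret v: alg_hom K H T v by (rule v)
  interpret uv: hom_pair K H H T u v by (rule hom_pair.intro[OF u v])
  interpret iA: alg_hom K A H iA by (rule left_factor_alg_hom)
  interpret iB: alg_hom K B H iB by (rule right_factor_alg_hom)
  interpret pA: hom_pair K A A T "\<lambda>a. u (iA a)" "\<lambda>a. v (iA a)"
    by (intro hom_pair.intro alg_hom_comp[OF left_factor_alg_hom] u v)
  interpret pB: hom_pair K B B T "\<lambda>b. u (iB b)" "\<lambda>b. v (iB b)"
    by (intro hom_pair.intro alg_hom_comp[OF right_factor_alg_hom] u v)
  note mods = A.module_axioms A.module_axioms B.module_axioms B.module_axioms
  note mf = linear_maps_closed[OF middle_flip_linear[OF mods]]
    linear_maps_add[OF middle_flip_linear[OF mods]] middle_flip_ptens[OF mods]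
  have fac: "ptens K A B a b = iA a \<otimes>\<^bsub>H\<^esub> iB b" if "a \<in> carrier A" "b \<in> carrier B" for a b
    using that by (simp add: left_factor_def right_factor_def)
  show ?thesis
    using s
  proof (induction s rule: AA.tensor_induct)
    case a: (pure a a')
    show ?case using t
    proof (induction t rule: BB.tensor_induct)
      case b: (pure b b')
      have "u (iB b) \<otimes>\<^bsub>T\<^esub> v (iA a') = v (iA a') \<otimes>\<^bsub>T\<^esub> u (iB b)"
        using c a b by (intro commutingD[OF c]) auto
      then have "u (iA a) \<otimes>\<^bsub>T\<^esub> (u (iB b) \<otimes>\<^bsub>T\<^esub> v (iA a')) \<otimes>\<^bsub>T\<^esub> v (iB b')
          = u (iA a) \<otimes>\<^bsub>T\<^esub> (v (iA a') \<otimes>\<^bsub>T\<^esub> u (iB b)) \<otimes>\<^bsub>T\<^esub> v (iB b')"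
        by simp
      then show ?case
        using a b by (simp add: mf(3) fac u.mult v.mult u.T.A.m_assoc)
    qed (use a in \<open>simp_all add: AABB.ptens_add_right mf(1,2) uv.pairing_add pB.pairing_add
          u.T.A.r_distr\<close>)
  qed (use t in \<open>simp_all add: AABB.ptens_add_left mf(1,2) uv.pairing_add pA.pairing_add
        u.T.A.l_distr\<close>)
qed

end

section \<open>The twist on the tensor product bialgebra\<close>

text \<open>The data of the theorem, with \<open>A = H\<^sub>1\<close> and \<open>B = H\<^sub>2\<close>.\<close>

locale twist_data = A: bialgebra K A + B: bialgebra K B
  for K (structure) and A (structure) and B (structure) +
  fixes F1 F2 R
  assumes F1: "twist K A F1" and F2: "twist K B F2"
    and R: "weak_R_matrix K (twisted_bialgebra K B F2) (twisted_bialgebra K A F1) R"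
begin

sublocale algebra_pair K A B ..

interpretation BA: algebra_pair K B A ..
interpretation AABB: algebra_pair K "A \<boxtimes>\<^bsub>K\<^esub> A" "B \<boxtimes>\<^bsub>K\<^esub> B" ..
interpretation HH: algebra_pair K H H ..
interpretation iA: alg_hom K A H iA by (rule left_factor_alg_hom)
interpretation iB: alg_hom K B H iB by (rule right_factor_alg_hom)
interpretation dA: alg_hom K A "A \<boxtimes>\<^bsub>K\<^esub> A" "comult A" by (rule A.comult_alg_hom)
interpretation dB: alg_hom K B "B \<boxtimes>\<^bsub>K\<^esub> B" "comult B" by (rule B.comult_alg_hom)
interpretation eA: character K A "counit A" by (rule A.counit_character)
interpretation eB: character K B "counit B" by (rule B.counit_character)

abbreviation S where "S \<equiv> inv\<^bsub>B \<boxtimes>\<^bsub>K\<^esub> A\<^esub> R"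

text \<open>The comultiplications of \<open>A\<close> and \<open>B\<close> twisted by \<open>F\<^sub>1\<close> and \<open>F\<^sub>2\<close>.\<close>

abbreviation comult_A_F where "comult_A_F \<equiv>
  \<lambda>x. F1 \<otimes>\<^bsub>A \<boxtimes>\<^bsub>K\<^esub> A\<^esub> comult A x \<otimes>\<^bsub>A \<boxtimes>\<^bsub>K\<^esub> A\<^esub> inv\<^bsub>A \<boxtimes>\<^bsub>K\<^esub> A\<^esub> F1"

abbreviation comult_B_F where "comult_B_F \<equiv>
  \<lambda>x. F2 \<otimes>\<^bsub>B \<boxtimes>\<^bsub>K\<^esub> B\<^esub> comult B x \<otimes>\<^bsub>B \<boxtimes>\<^bsub>K\<^esub> B\<^esub> inv\<^bsub>B \<boxtimes>\<^bsub>K\<^esub> B\<^esub> F2"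

lemma R_Units: "R \<in> Units (B \<boxtimes>\<^bsub>K\<^esub> A)"
  using R by (simp add: weak_R_matrix_twisted)

lemma F1_Units: "F1 \<in> Units (A \<boxtimes>\<^bsub>K\<^esub> A)"
  using F1 by (rule A.twist_Units)

lemma F2_Units: "F2 \<in> Units (B \<boxtimes>\<^bsub>K\<^esub> B)"
  using F2 by (rule B.twist_Units)

lemma elements_closed [simp]:
  "R \<in> carrier (B \<boxtimes>\<^bsub>K\<^esub> A)" "S \<in> carrier (B \<boxtimes>\<^bsub>K\<^esub> A)" "F1 \<in> carrier (A \<boxtimes>\<^bsub>K\<^esub> A)" "F2 \<in> carrier (B \<boxtimes>\<^bsub>K\<^esub> B)"
  using R_Units F1_Units F2_Units by auto

text \<open>The two defining equations of the weak R-matrix, read in an algebra \<open>T\<close>.\<close>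

lemma R_left:
  assumes "hom_triple K B B A T f g h"
  shows "pairing K B A T (\<lambda>b. pairing K B B T f g (comult_B_F b)) h R
    = pairing K B A T f h R \<otimes>\<^bsub>T\<^esub> pairing K B A T g h R"
proof -
  interpret hom_triple K B B A T f g h by fact
  note d = B.twisted_comult_alg_hom[OF F2_Units]
  have "triple (tensor_assoc K B B A (tensor_map K B A (B \<boxtimes>\<^bsub>K\<^esub> B) A comult_B_F (\<lambda>a. a) R))
      = triple (leg13 K B B A R \<otimes>\<^bsub>B \<boxtimes>\<^bsub>K\<^esub> (B \<boxtimes>\<^bsub>K\<^esub> A)\<^esub> leg23 K B B A R)"
    using R by (simp add: weak_R_matrix_twisted)
  then show ?thesis
    by (simp add: triple_comult_left[OF d] triple.mult leg13_closed leg23_closed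
        triple_leg13 triple_leg23)
qed

lemma R_right:
  assumes "hom_triple K B A A T f g h"
  shows "pairing K B A T f (\<lambda>a. pairing K A A T g h (comult_A_F a)) R
    = pairing K B A T f h R \<otimes>\<^bsub>T\<^esub> pairing K B A T f g R"
proof -
  interpret hom_triple K B A A T f g h by fact
  note d = A.twisted_comult_alg_hom[OF F1_Units]
  have "triple (tensor_map K B A B (A \<boxtimes>\<^bsub>K\<^esub> A) (\<lambda>b. b) comult_A_F R)
      = triple (leg13 K B A A R \<otimes>\<^bsub>B \<boxtimes>\<^bsub>K\<^esub> (A \<boxtimes>\<^bsub>K\<^esub> A)\<^esub> leg12 K B A A R)"
    using R by (simp add: weak_R_matrix_twisted)
  then show ?thesis
    by (simp add: triple_comult_right[OF d] triple.mult leg13_closed leg12_closed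
        triple_leg13 triple_leg12)
qed

text \<open>The same equations for \<open>S = R\<inverse>\<close>.  Inverting reverses the order of the legs; since
  \<open>(\<Delta>\<^sub>F \<otimes> Id)(S)\<close> is \<open>(\<Delta> \<otimes> Id)(S)\<close> conjugated by \<open>F\<^sub>2 \<otimes> 1\<close>
  (and \<open>(Id \<otimes> \<Delta>\<^sub>F)(S)\<close> is \<open>(Id \<otimes> \<Delta>)(S)\<close> conjugated by \<open>1 \<otimes> F\<^sub>1\<close>), the conjugating factor can be moved to
  the other side, which leaves an equation for the untwisted comultiplication.\<close>

lemma S_left:
  assumes "hom_triple K B B A T f g h"
  shows "pairing K B B T f g F2 \<otimes>\<^bsub>T\<^esub> pairing K B A T (\<lambda>b. pairing K B B T f g (comult B b)) h S
    = pairing K B A T g h S \<otimes>\<^bsub>T\<^esub> pairing K B A T f h S \<otimes>\<^bsub>T\<^esub> pairing K B B T f g F2"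
proof -
  interpret hom_triple K B B A T f g h by fact
  let ?d = "\<lambda>b. pairing K B B T f g (comult B b)"
  let ?d' = "\<lambda>b. pairing K B B T f g (comult_B_F b)"
  let ?u = "pairing K B B T f g F2"
  have u: "?u \<in> Units T" "pairing K B B T f g (inv\<^bsub>B \<boxtimes>\<^bsub>K\<^esub> B\<^esub> F2) = inv\<^bsub>T\<^esub> ?u"
    using pfg.Units_hom[OF F2_Units] by auto
  have uc: "?u \<in> carrier T" "inv\<^bsub>T\<^esub> ?u \<in> carrier T" using u by auto
  have dh: "alg_hom K B T ?d" "alg_hom K B T ?d'"
    by (rule alg_hom_comp[OF dB.alg_hom_axioms pfg.alg_hom_axioms],
        rule alg_hom_comp[OF B.twisted_comult_alg_hom[OF F2_Units] pfg.alg_hom_axioms])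
  have d': "?d' b = ?u \<otimes>\<^bsub>T\<^esub> ?d b \<otimes>\<^bsub>T\<^esub> inv\<^bsub>T\<^esub> ?u" if "b \<in> carrier B" for b
    using that F2_Units by (simp add: pfg.mult u(2))
  interpret p: hom_pair K B A T ?d h by (intro hom_pair.intro dh h.alg_hom_axioms)
  interpret p': hom_pair K B A T ?d' h by (intro hom_pair.intro dh h.alg_hom_axioms)
  interpret P': alg_hom K "B \<boxtimes>\<^bsub>K\<^esub> A" T "pairing K B A T ?d' h"
    by (rule p'.pairing_alg_hom[OF commuting_comp[OF commuting_fg_h
          B.twisted_comult_alg_hom[OF F2_Units]]])
  interpret Pfh: alg_hom K "B \<boxtimes>\<^bsub>K\<^esub> A" T "pairing K B A T f h"
    by (rule fh.pairing_alg_hom[OF fh])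
  have comm: "?u \<otimes>\<^bsub>T\<^esub> h a = h a \<otimes>\<^bsub>T\<^esub> ?u" if "a \<in> carrier A" for a
    by (rule commutingD[OF commuting_fg_h _ that]) simp
  have "?u \<otimes>\<^bsub>T\<^esub> pairing K B A T ?d h S \<otimes>\<^bsub>T\<^esub> inv\<^bsub>T\<^esub> ?u
      = pairing K B A T (\<lambda>b. ?u \<otimes>\<^bsub>T\<^esub> ?d b \<otimes>\<^bsub>T\<^esub> inv\<^bsub>T\<^esub> ?u) h S"
    by (rule p.pairing_conj_left[symmetric, OF u(1) comm]) simp_all
  also have "\<dots> = pairing K B A T ?d' h S"
    by (rule p'.pairing_cong) (simp_all only: d' elements_closed)
  also have "\<dots> = inv\<^bsub>T\<^esub> (pairing K B A T f h R \<otimes>\<^bsub>T\<^esub> pairing K B A T g h R)"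
    using P'.Units_hom(2)[OF R_Units] R_left[OF assms] by simp
  also have "\<dots> = pairing K B A T g h S \<otimes>\<^bsub>T\<^esub> pairing K B A T f h S"
    using Pfh.Units_hom[OF R_Units] pgh.Units_hom[OF R_Units] by (simp add: f.T.A.inv_mult_Units)
  finally have "?u \<otimes>\<^bsub>T\<^esub> pairing K B A T ?d h S \<otimes>\<^bsub>T\<^esub> inv\<^bsub>T\<^esub> ?u \<otimes>\<^bsub>T\<^esub> ?u
      = pairing K B A T g h S \<otimes>\<^bsub>T\<^esub> pairing K B A T f h S \<otimes>\<^bsub>T\<^esub> ?u"
    by simp
  then show ?thesis
    using u(1) uc by (simp add: f.T.A.m_assoc)
qed

lemma S_right:
  assumes "hom_triple K B A A T f g h"
  shows "pairing K A A T g h F1 \<otimes>\<^bsub>T\<^esub> pairing K B A T f (\<lambda>a. pairing K A A T g h (comult A a)) S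
    = pairing K B A T f g S \<otimes>\<^bsub>T\<^esub> pairing K B A T f h S \<otimes>\<^bsub>T\<^esub> pairing K A A T g h F1"
proof -
  interpret hom_triple K B A A T f g h by fact
  let ?d = "\<lambda>b. pairing K A A T g h (comult A b)"
  let ?d' = "\<lambda>b. pairing K A A T g h (comult_A_F b)"
  let ?u = "pairing K A A T g h F1"
  have u: "?u \<in> Units T" "pairing K A A T g h (inv\<^bsub>A \<boxtimes>\<^bsub>K\<^esub> A\<^esub> F1) = inv\<^bsub>T\<^esub> ?u"
    using pgh.Units_hom[OF F1_Units] by auto
  have uc: "?u \<in> carrier T" "inv\<^bsub>T\<^esub> ?u \<in> carrier T" using u by auto
  have dh: "alg_hom K A T ?d" "alg_hom K A T ?d'"
    by (rule alg_hom_comp[OF dA.alg_hom_axioms pgh.alg_hom_axioms],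
        rule alg_hom_comp[OF A.twisted_comult_alg_hom[OF F1_Units] pgh.alg_hom_axioms])
  have d': "?d' b = ?u \<otimes>\<^bsub>T\<^esub> ?d b \<otimes>\<^bsub>T\<^esub> inv\<^bsub>T\<^esub> ?u" if "b \<in> carrier A" for b
    using that F1_Units by (simp add: pgh.mult u(2))
  interpret p: hom_pair K B A T f ?d by (intro hom_pair.intro dh f.alg_hom_axioms)
  interpret p': hom_pair K B A T f ?d' by (intro hom_pair.intro dh f.alg_hom_axioms)
  interpret P': alg_hom K "B \<boxtimes>\<^bsub>K\<^esub> A" T "pairing K B A T f ?d'"
    by (rule p'.pairing_alg_hom[OF commuting_sym[OF commuting_comp[OF commuting_sym[OF commuting_f_gh]
          A.twisted_comult_alg_hom[OF F1_Units]]]])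
  interpret Pfh: alg_hom K "B \<boxtimes>\<^bsub>K\<^esub> A" T "pairing K B A T f h"
    by (rule fh.pairing_alg_hom[OF fh])
  have comm: "?u \<otimes>\<^bsub>T\<^esub> f b = f b \<otimes>\<^bsub>T\<^esub> ?u" if "b \<in> carrier B" for b
    by (rule commutingD[OF commuting_f_gh that, symmetric]) simp
  have "?u \<otimes>\<^bsub>T\<^esub> pairing K B A T f ?d S \<otimes>\<^bsub>T\<^esub> inv\<^bsub>T\<^esub> ?u
      = pairing K B A T f (\<lambda>b. ?u \<otimes>\<^bsub>T\<^esub> ?d b \<otimes>\<^bsub>T\<^esub> inv\<^bsub>T\<^esub> ?u) S"
    by (rule p.pairing_conj_right[symmetric, OF u(1) comm]) simp_all
  also have "\<dots> = pairing K B A T f ?d' S"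
    by (rule p'.pairing_cong) (simp_all only: d' elements_closed)
  also have "\<dots> = inv\<^bsub>T\<^esub> (pairing K B A T f h R \<otimes>\<^bsub>T\<^esub> pairing K B A T f g R)"
    using P'.Units_hom(2)[OF R_Units] R_right[OF assms] by simp
  also have "\<dots> = pairing K B A T f g S \<otimes>\<^bsub>T\<^esub> pairing K B A T f h S"
    using Pfh.Units_hom[OF R_Units] pfg.Units_hom[OF R_Units] by (simp add: f.T.A.inv_mult_Units)
  finally have "?u \<otimes>\<^bsub>T\<^esub> pairing K B A T f ?d S \<otimes>\<^bsub>T\<^esub> inv\<^bsub>T\<^esub> ?u \<otimes>\<^bsub>T\<^esub> ?u
      = pairing K B A T f g S \<otimes>\<^bsub>T\<^esub> pairing K B A T f h S \<otimes>\<^bsub>T\<^esub> ?u"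
    by simp
  then show ?thesis
    using u(1) uc by (simp add: f.T.A.m_assoc)
qed

text \<open>The definition of a weak R-matrix does not ask for \<open>(\<epsilon> \<otimes> Id)(R) = 1\<close>.  It follows: applying
  \<open>\<epsilon> \<otimes> \<epsilon> \<otimes> Id\<close> to \<open>(\<Delta>\<^sub>F \<otimes> Id)(R) = R\<^sub>1\<^sub>3 R\<^sub>2\<^sub>3\<close> shows that the invertible element
  \<open>e = (\<epsilon> \<otimes> Id)(R)\<close> satisfies \<open>e = e e\<close>.
  The same holds for \<open>(Id \<otimes> \<epsilon>)(R)\<close>, and for \<open>S\<close> in place of \<open>R\<close>, by inverting.\<close>

lemma S_counit_left:
  assumes g: "alg_hom K A T g"
  shows "pairing K B A T (\<lambda>b. counit B b \<odot>\<^bsub>T\<^esub> \<one>\<^bsub>T\<^esub>) g S = \<one>\<^bsub>T\<^esub>"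
proof -
  interpret g: alg_hom K A T g by fact
  let ?\<eta> = "\<lambda>b. counit B b \<odot>\<^bsub>T\<^esub> \<one>\<^bsub>T\<^esub>"
  have e: "alg_hom K B T ?\<eta>" by (rule eB.scalar_alg_hom[OF g.T.assoc_algebra_axioms])
  interpret h: hom_triple K B B A T ?\<eta> ?\<eta> g
    by (intro hom_triple.intro hom_triple_axioms.intro e g eB.scalar_commuting)
  let ?e = "pairing K B A T ?\<eta> g R"
  have "?e = pairing K B A T (\<lambda>b. pairing K B B T ?\<eta> ?\<eta> (comult_B_F b)) g R"
    by (rule hom_pair.pairing_cong[OF hom_pair.intro[OF e g], symmetric])
      (simp_all add: B.scalar_twisted_comult[OF F2 g.T.assoc_algebra_axioms])
  then have ee: "?e = ?e \<otimes>\<^bsub>T\<^esub> ?e" using R_left[OF h.hom_triple_axioms] by simp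
  have U: "?e \<in> Units T" "pairing K B A T ?\<eta> g S = inv\<^bsub>T\<^esub> ?e"
    using h.pgh.Units_hom[OF R_Units] by auto
  then have "?e = \<one>\<^bsub>T\<^esub>" using ee g.T.A.Units_l_cancel[OF U(1), of ?e "\<one>\<^bsub>T\<^esub>"] by auto
  then show ?thesis using U by simp
qed

lemma S_counit_right:
  assumes g: "alg_hom K B T g"
  shows "pairing K B A T g (\<lambda>a. counit A a \<odot>\<^bsub>T\<^esub> \<one>\<^bsub>T\<^esub>) S = \<one>\<^bsub>T\<^esub>"
proof -
  interpret g: alg_hom K B T g by fact
  let ?\<eta> = "\<lambda>a. counit A a \<odot>\<^bsub>T\<^esub> \<one>\<^bsub>T\<^esub>"
  have e: "alg_hom K A T ?\<eta>" by (rule eA.scalar_alg_hom[OF g.T.assoc_algebra_axioms])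
  interpret h: hom_triple K B A A T g ?\<eta> ?\<eta>
    by (intro hom_triple.intro hom_triple_axioms.intro e g eA.scalar_commuting
        commuting_sym[OF eA.scalar_commuting])
  let ?e = "pairing K B A T g ?\<eta> R"
  have "?e = pairing K B A T g (\<lambda>b. pairing K A A T ?\<eta> ?\<eta> (comult_A_F b)) R"
    by (rule hom_pair.pairing_cong[OF hom_pair.intro[OF g e], symmetric])
      (simp_all add: A.scalar_twisted_comult[OF F1 g.T.assoc_algebra_axioms])
  then have ee: "?e = ?e \<otimes>\<^bsub>T\<^esub> ?e" using R_right[OF h.hom_triple_axioms] by simp
  have U: "?e \<in> Units T" "pairing K B A T g ?\<eta> S = inv\<^bsub>T\<^esub> ?e"
    using h.pfg.Units_hom[OF R_Units] by auto
  then have "?e = \<one>\<^bsub>T\<^esub>" using ee g.T.A.Units_l_cancel[OF U(1), of ?e "\<one>\<^bsub>T\<^esub>"] by auto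
  then show ?thesis using U by simp
qed

text \<open>Comultiplication and counit of the tensor product bialgebra.\<close>

definition tensor_comult where
  "tensor_comult = (\<lambda>t. middle_flip K A A B B
    (tensor_map K A B (A \<boxtimes>\<^bsub>K\<^esub> A) (B \<boxtimes>\<^bsub>K\<^esub> B) (comult A) (comult B) t))"

definition tensor_counit where
  "tensor_counit = tensor_lift K A B (base_algebra K) (\<lambda>a b. counit A a \<otimes>\<^bsub>K\<^esub> counit B b)"

text \<open>The element \<open>(1 \<otimes> R\<inverse> \<otimes> 1) (Id \<otimes> \<tau> \<otimes> Id)(F\<^sub>1 \<otimes> F\<^sub>2)\<close>, which is to be shown to be a twist.\<close>

definition twist_product where
  "twist_product = inner_legs K A B A B S \<otimes>\<^bsub>H \<boxtimes>\<^bsub>K\<^esub> H\<^esub>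
    middle_flip K A A B B (ptens K (A \<boxtimes>\<^bsub>K\<^esub> A) (B \<boxtimes>\<^bsub>K\<^esub> B) F1 F2)"

lemma inner_S_closed: "inner_legs K A B A B S \<in> carrier (H \<boxtimes>\<^bsub>K\<^esub> H)"
  by (rule linear_maps_closed[OF inner_legs_linear]) simp

lemma middle_flip_F_closed:
  "middle_flip K A A B B (ptens K (A \<boxtimes>\<^bsub>K\<^esub> A) (B \<boxtimes>\<^bsub>K\<^esub> B) F1 F2) \<in> carrier (H \<boxtimes>\<^bsub>K\<^esub> H)"
  by (rule linear_maps_closed[OF middle_flip_linear])
    (simp_all add: A.module_axioms B.module_axioms)

text \<open>Every structure map that occurs in the definition of a twist is a pairing \<open>u * v\<close>, so this formula
  evaluates all of them on \<open>twist_product\<close>.\<close>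

lemma pairing_twist_product:
  assumes u: "alg_hom K H T u" and v: "alg_hom K H T v" and c: "commuting H H T u v"
  shows "pairing K H H T u v twist_product
    = pairing K B A T (\<lambda>b. u (iB b)) (\<lambda>a. v (iA a)) S
      \<otimes>\<^bsub>T\<^esub> (pairing K A A T (\<lambda>a. u (iA a)) (\<lambda>a. v (iA a)) F1
      \<otimes>\<^bsub>T\<^esub> pairing K B B T (\<lambda>b. u (iB b)) (\<lambda>b. v (iB b)) F2)"
proof -
  interpret p: alg_hom K "H \<boxtimes>\<^bsub>K\<^esub> H" T "pairing K H H T u v"
    by (rule hom_pair.pairing_alg_hom[OF hom_pair.intro[OF u v] c])
  show ?thesis
    by (simp add: twist_product_def p.mult inner_S_closed middle_flip_F_closed
        pairing_inner_legs[OF u v] pairing_middle_flip[OF u v c])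
qed

text \<open>The pairing of the two embeddings of \<open>H\<close> into \<open>H \<otimes> H\<close> is the identity, so the preceding formula
  exhibits \<open>twist_product\<close> as a product of images of units.\<close>

lemma twist_product_Units: "twist_product \<in> Units (H \<boxtimes>\<^bsub>K\<^esub> H)"
proof -
  let ?T = "H \<boxtimes>\<^bsub>K\<^esub> H"
  let ?u = "left_factor K H H" and ?v = "right_factor K H H"
  have u: "alg_hom K H ?T ?u" and v: "alg_hom K H ?T ?v" and c: "commuting H H ?T ?u ?v"
    by (rule HH.left_factor_alg_hom HH.right_factor_alg_hom HH.factors_commuting)+
  have uA: "alg_hom K A ?T (\<lambda>a. ?u (iA a))" and vA: "alg_hom K A ?T (\<lambda>a. ?v (iA a))"
    and uB: "alg_hom K B ?T (\<lambda>b. ?u (iB b))" and vB: "alg_hom K B ?T (\<lambda>b. ?v (iB b))"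
    by (rule alg_hom_comp[OF iA.alg_hom_axioms u] alg_hom_comp[OF iA.alg_hom_axioms v]
        alg_hom_comp[OF iB.alg_hom_axioms u] alg_hom_comp[OF iB.alg_hom_axioms v])+
  have cc: "commuting B A ?T (\<lambda>b. ?u (iB b)) (\<lambda>a. ?v (iA a))"
    "commuting A A ?T (\<lambda>b. ?u (iA b)) (\<lambda>a. ?v (iA a))"
    "commuting B B ?T (\<lambda>b. ?u (iB b)) (\<lambda>a. ?v (iB a))"
    using c by (auto simp: commuting_def)
  have S_Units: "S \<in> Units (B \<boxtimes>\<^bsub>K\<^esub> A)" using R_Units by simp
  have "twist_product \<in> carrier ?T"
    by (simp add: twist_product_def inner_S_closed middle_flip_F_closed)
  then have "twist_product = pairing K H H ?T ?u ?v twist_product"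
    by (simp add: HH.pairing_factors)
  also have "\<dots> \<in> Units ?T"
    unfolding pairing_twist_product[OF u v c]
    by (intro HH.tensor.A.Units_m_closed
        alg_hom.Units_hom(1)[OF hom_pair.pairing_alg_hom] hom_pair.intro uA vA uB vB cc
        S_Units F1_Units F2_Units)
  finally show ?thesis .
qed

lemma tensor_comult_closed: "t \<in> carrier H \<Longrightarrow> tensor_comult t \<in> carrier (H \<boxtimes>\<^bsub>K\<^esub> H)"
  and tensor_comult_linear: "tensor_comult \<in> linear_maps K H (H \<boxtimes>\<^bsub>K\<^esub> H)"
  and tensor_comult_ptens: "\<lbrakk>a \<in> carrier A; b \<in> carrier B\<rbrakk> \<Longrightarrow> tensor_comult (ptens K A B a b)
    = middle_flip K A A B B (ptens K (A \<boxtimes>\<^bsub>K\<^esub> A) (B \<boxtimes>\<^bsub>K\<^esub> B) (comult A a) (comult B b))"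
proof -
  note mods = A.module_axioms B.module_axioms A.HH.tensor_module B.HH.tensor_module dA.linear dB.linear
  show lin: "tensor_comult \<in> linear_maps K H (H \<boxtimes>\<^bsub>K\<^esub> H)"
    unfolding tensor_comult_def
    by (rule linear_maps_comp[OF tensor_map_linear[OF mods]
          middle_flip_linear[OF mods(1) mods(1) mods(2) mods(2)]])
  show "tensor_comult t \<in> carrier (H \<boxtimes>\<^bsub>K\<^esub> H)" if "t \<in> carrier H"
    by (rule linear_maps_closed[OF lin that])
  show "tensor_comult (ptens K A B a b)
    = middle_flip K A A B B (ptens K (A \<boxtimes>\<^bsub>K\<^esub> A) (B \<boxtimes>\<^bsub>K\<^esub> B) (comult A a) (comult B b))"
    if "a \<in> carrier A" "b \<in> carrier B"
    by (simp add: tensor_comult_def tensor_map_ptens[OF mods that])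
qed

lemma pairing_tensor_comult:
  assumes u: "alg_hom K H T u" and v: "alg_hom K H T v" and c: "commuting H H T u v"
  shows "\<lbrakk>a \<in> carrier A; b \<in> carrier B\<rbrakk> \<Longrightarrow> pairing K H H T u v (tensor_comult (ptens K A B a b))
      = pairing K A A T (\<lambda>a. u (iA a)) (\<lambda>a. v (iA a)) (comult A a)
        \<otimes>\<^bsub>T\<^esub> pairing K B B T (\<lambda>b. u (iB b)) (\<lambda>b. v (iB b)) (comult B b)"
    and "a \<in> carrier A \<Longrightarrow> pairing K H H T u v (tensor_comult (iA a))
      = pairing K A A T (\<lambda>a. u (iA a)) (\<lambda>a. v (iA a)) (comult A a)"
    and "b \<in> carrier B \<Longrightarrow> pairing K H H T u v (tensor_comult (iB b))
      = pairing K B B T (\<lambda>b. u (iB b)) (\<lambda>b. v (iB b)) (comult B b)"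
proof -
  interpret u: alg_hom K H T u by (rule u)
  interpret v: alg_hom K H T v by (rule v)
  have cA: "commuting A A T (\<lambda>b. u (iA b)) (\<lambda>a. v (iA a))"
    and cB: "commuting B B T (\<lambda>b. u (iB b)) (\<lambda>a. v (iB a))"
    using c by (auto simp: commuting_def)
  interpret pA: alg_hom K "A \<boxtimes>\<^bsub>K\<^esub> A" T "pairing K A A T (\<lambda>a. u (iA a)) (\<lambda>a. v (iA a))"
    by (intro hom_pair.pairing_alg_hom hom_pair.intro cA alg_hom_comp[OF iA.alg_hom_axioms] u v)
  interpret pB: alg_hom K "B \<boxtimes>\<^bsub>K\<^esub> B" T "pairing K B B T (\<lambda>a. u (iB a)) (\<lambda>a. v (iB a))"
    by (intro hom_pair.pairing_alg_hom hom_pair.intro cB alg_hom_comp[OF iB.alg_hom_axioms] u v)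
  show 1: "pairing K H H T u v (tensor_comult (ptens K A B a b))
      = pairing K A A T (\<lambda>a. u (iA a)) (\<lambda>a. v (iA a)) (comult A a)
        \<otimes>\<^bsub>T\<^esub> pairing K B B T (\<lambda>b. u (iB b)) (\<lambda>b. v (iB b)) (comult B b)"
    if "a \<in> carrier A" "b \<in> carrier B" for a b
    using that by (simp add: tensor_comult_ptens pairing_middle_flip[OF u v c])
  show "pairing K H H T u v (tensor_comult (iA a))
      = pairing K A A T (\<lambda>a. u (iA a)) (\<lambda>a. v (iA a)) (comult A a)"
    if "a \<in> carrier A"
    using 1[OF that B.A.one_closed] that by (simp add: left_factor_def[of K A B a])
  show "pairing K H H T u v (tensor_comult (iB b))
      = pairing K B B T (\<lambda>b. u (iB b)) (\<lambda>b. v (iB b)) (comult B b)"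
    if "b \<in> carrier B"
    using 1[OF A.A.one_closed that] that by (simp add: right_factor_def[of K A B b])
qed

text \<open>The comultiplication is the pairing of \<open>\<Delta>\<^sub>A\<close> and \<open>\<Delta>\<^sub>B\<close>, each followed by the embedding into the
  first and second copies of \<open>A \<otimes> B\<close>; hence it is an algebra homomorphism.\<close>

lemma tensor_comult_alg_hom: "alg_hom K H (H \<boxtimes>\<^bsub>K\<^esub> H) tensor_comult"
proof -
  let ?T = "H \<boxtimes>\<^bsub>K\<^esub> H"
  let ?u = "left_factor K H H" and ?v = "right_factor K H H"
  have u: "alg_hom K H ?T ?u" and v: "alg_hom K H ?T ?v" and c: "commuting H H ?T ?u ?v"
    by (rule HH.left_factor_alg_hom HH.right_factor_alg_hom HH.factors_commuting)+
  interpret p: alg_hom K ?T ?T "pairing K H H ?T ?u ?v"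
    by (rule hom_pair.pairing_alg_hom[OF hom_pair.intro[OF u v] c])
  have uA: "alg_hom K A ?T (\<lambda>a. ?u (iA a))" and vA: "alg_hom K A ?T (\<lambda>a. ?v (iA a))"
    and uB: "alg_hom K B ?T (\<lambda>b. ?u (iB b))" and vB: "alg_hom K B ?T (\<lambda>b. ?v (iB b))"
    by (rule alg_hom_comp[OF iA.alg_hom_axioms u] alg_hom_comp[OF iA.alg_hom_axioms v]
        alg_hom_comp[OF iB.alg_hom_axioms u] alg_hom_comp[OF iB.alg_hom_axioms v])+
  have cc: "commuting A B ?T (\<lambda>b. ?u (iA b)) (\<lambda>a. ?v (iB a))"
    "commuting B A ?T (\<lambda>b. ?u (iB b)) (\<lambda>a. ?v (iA a))"
    "commuting A A ?T (\<lambda>b. ?u (iA b)) (\<lambda>a. ?v (iA a))"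
    "commuting B B ?T (\<lambda>b. ?u (iB b)) (\<lambda>a. ?v (iB a))"
    using c by (auto simp: commuting_def)
  have same: "commuting A B ?T (\<lambda>b. ?u (iA b)) (\<lambda>a. ?u (iB a))"
    "commuting A B ?T (\<lambda>b. ?v (iA b)) (\<lambda>a. ?v (iB a))"
    using factors_commuting
    by (auto simp: commuting_def alg_hom.mult[OF u, symmetric] alg_hom.mult[OF v, symmetric])
  let ?A = "\<lambda>a. pairing K A A ?T (\<lambda>a. ?u (iA a)) (\<lambda>a. ?v (iA a)) (comult A a)"
  let ?B = "\<lambda>b. pairing K B B ?T (\<lambda>b. ?u (iB b)) (\<lambda>b. ?v (iB b)) (comult B b)"
  have hA: "alg_hom K A ?T ?A" and hB: "alg_hom K B ?T ?B"
    by (rule alg_hom_comp[OF dA.alg_hom_axioms hom_pair.pairing_alg_hom[OF hom_pair.intro[OF uA vA] cc(3)]]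
        alg_hom_comp[OF dB.alg_hom_axioms hom_pair.pairing_alg_hom[OF hom_pair.intro[OF uB vB] cc(4)]])+
  have AB: "commuting A B ?T ?A ?B"
    unfolding commuting_def
    by (intro ballI pairings_commute uA vA uB vB cc same commuting_sym[OF cc(2)] dA.closed dB.closed)
  show ?thesis
  proof (rule alg_hom_cong[OF hom_pair.pairing_alg_hom[OF hom_pair.intro[OF hA hB] AB]])
    fix t assume t: "t \<in> carrier H"
    show "tensor_comult t = pairing K A B ?T ?A ?B t"
      by (rule hom_pair.pairing_unique[OF hom_pair.intro[OF hA hB] tensor_comult_linear _ t])
        (use pairing_tensor_comult(1)[OF u v c] in \<open>simp add: HH.pairing_factors tensor_comult_closed\<close>)
  qed
qed

lemma tensor_counit_character: "character K H tensor_counit"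
proof -
  have "tensor_counit = pairing K A B (base_algebra K) (counit A) (counit B)"
    by (simp add: tensor_counit_def pairing_def)
  moreover have "commuting A B (base_algebra K) (counit A) (counit B)"
    by (simp add: commuting_def A.K.m_comm)
  ultimately show ?thesis
    using hom_pair.pairing_alg_hom[OF hom_pair.intro[OF eA.alg_hom_axioms eB.alg_hom_axioms]]
    by (simp add: character_def)
qed

lemma tensor_counit_ptens:
  "\<lbrakk>a \<in> carrier A; b \<in> carrier B\<rbrakk> \<Longrightarrow>
    tensor_counit (ptens K A B a b) = counit A a \<otimes>\<^bsub>K\<^esub> counit B b"
  using hom_pair.pairing_ptens[OF hom_pair.intro[OF eA.alg_hom_axioms eB.alg_hom_axioms]]
  by (simp add: tensor_counit_def pairing_def)

lemma tensor_counit_factors: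
  "a \<in> carrier A \<Longrightarrow> tensor_counit (iA a) = counit A a"
  "b \<in> carrier B \<Longrightarrow> tensor_counit (iB b) = counit B b"
  using eA.one eB.one
  by (simp_all add: left_factor_def right_factor_def tensor_counit_ptens)

lemma twist_product_counit_left:
  "tensor_lift K H H H (\<lambda>x y. tensor_counit x \<odot>\<^bsub>H\<^esub> y) twist_product = \<one>\<^bsub>H\<^esub>"
proof -
  interpret e: character K H tensor_counit by (rule tensor_counit_character)
  let ?u = "\<lambda>x. tensor_counit x \<odot>\<^bsub>H\<^esub> \<one>\<^bsub>H\<^esub>" and ?v = "\<lambda>x. x"
  note H = tensor_assoc_algebra
  have v: "alg_hom K H H ?v" and u: "alg_hom K H H ?u"
    by (rule alg_hom_id[OF H] e.scalar_alg_hom[OF H])+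
  have c: "commuting H H H ?u ?v" by (rule e.scalar_commuting[OF v])
  let ?A = "\<lambda>a. counit A a \<odot>\<^bsub>H\<^esub> \<one>\<^bsub>H\<^esub>" and ?B = "\<lambda>a. counit B a \<odot>\<^bsub>H\<^esub> \<one>\<^bsub>H\<^esub>"
  have A: "alg_hom K A H ?A" and B: "alg_hom K B H ?B"
    by (rule eA.scalar_alg_hom[OF H] eB.scalar_alg_hom[OF H])+
  have "twist_product \<in> carrier (H \<boxtimes>\<^bsub>K\<^esub> H)" using twist_product_Units by auto
  then have "tensor_lift K H H H (\<lambda>x y. tensor_counit x \<odot>\<^bsub>H\<^esub> y) twist_product
      = pairing K H H H ?u ?v twist_product"
    by (rule e.pairing_scalar_left[OF v, symmetric])
  also have "\<dots> = pairing K B A H ?B iA S \<otimes>\<^bsub>H\<^esub> (pairing K A A H ?A iA F1 \<otimes>\<^bsub>H\<^esub> pairing K B B H ?B iB F2)"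
    unfolding pairing_twist_product[OF u v c]
    by (intro arg_cong2[where f = "mult H"] hom_pair.pairing_cong hom_pair.intro A B
        iA.alg_hom_axioms iB.alg_hom_axioms elements_closed) (simp_all add: tensor_counit_factors)
  also have "\<dots> = \<one>\<^bsub>H\<^esub>"
    using F1 F2 S_counit_left[OF iA.alg_hom_axioms]
      eA.pairing_scalar_left[OF iA.alg_hom_axioms elements_closed(3)]
      eB.pairing_scalar_left[OF iB.alg_hom_axioms elements_closed(4)]
    by (simp add: twist_def counit_left_def)
  finally show ?thesis .
qed

lemma twist_product_counit_right:
  "tensor_lift K H H H (\<lambda>x y. tensor_counit y \<odot>\<^bsub>H\<^esub> x) twist_product = \<one>\<^bsub>H\<^esub>"
proof -
  interpret e: character K H tensor_counit by (rule tensor_counit_character)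
  let ?v = "\<lambda>x. tensor_counit x \<odot>\<^bsub>H\<^esub> \<one>\<^bsub>H\<^esub>" and ?u = "\<lambda>x. x"
  note H = tensor_assoc_algebra
  have u: "alg_hom K H H ?u" and v: "alg_hom K H H ?v"
    by (rule alg_hom_id[OF H] e.scalar_alg_hom[OF H])+
  have c: "commuting H H H ?u ?v" by (rule commuting_sym[OF e.scalar_commuting[OF u]])
  let ?A = "\<lambda>a. counit A a \<odot>\<^bsub>H\<^esub> \<one>\<^bsub>H\<^esub>" and ?B = "\<lambda>a. counit B a \<odot>\<^bsub>H\<^esub> \<one>\<^bsub>H\<^esub>"
  have A: "alg_hom K A H ?A" and B: "alg_hom K B H ?B"
    by (rule eA.scalar_alg_hom[OF H] eB.scalar_alg_hom[OF H])+
  have "twist_product \<in> carrier (H \<boxtimes>\<^bsub>K\<^esub> H)" using twist_product_Units by auto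
  then have "tensor_lift K H H H (\<lambda>x y. tensor_counit y \<odot>\<^bsub>H\<^esub> x) twist_product
      = pairing K H H H ?u ?v twist_product"
    by (rule e.pairing_scalar_right[OF u, symmetric])
  also have "\<dots> = pairing K B A H iB ?A S \<otimes>\<^bsub>H\<^esub> (pairing K A A H iA ?A F1 \<otimes>\<^bsub>H\<^esub> pairing K B B H iB ?B F2)"
    unfolding pairing_twist_product[OF u v c]
    by (intro arg_cong2[where f = "mult H"] hom_pair.pairing_cong hom_pair.intro A B
        iA.alg_hom_axioms iB.alg_hom_axioms elements_closed) (simp_all add: tensor_counit_factors)
  also have "\<dots> = \<one>\<^bsub>H\<^esub>"
    using F1 F2 S_counit_right[OF iB.alg_hom_axioms]
      eA.pairing_scalar_right[OF iA.alg_hom_axioms elements_closed(3)]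
      eB.pairing_scalar_right[OF iB.alg_hom_axioms elements_closed(4)]
    by (simp add: twist_def counit_right_def)
  finally show ?thesis .
qed

text \<open>The cocycle equation on three commuting copies of \<open>H = A \<otimes> B\<close>.  Write \<open>s\<^sub>i\<^sub>j\<close> for \<open>R\<inverse>\<close> with its
  \<open>B\<close>-leg in copy \<open>i\<close> and its \<open>A\<close>-leg in copy \<open>j\<close>, and \<open>f\<^sub>i\<^sub>j\<close>, \<open>g\<^sub>i\<^sub>j\<close> for \<open>F\<^sub>1\<close>, \<open>F\<^sub>2\<close> in copies \<open>i\<close> and \<open>j\<close>.
  The left side is \<open>s\<^sub>1\<^sub>2 s\<^sub>2\<^sub>3 s\<^sub>1\<^sub>3\<close>, the right side \<open>s\<^sub>2\<^sub>3 s\<^sub>1\<^sub>2 s\<^sub>1\<^sub>3\<close>, each times the common value of the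
  cocycle equations of \<open>F\<^sub>1\<close> and \<open>F\<^sub>2\<close>; and \<open>s\<^sub>1\<^sub>2\<close>, \<open>s\<^sub>2\<^sub>3\<close> commute, as they share no tensor factor.\<close>

lemma twist_product_cocycle:
  assumes "hom_triple K H H H T u1 u2 u3"
  shows "pairing K H H T u1 u2 twist_product
      \<otimes>\<^bsub>T\<^esub> pairing K H H T (\<lambda>x. pairing K H H T u1 u2 (tensor_comult x)) u3 twist_product
    = pairing K H H T u2 u3 twist_product
      \<otimes>\<^bsub>T\<^esub> pairing K H H T u1 (\<lambda>x. pairing K H H T u2 u3 (tensor_comult x)) twist_product"
proof -
  interpret u: hom_triple K H H H T u1 u2 u3 by fact
  define a1 a2 a3 where a_def: "a1 = (\<lambda>a. u1 (iA a))" "a2 = (\<lambda>a. u2 (iA a))" "a3 = (\<lambda>a. u3 (iA a))"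
  define b1 b2 b3 where b_def: "b1 = (\<lambda>b. u1 (iB b))" "b2 = (\<lambda>b. u2 (iB b))" "b3 = (\<lambda>b. u3 (iB b))"
  have hom: "alg_hom K A T a1" "alg_hom K A T a2" "alg_hom K A T a3"
    "alg_hom K B T b1" "alg_hom K B T b2" "alg_hom K B T b3"
    unfolding a_def b_def
    by (intro alg_hom_comp[OF iA.alg_hom_axioms] alg_hom_comp[OF iB.alg_hom_axioms]
        u.f.alg_hom_axioms u.g.alg_hom_axioms u.h.alg_hom_axioms)+
  have comm: "commuting A A T a1 a2" "commuting A A T a1 a3" "commuting A A T a2 a3"
    "commuting B B T b1 b2" "commuting B B T b1 b3" "commuting B B T b2 b3"
    "commuting A B T a1 b2" "commuting A B T a1 b3" "commuting A B T a2 b3"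
    "commuting B A T b1 a2" "commuting B A T b1 a3" "commuting B A T b2 a3"
    using u.fg u.fh u.gh by (auto simp: commuting_def a_def b_def)
  \<comment> \<open>Within one copy, \<open>A\<close> and \<open>B\<close> commute because \<open>a \<otimes> 1\<close> and \<open>1 \<otimes> b\<close> do.\<close>
  have same: "commuting A B T a1 b1" "commuting A B T a2 b2" "commuting A B T a3 b3"
    using factors_commuting
    by (auto simp: commuting_def a_def b_def u.f.mult[symmetric] u.g.mult[symmetric] u.h.mult[symmetric])
  note comm = comm comm[THEN commuting_sym] same same[THEN commuting_sym]
  have tA: "hom_triple K A A A T a1 a2 a3" and tB: "hom_triple K B B B T b1 b2 b3"
    and tBBA: "hom_triple K B B A T b1 b2 a3" and tBAA: "hom_triple K B A A T b1 a2 a3"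
    by (intro hom_triple.intro hom_triple_axioms.intro hom comm)+
  let ?da = "\<lambda>a. pairing K A A T a1 a2 (comult A a)"
  let ?da' = "\<lambda>a. pairing K A A T a2 a3 (comult A a)"
  let ?db = "\<lambda>b. pairing K B B T b1 b2 (comult B b)"
  let ?db' = "\<lambda>b. pairing K B B T b2 b3 (comult B b)"
  interpret A12: hom_pair K A A T a1 a2 by (intro hom_pair.intro hom)
  interpret A23: hom_pair K A A T a2 a3 by (intro hom_pair.intro hom)
  interpret B12: hom_pair K B B T b1 b2 by (intro hom_pair.intro hom)
  interpret B23: hom_pair K B B T b2 b3 by (intro hom_pair.intro hom)
  have dhom: "alg_hom K A T ?da" "alg_hom K A T ?da'" "alg_hom K B T ?db" "alg_hom K B T ?db'"
    by (rule alg_hom_comp[OF dA.alg_hom_axioms A12.pairing_alg_hom[OF comm(1)]]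
        alg_hom_comp[OF dA.alg_hom_axioms A23.pairing_alg_hom[OF comm(3)]]
        alg_hom_comp[OF dB.alg_hom_axioms B12.pairing_alg_hom[OF comm(4)]]
        alg_hom_comp[OF dB.alg_hom_axioms B23.pairing_alg_hom[OF comm(6)]])+
  note dA_comm = A12.commuting_pairing[THEN commuting_comp, OF _ _ _ dA.alg_hom_axioms]
    A23.commuting_pairing[THEN commuting_comp, OF _ _ _ dA.alg_hom_axioms]
  have d_comm: "commuting A A T ?da a3" "commuting A A T a1 ?da'"
    "commuting A B T ?da b1" "commuting A B T ?da b2" "commuting A B T ?da' b2" "commuting A B T ?da' b3"
    "commuting A B T ?da' b1"
    by (rule dA_comm(1) commuting_sym[OF dA_comm(2)] dA_comm(2); rule comm hom)+
  \<comment> \<open>The suffix 12 etc. names the copies of \<open>A \<otimes> B\<close> that hold the legs; \<open>ds\<close>, \<open>df\<close>, \<open>dg\<close> are the images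
    under \<open>\<Delta> \<otimes> Id\<close> and \<open>ds'\<close>, \<open>df'\<close>, \<open>dg'\<close> those under \<open>Id \<otimes> \<Delta>\<close>.\<close>
  define s12 s13 s23 where s_def: "s12 = pairing K B A T b1 a2 S" "s13 = pairing K B A T b1 a3 S"
    "s23 = pairing K B A T b2 a3 S"
  define f12 f23 g12 g23 where fg_def: "f12 = pairing K A A T a1 a2 F1" "f23 = pairing K A A T a2 a3 F1"
    "g12 = pairing K B B T b1 b2 F2" "g23 = pairing K B B T b2 b3 F2"
  define ds ds' where ds_def: "ds = pairing K B A T ?db a3 S" "ds' = pairing K B A T b1 ?da' S"
  define df df' where df_def: "df = pairing K A A T ?da a3 F1" "df' = pairing K A A T a1 ?da' F1"
  define dg dg' where dg_def: "dg = pairing K B B T ?db b3 F2" "dg' = pairing K B B T b1 ?db' F2"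
  have [simp]: "s12 \<in> carrier T" "s13 \<in> carrier T" "s23 \<in> carrier T"
    "f12 \<in> carrier T" "f23 \<in> carrier T" "g12 \<in> carrier T" "g23 \<in> carrier T"
    "ds \<in> carrier T" "ds' \<in> carrier T" "df \<in> carrier T" "df' \<in> carrier T"
    "dg \<in> carrier T" "dg' \<in> carrier T"
    unfolding s_def fg_def ds_def df_def dg_def
    by (rule hom_pair.pairing_closed; intro hom_pair.intro hom dhom elements_closed)+
  have cc: "f12 \<otimes>\<^bsub>T\<^esub> s23 = s23 \<otimes>\<^bsub>T\<^esub> f12" "f12 \<otimes>\<^bsub>T\<^esub> s13 = s13 \<otimes>\<^bsub>T\<^esub> f12"
    "s12 \<otimes>\<^bsub>T\<^esub> s23 = s23 \<otimes>\<^bsub>T\<^esub> s12" "g12 \<otimes>\<^bsub>T\<^esub> df = df \<otimes>\<^bsub>T\<^esub> g12"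
    "g23 \<otimes>\<^bsub>T\<^esub> ds' = ds' \<otimes>\<^bsub>T\<^esub> g23" "g23 \<otimes>\<^bsub>T\<^esub> df' = df' \<otimes>\<^bsub>T\<^esub> g23"
    unfolding s_def fg_def ds_def df_def
    by (rule pairings_commute; intro hom dhom comm d_comm d_comm[THEN commuting_sym] elements_closed)+
  have F: "f12 \<otimes>\<^bsub>T\<^esub> df = f23 \<otimes>\<^bsub>T\<^esub> df'" "g12 \<otimes>\<^bsub>T\<^esub> dg = g23 \<otimes>\<^bsub>T\<^esub> dg'"
    unfolding fg_def df_def dg_def by (rule A.twist_in[OF F1 tA] B.twist_in[OF F2 tB])+
  have S: "g12 \<otimes>\<^bsub>T\<^esub> ds = s23 \<otimes>\<^bsub>T\<^esub> s13 \<otimes>\<^bsub>T\<^esub> g12" "f23 \<otimes>\<^bsub>T\<^esub> ds' = s12 \<otimes>\<^bsub>T\<^esub> s13 \<otimes>\<^bsub>T\<^esub> f23"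
    unfolding fg_def ds_def s_def by (rule S_left[OF tBBA] S_right[OF tBAA])+
  have lhs1: "pairing K H H T u1 u2 twist_product = s12 \<otimes>\<^bsub>T\<^esub> (f12 \<otimes>\<^bsub>T\<^esub> g12)"
    unfolding pairing_twist_product[OF u.f.alg_hom_axioms u.g.alg_hom_axioms u.fg]
      s_def fg_def a_def b_def ..
  have rhs1: "pairing K H H T u2 u3 twist_product = s23 \<otimes>\<^bsub>T\<^esub> (f23 \<otimes>\<^bsub>T\<^esub> g23)"
    unfolding pairing_twist_product[OF u.g.alg_hom_axioms u.h.alg_hom_axioms u.gh]
      s_def fg_def a_def b_def ..
  note D12 = alg_hom_comp[OF tensor_comult_alg_hom u.pfg.alg_hom_axioms]
    and D23 = alg_hom_comp[OF tensor_comult_alg_hom u.pgh.alg_hom_axioms]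
  note D12_factors = pairing_tensor_comult(2,3)[OF u.f.alg_hom_axioms u.g.alg_hom_axioms u.fg,
      folded a_def b_def]
    and D23_factors = pairing_tensor_comult(2,3)[OF u.g.alg_hom_axioms u.h.alg_hom_axioms u.gh,
      folded a_def b_def]
  have lhs2: "pairing K H H T (\<lambda>x. pairing K H H T u1 u2 (tensor_comult x)) u3 twist_product
      = ds \<otimes>\<^bsub>T\<^esub> (df \<otimes>\<^bsub>T\<^esub> dg)"
    unfolding pairing_twist_product[OF D12 u.h.alg_hom_axioms
        commuting_comp[OF u.commuting_fg_h tensor_comult_alg_hom]] ds_def df_def dg_def
      a_def(3)[symmetric] b_def(3)[symmetric]
    by (intro arg_cong2[where f = "mult T"] hom_pair.pairing_cong hom_pair.intro hom dhom
        D12_factors elements_closed refl)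
  have rhs2: "pairing K H H T u1 (\<lambda>x. pairing K H H T u2 u3 (tensor_comult x)) twist_product
      = ds' \<otimes>\<^bsub>T\<^esub> (df' \<otimes>\<^bsub>T\<^esub> dg')"
    unfolding pairing_twist_product[OF u.f.alg_hom_axioms D23
        commuting_sym[OF commuting_comp[OF commuting_sym[OF u.commuting_f_gh] tensor_comult_alg_hom]]]
      ds_def df_def dg_def a_def(1)[symmetric] b_def(1)[symmetric]
    by (intro arg_cong2[where f = "mult T"] hom_pair.pairing_cong hom_pair.intro hom dhom
        D23_factors elements_closed refl)
  note assoc = u.f.T.A.m_assoc u.f.T.A.m_closed
  have "s12 \<otimes>\<^bsub>T\<^esub> (f12 \<otimes>\<^bsub>T\<^esub> g12) \<otimes>\<^bsub>T\<^esub> (ds \<otimes>\<^bsub>T\<^esub> (df \<otimes>\<^bsub>T\<^esub> dg))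
      = s12 \<otimes>\<^bsub>T\<^esub> f12 \<otimes>\<^bsub>T\<^esub> (g12 \<otimes>\<^bsub>T\<^esub> ds) \<otimes>\<^bsub>T\<^esub> df \<otimes>\<^bsub>T\<^esub> dg"
    by (simp add: assoc)
  also have "\<dots> = s12 \<otimes>\<^bsub>T\<^esub> (f12 \<otimes>\<^bsub>T\<^esub> s23) \<otimes>\<^bsub>T\<^esub> s13 \<otimes>\<^bsub>T\<^esub> (g12 \<otimes>\<^bsub>T\<^esub> df) \<otimes>\<^bsub>T\<^esub> dg"
    by (simp add: S assoc)
  also have "\<dots> = s12 \<otimes>\<^bsub>T\<^esub> s23 \<otimes>\<^bsub>T\<^esub> (f12 \<otimes>\<^bsub>T\<^esub> s13) \<otimes>\<^bsub>T\<^esub> df \<otimes>\<^bsub>T\<^esub> (g12 \<otimes>\<^bsub>T\<^esub> dg)"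
    unfolding cc(1,4) by (simp add: assoc)
  also have "\<dots> = s12 \<otimes>\<^bsub>T\<^esub> s23 \<otimes>\<^bsub>T\<^esub> s13 \<otimes>\<^bsub>T\<^esub> (f12 \<otimes>\<^bsub>T\<^esub> df) \<otimes>\<^bsub>T\<^esub> (g12 \<otimes>\<^bsub>T\<^esub> dg)"
    unfolding cc(2) by (simp add: assoc)
  also have "\<dots> = s23 \<otimes>\<^bsub>T\<^esub> (s12 \<otimes>\<^bsub>T\<^esub> s13 \<otimes>\<^bsub>T\<^esub> f23) \<otimes>\<^bsub>T\<^esub> (df' \<otimes>\<^bsub>T\<^esub> g23) \<otimes>\<^bsub>T\<^esub> dg'"
    unfolding cc(3) F by (simp add: assoc)
  also have "\<dots> = s23 \<otimes>\<^bsub>T\<^esub> f23 \<otimes>\<^bsub>T\<^esub> (ds' \<otimes>\<^bsub>T\<^esub> g23) \<otimes>\<^bsub>T\<^esub> df' \<otimes>\<^bsub>T\<^esub> dg'"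
    unfolding S(2)[symmetric] cc(6)[symmetric] by (simp add: assoc)
  also have "\<dots> = s23 \<otimes>\<^bsub>T\<^esub> (f23 \<otimes>\<^bsub>T\<^esub> g23) \<otimes>\<^bsub>T\<^esub> (ds' \<otimes>\<^bsub>T\<^esub> (df' \<otimes>\<^bsub>T\<^esub> dg'))"
    unfolding cc(5)[symmetric] by (simp add: assoc)
  finally show ?thesis by (simp only: lhs1 lhs2 rhs1 rhs2)
qed

lemma twist_product_is_twist: "twist K (tensor_bialgebra K A B) twist_product"
proof -
  let ?T = "H \<boxtimes>\<^bsub>K\<^esub> (H \<boxtimes>\<^bsub>K\<^esub> H)"
  define i1 where "i1 = left_factor K H (H \<boxtimes>\<^bsub>K\<^esub> H)"
  define i2 where "i2 = (\<lambda>x. right_factor K H (H \<boxtimes>\<^bsub>K\<^esub> H) (left_factor K H H x))"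
  define i3 where "i3 = (\<lambda>x. right_factor K H (H \<boxtimes>\<^bsub>K\<^esub> H) (right_factor K H H x))"
  interpret i: hom_triple K H H H ?T i1 i2 i3
    unfolding i1_def i2_def i3_def by (rule triple_embeddings(1)[OF tensor_assoc_algebra])
  have id: "i.triple t = t" if "t \<in> carrier ?T" for t
    using triple_embeddings(2)[OF tensor_assoc_algebra that] by (simp add: i1_def i2_def i3_def)
  have F: "twist_product \<in> carrier (H \<boxtimes>\<^bsub>K\<^esub> H)" using twist_product_Units by auto
  note D = tensor_comult_alg_hom
  have legs: "leg12 K H H H twist_product = pairing K H H ?T i1 i2 twist_product"
    "leg23 K H H H twist_product = pairing K H H ?T i2 i3 twist_product"
    "tensor_assoc K H H H (tensor_map K H H (H \<boxtimes>\<^bsub>K\<^esub> H) H tensor_comult (\<lambda>x. x) twist_product)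
      = pairing K H H ?T (\<lambda>x. pairing K H H ?T i1 i2 (tensor_comult x)) i3 twist_product"
    "tensor_map K H H H (H \<boxtimes>\<^bsub>K\<^esub> H) (\<lambda>x. x) tensor_comult twist_product
      = pairing K H H ?T i1 (\<lambda>x. pairing K H H ?T i2 i3 (tensor_comult x)) twist_product"
    using i.triple_leg12[OF F] i.triple_leg23[OF F] i.triple_comult_left[OF D F]
      i.triple_comult_right[OF D F]
    by (simp_all add: id i.leg12_closed[OF F] i.leg23_closed[OF F] i.comult_left_closed[OF D F]
        i.comult_right_closed[OF D F])
  show ?thesis
    unfolding twist_tensor_bialgebra tensor_comult_def[symmetric] tensor_counit_def[symmetric]
    by (intro conjI twist_product_Units twist_product_counit_left twist_product_counit_right)
      (simp only: legs twist_product_cocycle[OF i.hom_triple_axioms])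
qed

end

theorem lemma3p6:
  fixes K :: "('k, 'r) ring_scheme"
    and H1 :: "('k, 'a, 'm) bialgebra_scheme"
    and H2 :: "('k, 'b, 'n) bialgebra_scheme"
    and F1 :: "('k, 'a, 'a) tensor" and F2 :: "('k, 'b, 'b) tensor"
    and R :: "('k, 'b, 'a) tensor"
  assumes "field K"
    and "bialgebra K H1" and "bialgebra K H2"
    and "twist K H1 F1" and "twist K H2 F2"
    and "weak_R_matrix K (twisted_bialgebra K H2 F2) (twisted_bialgebra K H1 F1) R"
  shows "twist K (tensor_bialgebra K H1 H2)
    (inner_legs K H1 H2 H1 H2 (inv\<^bsub>H2 \<boxtimes>\<^bsub>K\<^esub> H1\<^esub> R)
      \<otimes>\<^bsub>(H1 \<boxtimes>\<^bsub>K\<^esub> H2) \<boxtimes>\<^bsub>K\<^esub> (H1 \<boxtimes>\<^bsub>K\<^esub> H2)\<^esub>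
     middle_flip K H1 H1 H2 H2 (ptens K (H1 \<boxtimes>\<^bsub>K\<^esub> H1) (H2 \<boxtimes>\<^bsub>K\<^esub> H2) F1 F2))"
proof -
  interpret twist_data K H1 H2 F1 F2 R
    by (intro twist_data.intro twist_data_axioms.intro assms)
  show ?thesis
    using twist_product_is_twist by (simp only: twist_product_def)
qed

end
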